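(* Let $X$ be a Lie rack with Leibniz algebra $\mathfrak x=T_1X$ and let $A$ be a smooth $As_p(X)$-module with Lie algebra $\mathfrak a=T_0A$. The maps $$\delta^n:CR^n_s(X,A^s)\to CL^n(\mathfrak x,\mathfrak a^s)\quad\text{and}\quad \delta^n:CR^n_s(X,A^a)\to CL^n(\mathfrak x,\mathfrak a^a)\qquad(n\ge1),$$ $$\delta^n(f)(a_1,\dots,a_n)=d^nf(1,\dots,1)\big((a_1,0,\dots,0),\dots,(0,\dots,0,a_n)\big)$$ ($d^nf$ the $n$-th differential of $f$), are morphisms of cochain complexes, i.e. $\delta^{n+1}(d_R^nf)=dL^n(\delta^n(f))$.
   Context: A pointed rack is a set $X$ with a product $\rhd$ and an element $1$ such that every $x\rhd-$ is a bijection, $x\rhd(y\rhd z)=(x\rhd y)\rhd(x\rhd z)$, $1\rhd x=x$, $x\rhd1=1$. A Lie rack is a smooth manifold with a pointed rack structure with smooth product such that each $c_x=x\rhd-$ is a diffeomorphism. Its Leibniz algebra is $\mathfrak x=T_1X$ with bracket $[u,v]=ad(u)(v)$, $ad=T_1Ad$, $Ad_x=T_1c_x$. A smooth $As_p(X)$-module is an abelian Lie group $A$ (written additively) with automorphisms $\rho_x$, $x\in X$, such that $\rho_{x\rhd y}=\rho_x\rho_y\rho_x^{-1}$, $\rho_1=id$, and $(x,a)\mapsto\rho_x(a)$ is smooth. $A^s$ denotes $A$ with $\phi_{x,y}=\rho_x$, $\psi_{x,y}=id-\rho_{x\rhd y}$; $A^a$ denotes $A$ with $\phi_{x,y}=\rho_x$,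 $\psi_{x,y}=0$. $CR^n_s(X,A)$ is the set of maps $f:X^n\to A$, smooth in a neighbourhood of $(1,\dots,1)$, with $f(x_1,\dots,x_n)=0$ whenever some $x_i=1$. With $x_1\rhd\dots\rhd x_k$ meaning $x_1\rhd(x_2\rhd(\cdots\rhd x_k))$, the differential is $$d_R^nf(x_1,\dots,x_{n+1})=\sum_{i=1}^n(-1)^{i-1}\Big(\phi_{x_1\rhd\dots\rhd x_i,\;x_1\rhd\dots\widehat{x_i}\dots\rhd x_{n+1}}\big(f(x_1,\dots,\widehat{x_i},\dots,x_{n+1})\big)-f(x_1,\dots,x_{i-1},x_i\rhd x_{i+1},\dots,x_i\rhd x_{n+1})\Big)+(-1)^{n-1}\psi_{x_1\rhd\dots\rhd x_n,\;x_1\rhd\dots\rhd x_{n-1}\rhd x_{n+1}}\big(f(x_1,\dots,x_n)\big).$$ $\mathfrak x$ acts on $\mathfrak a$ by $u.m=T_1\big(x\mapsto T_0\rho_x\big)(u)(m)$. $\mathfrak a^s$ is $\mathfrak a$ with $[u,m]_L=u.m$, $[m,u]_R=-u.m$; $\mathfrak a^a$ is $\mathfrak a$ with $[u,m]_L=u.m$, $[m,u]_R=0$. For such $M$, $CL^n(\mathfrak x,M)=Hom(\mathfrak x^{\otimes n},M)$ and $$dL^n\omega(x_0,\dots,x_n)=\sum_{i=0}^{n-1}(-1)^i[x_i,\omega(x_0,\dots,\widehat{x_i},\dots,x_n)]_L+(-1)^{n-1}[\omega(x_0,\dots,x_{n-1}),x_n]_R+\sum_{0\le i<j\le n}(-1)^{i+1}\omega(x_0,\dots,\widehat{x_i},\dots,x_{j-1},[x_i,x_j],x_{j+1},\dots,x_n).$$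 *)

theory Defs
  imports "HOL-Analysis.Analysis"
begin

section \<open>Smooth maps between normed spaces\<close>

fun Ck_on :: "nat \<Rightarrow> 'v::real_normed_vector set \<Rightarrow> ('v \<Rightarrow> 'w::real_normed_vector) \<Rightarrow> bool" where
  "Ck_on 0 S F \<longleftrightarrow> continuous_on S F"
| "Ck_on (Suc k) S F \<longleftrightarrow>
     (\<forall>x\<in>S. F differentiable (at x)) \<and> (\<forall>v. Ck_on k S (\<lambda>x. frechet_derivative F (at x) v))"

text \<open>Only used for open \<open>S\<close> and for functions that depend on finitely many real coordinates;
  there it says that all partial derivatives of all orders exist and are continuous.\<close>

definition smooth_on :: "'v::real_normed_vector set \<Rightarrow> ('v \<Rightarrow> 'w::real_normed_vector) \<Rightarrow> bool" where
  "smooth_on S F \<longleftrightarrow> (\<forall>k. Ck_on k S F)"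

text \<open>\<open>iter_deriv F [v\<^sub>1, \<dots>, v\<^sub>n] p\<close> is the \<open>n\<close>-th differential of \<open>F\<close> at \<open>p\<close>, evaluated at
  \<open>(v\<^sub>1, \<dots>, v\<^sub>n)\<close>.\<close>

fun iter_deriv :: "('v::real_normed_vector \<Rightarrow> 'w::real_normed_vector) \<Rightarrow> 'v list \<Rightarrow> 'v \<Rightarrow> 'w" where
  "iter_deriv F [] p = F p"
| "iter_deriv F (v # vs) p = frechet_derivative (\<lambda>q. iter_deriv F vs q) (at p) v"


section \<open>Smooth manifolds\<close>

text \<open>A manifold is a type of class t2, second countable, with an atlas of charts \<open>(U, \<phi>)\<close> with values
  in a finite-dimensional normed space \<open>'e\<close>.  A normed space with a finite spanning set is used
  instead of the class of Euclidean spaces, because the latter excludes dimension 0.\<close>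

type_synonym ('x, 'e) chart = "'x set \<times> ('x \<Rightarrow> 'e)"

definition cinv :: "('x, 'e) chart \<Rightarrow> 'e \<Rightarrow> 'x" where
  "cinv c = inv_into (fst c) (snd c)"

definition is_chart :: "('x::topological_space, 'e::real_normed_vector) chart \<Rightarrow> bool" where
  "is_chart c \<longleftrightarrow> open (fst c) \<and> open (snd c ` fst c) \<and>
     homeomorphism (fst c) (snd c ` fst c) (snd c) (cinv c)"

definition smooth_manifold ::
  "('x::{t2_space,second_countable_topology}, 'e::real_normed_vector) chart set \<Rightarrow> bool" where
  "smooth_manifold \<A> \<longleftrightarrow>
     (\<exists>B::'e set. finite B \<and> span B = UNIV) \<and>
     (\<forall>c\<in>\<A>. is_chart c) \<and>
     (\<Union>c\<in>\<A>. fst c) = UNIV \<and>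
     (\<forall>c\<in>\<A>. \<forall>c'\<in>\<A>. smooth_on (snd c ` (fst c \<inter> fst c')) (snd c' \<circ> cinv c))"

definition charts_at :: "('x, 'e) chart set \<Rightarrow> 'x \<Rightarrow> ('x, 'e) chart set" where
  "charts_at \<A> p = {c \<in> \<A>. p \<in> fst c}"

definition smooth_map ::
  "('x::topological_space, 'e::real_normed_vector) chart set \<Rightarrow>
   ('y::topological_space, 'f::real_normed_vector) chart set \<Rightarrow> ('x \<Rightarrow> 'y) \<Rightarrow> bool" where
  "smooth_map \<A> \<B> f \<longleftrightarrow>
     (\<forall>p. \<forall>c\<in>charts_at \<A> p. \<forall>d\<in>charts_at \<B> (f p).
        \<exists>W. open W \<and> p \<in> W \<and> W \<subseteq> fst c \<and> f ` W \<subseteq> fst d \<and>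
            smooth_on (snd c ` W) (snd d \<circ> f \<circ> cinv c))"

definition diffeomorphism ::
  "('x::topological_space, 'e::real_normed_vector) chart set \<Rightarrow>
   ('y::topological_space, 'f::real_normed_vector) chart set \<Rightarrow> ('x \<Rightarrow> 'y) \<Rightarrow> bool" where
  "diffeomorphism \<A> \<B> f \<longleftrightarrow> bij f \<and> smooth_map \<A> \<B> f \<and> smooth_map \<B> \<A> (inv f)"

definition prod_atlas ::
  "('x, 'e) chart set \<Rightarrow> ('y, 'f) chart set \<Rightarrow> ('x \<times> 'y, 'e \<times> 'f) chart set" where
  "prod_atlas \<A> \<B> = {(fst c \<times> fst d, map_prod (snd c) (snd d)) | c d. c \<in> \<A> \<and> d \<in> \<B>}"


section \<open>Tangent spaces\<close>

text \<open>A tangent vector at \<open>p\<close> is the family of its coordinate vectors in all charts around \<open>p\<close>,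
  transforming by the derivatives of the coordinate changes (and 0 at all other charts, so that
  equality of tangent vectors is equality of functions).  The vector space operations are
  pointwise.\<close>

type_synonym ('x, 'e) tvec = "('x, 'e) chart \<Rightarrow> 'e"

definition tangent_space ::
  "('x::topological_space, 'e::real_normed_vector) chart set \<Rightarrow> 'x \<Rightarrow> ('x, 'e) tvec set" where
  "tangent_space \<A> p = {u.
     (\<forall>c\<in>charts_at \<A> p. \<forall>c'\<in>charts_at \<A> p.
        u c' = frechet_derivative (snd c' \<circ> cinv c) (at (snd c p)) (u c)) \<and>
     (\<forall>c. c \<notin> charts_at \<A> p \<longrightarrow> u c = 0)}"

definition chart_at :: "('x, 'e) chart set \<Rightarrow> 'x \<Rightarrow> ('x, 'e) chart" where
  "chart_at \<A> p = (SOME c. c \<in> charts_at \<A> p)"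

text \<open>The tangent map \<open>T\<^sub>pf\<close>.\<close>

definition tmap ::
  "('x::topological_space, 'e::real_normed_vector) chart set \<Rightarrow>
   ('y::topological_space, 'f::real_normed_vector) chart set \<Rightarrow> 'x \<Rightarrow> ('x \<Rightarrow> 'y) \<Rightarrow>
   ('x, 'e) tvec \<Rightarrow> ('y, 'f) tvec" where
  "tmap \<A> \<B> p f u = (\<lambda>d. if d \<in> charts_at \<B> (f p)
     then let c = chart_at \<A> p in
       frechet_derivative (snd d \<circ> f \<circ> cinv c) (at (snd c p)) (u c)
     else 0)"

text \<open>The differential \<open>T\<^sub>pg\<close> of a map \<open>g\<close> from a manifold into the vector space of endomorphisms
  of some (fixed) tangent space; it is taken entry by entry, and \<open>T\<^sub>pg(u)\<close> is
  again such an endomorphism.\<close>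

definition tmap_End ::
  "('x::topological_space, 'e::real_normed_vector) chart set \<Rightarrow> 'x \<Rightarrow>
   ('x \<Rightarrow> ('y, 'f::real_normed_vector) tvec \<Rightarrow> ('y, 'f) tvec) \<Rightarrow>
   ('x, 'e) tvec \<Rightarrow> ('y, 'f) tvec \<Rightarrow> ('y, 'f) tvec" where
  "tmap_End \<A> p g u = (\<lambda>m d. let c = chart_at \<A> p in
     frechet_derivative (\<lambda>w. g (cinv c w) m d) (at (snd c p)) (u c))"


section \<open>Lie racks and their Leibniz algebras\<close>

definition pointed_rack :: "('x \<Rightarrow> 'x \<Rightarrow> 'x) \<Rightarrow> 'x \<Rightarrow> bool" where
  "pointed_rack r e \<longleftrightarrow>
     (\<forall>x. bij (r x)) \<and> (\<forall>x y z. r x (r y z) = r (r x y) (r x z)) \<and>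
     (\<forall>x. r e x = x) \<and> (\<forall>x. r x e = e)"

definition lie_rack ::
  "('x::{t2_space,second_countable_topology}, 'e::real_normed_vector) chart set \<Rightarrow>
   ('x \<Rightarrow> 'x \<Rightarrow> 'x) \<Rightarrow> 'x \<Rightarrow> bool" where
  "lie_rack \<A> r e \<longleftrightarrow> smooth_manifold \<A> \<and> pointed_rack r e \<and>
     smooth_map (prod_atlas \<A> \<A>) \<A> (\<lambda>(x, y). r x y) \<and>
     (\<forall>x. diffeomorphism \<A> \<A> (r x))"

definition Ad ::
  "('x::topological_space, 'e::real_normed_vector) chart set \<Rightarrow> ('x \<Rightarrow> 'x \<Rightarrow> 'x) \<Rightarrow> 'x \<Rightarrow>
   'x \<Rightarrow> ('x, 'e) tvec \<Rightarrow> ('x, 'e) tvec" where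
  "Ad \<A> r e x = tmap \<A> \<A> e (r x)"

definition ad ::
  "('x::topological_space, 'e::real_normed_vector) chart set \<Rightarrow> ('x \<Rightarrow> 'x \<Rightarrow> 'x) \<Rightarrow> 'x \<Rightarrow>
   ('x, 'e) tvec \<Rightarrow> ('x, 'e) tvec \<Rightarrow> ('x, 'e) tvec" where
  "ad \<A> r e = tmap_End \<A> e (Ad \<A> r e)"

definition bracket ::
  "('x::topological_space, 'e::real_normed_vector) chart set \<Rightarrow> ('x \<Rightarrow> 'x \<Rightarrow> 'x) \<Rightarrow> 'x \<Rightarrow>
   ('x, 'e) tvec \<Rightarrow> ('x, 'e) tvec \<Rightarrow> ('x, 'e) tvec" where
  "bracket \<A> r e u v = ad \<A> r e u v"


section \<open>Smooth modules over a Lie rack\<close>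

definition abelian_lie_group ::
  "('a::{t2_space,second_countable_topology,ab_group_add}, 'f::real_normed_vector) chart set \<Rightarrow> bool"
where
  "abelian_lie_group \<B> \<longleftrightarrow> smooth_manifold \<B> \<and>
     smooth_map (prod_atlas \<B> \<B>) \<B> (\<lambda>(a, b). a + b) \<and> smooth_map \<B> \<B> (\<lambda>a. - a)"

definition smooth_As_module ::
  "('x::{t2_space,second_countable_topology}, 'e::real_normed_vector) chart set \<Rightarrow>
   ('x \<Rightarrow> 'x \<Rightarrow> 'x) \<Rightarrow> 'x \<Rightarrow>
   ('a::{t2_space,second_countable_topology,ab_group_add}, 'f::real_normed_vector) chart set \<Rightarrow>
   ('x \<Rightarrow> 'a \<Rightarrow> 'a) \<Rightarrow> bool" where
  "smooth_As_module \<A> r e \<B> \<rho> \<longleftrightarrow> abelian_lie_group \<B> \<and>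
     (\<forall>x. diffeomorphism \<B> \<B> (\<rho> x) \<and> (\<forall>a b. \<rho> x (a + b) = \<rho> x a + \<rho> x b)) \<and>
     (\<forall>x y. \<rho> (r x y) = \<rho> x \<circ> \<rho> y \<circ> inv (\<rho> x)) \<and>
     \<rho> e = id \<and>
     smooth_map (prod_atlas \<A> \<B>) \<B> (\<lambda>(x, a). \<rho> x a)"

definition \<phi>_mod :: "('x \<Rightarrow> 'a \<Rightarrow> 'a) \<Rightarrow> 'x \<Rightarrow> 'x \<Rightarrow> 'a \<Rightarrow> 'a" where
  "\<phi>_mod \<rho> x y a = \<rho> x a"

definition \<psi>_s :: "('x \<Rightarrow> 'x \<Rightarrow> 'x) \<Rightarrow> ('x \<Rightarrow> 'a \<Rightarrow> 'a) \<Rightarrow> 'x \<Rightarrow> 'x \<Rightarrow> 'a::ab_group_add \<Rightarrow> 'a" where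
  "\<psi>_s r \<rho> x y a = a - \<rho> (r x y) a"

definition \<psi>_a :: "'x \<Rightarrow> 'x \<Rightarrow> 'a::ab_group_add \<Rightarrow> 'a" where
  "\<psi>_a x y a = 0"


section \<open>Rack cochains\<close>

text \<open>The point \<open>(x\<^sub>1, \<dots>, x\<^sub>n)\<close> of \<open>X\<^sup>n\<close> is a list of length \<open>n\<close>, so \<open>x\<^sub>i\<close> is \<open>xs ! (i - 1)\<close>; maps
  from \<open>X\<^sup>n\<close> are functions on lists whose values on lists of other lengths are irrelevant.\<close>

definition del :: "nat \<Rightarrow> 'b list \<Rightarrow> 'b list" where
  "del i xs = take i xs @ drop (Suc i) xs"

fun rprod :: "('x \<Rightarrow> 'x \<Rightarrow> 'x) \<Rightarrow> 'x list \<Rightarrow> 'x" where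
  "rprod r [] = undefined"
| "rprod r [x] = x"
| "rprod r (x # y # zs) = r x (rprod r (y # zs))"

text \<open>The model space of \<open>X\<^sup>n\<close> is \<open>E\<^sup>n\<close>. As there is no normed type \<open>E\<^sup>n\<close> with variable \<open>n\<close>, a function
  on (an open subset of) \<open>E\<^sup>n\<close> is regarded as a function on the space of bounded sequences in
  \<open>E\<close> that depends only on the first \<open>n\<close> terms \<open>v 0, \<dots>, v (n - 1)\<close>.\<close>

definition local_rep ::
  "('x, 'e::real_normed_vector) chart \<Rightarrow> ('a, 'f) chart \<Rightarrow> nat \<Rightarrow> ('x list \<Rightarrow> 'a) \<Rightarrow>
   (nat \<Rightarrow>\<^sub>C 'e) \<Rightarrow> 'f" where
  "local_rep c d n f v = snd d (f (map (\<lambda>i. cinv c (apply_bcontfun v i)) [0..<n]))"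

definition CR ::
  "('x::topological_space, 'e::real_normed_vector) chart set \<Rightarrow> 'x \<Rightarrow>
   ('a::{topological_space,ab_group_add}, 'f::real_normed_vector) chart set \<Rightarrow> nat \<Rightarrow>
   ('x list \<Rightarrow> 'a) set" where
  "CR \<A> e \<B> n = {f.
     (\<forall>c\<in>charts_at \<A> e. \<forall>d\<in>charts_at \<B> (f (replicate n e)).
        \<exists>W. open W \<and> e \<in> W \<and> W \<subseteq> fst c \<and>
            (\<forall>xs. length xs = n \<and> set xs \<subseteq> W \<longrightarrow> f xs \<in> fst d) \<and>
            smooth_on {v. \<forall>i<n. apply_bcontfun v i \<in> snd c ` W} (local_rep c d n f)) \<and>
     (\<forall>xs. length xs = n \<and> e \<in> set xs \<longrightarrow> f xs = 0)}"

text \<open>\<open>(-1)\<^sup>k a\<close> in an abelian group.\<close>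

definition signed :: "nat \<Rightarrow> 'a::ab_group_add \<Rightarrow> 'a" where
  "signed k a = (if even k then a else - a)"

definition dR ::
  "('x \<Rightarrow> 'x \<Rightarrow> 'x) \<Rightarrow> ('x \<Rightarrow> 'x \<Rightarrow> 'a \<Rightarrow> 'a) \<Rightarrow> ('x \<Rightarrow> 'x \<Rightarrow> 'a \<Rightarrow> 'a) \<Rightarrow> nat \<Rightarrow>
   ('x list \<Rightarrow> 'a::ab_group_add) \<Rightarrow> 'x list \<Rightarrow> 'a" where
  "dR r \<phi> \<psi> n f xs =
     (\<Sum>i = 1..n. signed (i - 1)
        (\<phi> (rprod r (take i xs)) (rprod r (del (i - 1) xs)) (f (del (i - 1) xs))
         - f (take (i - 1) xs @ map (r (xs ! (i - 1))) (drop i xs))))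
     + signed (n - 1)
        (\<psi> (rprod r (take n xs)) (rprod r (del (n - 1) xs)) (f (take n xs)))"


section \<open>Leibniz cochains\<close>

definition act ::
  "('x::topological_space, 'e::real_normed_vector) chart set \<Rightarrow> 'x \<Rightarrow>
   ('a::{topological_space,ab_group_add}, 'f::real_normed_vector) chart set \<Rightarrow> ('x \<Rightarrow> 'a \<Rightarrow> 'a) \<Rightarrow>
   ('x, 'e) tvec \<Rightarrow> ('a, 'f) tvec \<Rightarrow> ('a, 'f) tvec" where
  "act \<A> e \<B> \<rho> u m = tmap_End \<A> e (\<lambda>x. tmap \<B> \<B> 0 (\<rho> x)) u m"

text \<open>The left action \<open>[u, m]\<^sub>L = u.m\<close> is \<^const>\<open>act\<close> in both cases.\<close>

definition right_s ::
  "('x::topological_space, 'e::real_normed_vector) chart set \<Rightarrow> 'x \<Rightarrow>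
   ('a::{topological_space,ab_group_add}, 'f::real_normed_vector) chart set \<Rightarrow> ('x \<Rightarrow> 'a \<Rightarrow> 'a) \<Rightarrow>
   ('a, 'f) tvec \<Rightarrow> ('x, 'e) tvec \<Rightarrow> ('a, 'f) tvec" where
  "right_s \<A> e \<B> \<rho> m u = (\<lambda>d. - act \<A> e \<B> \<rho> u m d)"

definition right_a :: "('a, 'f::real_normed_vector) tvec \<Rightarrow> ('x, 'e) tvec \<Rightarrow> ('a, 'f) tvec" where
  "right_a m u = (\<lambda>d. 0)"

text \<open>Linear maps from the \<open>n\<close>-th tensor power of \<open>T\<^sub>eX\<close> to \<open>T\<^sub>0A\<close>, given as multilinear maps on
  lists of length \<open>n\<close>.\<close>

definition CL ::
  "('x::topological_space, 'e::real_normed_vector) chart set \<Rightarrow> 'x \<Rightarrow>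
   ('a::{topological_space,ab_group_add}, 'f::real_normed_vector) chart set \<Rightarrow> nat \<Rightarrow>
   (('x, 'e) tvec list \<Rightarrow> ('a, 'f) tvec) set" where
  "CL \<A> e \<B> n = {\<omega>. \<forall>us. length us = n \<and> set us \<subseteq> tangent_space \<A> e \<longrightarrow>
     \<omega> us \<in> tangent_space \<B> 0 \<and>
     (\<forall>i<n. \<forall>v\<in>tangent_space \<A> e. \<forall>w\<in>tangent_space \<A> e. \<forall>s t :: real.
        \<omega> (us[i := (\<lambda>c. s *\<^sub>R v c + t *\<^sub>R w c)])
        = (\<lambda>d. s *\<^sub>R \<omega> (us[i := v]) d + t *\<^sub>R \<omega> (us[i := w]) d))}"

text \<open>The arguments of \<open>dL\<^sup>n\<omega>\<close> are numbered from 0, as list positions are.\<close>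

definition dL ::
  "(('x, 'e) tvec \<Rightarrow> ('x, 'e) tvec \<Rightarrow> ('x, 'e) tvec) \<Rightarrow>
   (('x, 'e) tvec \<Rightarrow> ('a, 'f) tvec \<Rightarrow> ('a, 'f) tvec) \<Rightarrow>
   (('a, 'f) tvec \<Rightarrow> ('x, 'e) tvec \<Rightarrow> ('a, 'f) tvec) \<Rightarrow> nat \<Rightarrow>
   (('x, 'e) tvec list \<Rightarrow> ('a, 'f::real_normed_vector) tvec) \<Rightarrow>
   ('x, 'e) tvec list \<Rightarrow> ('a, 'f) tvec" where
  "dL br actL actR n \<omega> us = (\<lambda>d.
     (\<Sum>i<n. (- 1) ^ i *\<^sub>R actL (us ! i) (\<omega> (del i us)) d)
     + (- 1) ^ (n - 1) *\<^sub>R actR (\<omega> (take n us)) (us ! n) d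
     + (\<Sum>(i, j)\<in>{(i, j). i < j \<and> j \<le> n}.
          (- 1) ^ (i + 1) *\<^sub>R \<omega> (del i (us[j := br (us ! i) (us ! j)])) d))"


section \<open>The comparison map\<close>

text \<open>The element \<open>(0, \<dots>, 0, a, 0, \<dots>)\<close> with \<open>a\<close> at position \<open>i\<close>.\<close>

definition single :: "nat \<Rightarrow> 'e::real_normed_vector \<Rightarrow> (nat \<Rightarrow>\<^sub>C 'e)" where
  "single i a = Bcontfun (\<lambda>j. if j = i then a else 0)"

text \<open>The \<open>n\<close>-th differential is computed in the chart \<open>c\<close> of \<open>X\<close> around \<open>e\<close>, and its value, a tangent
  vector at \<open>0 = f(e, \<dots>, e)\<close>, is given by its coordinates in every chart \<open>d\<close> around 0.\<close>

definition delta ::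
  "('x, 'e::real_normed_vector) chart \<Rightarrow> 'x \<Rightarrow>
   ('a::{topological_space,ab_group_add}, 'f::real_normed_vector) chart set \<Rightarrow> nat \<Rightarrow>
   ('x list \<Rightarrow> 'a) \<Rightarrow> ('x, 'e) tvec list \<Rightarrow> ('a, 'f) tvec" where
  "delta c e \<B> n f us = (\<lambda>d. if d \<in> charts_at \<B> 0
     then iter_deriv (local_rep c d n f) (map (\<lambda>i. single i ((us ! i) c)) [0..<n])
            (const_bcontfun (snd c e))
     else 0)"

text \<open>\<open>\<delta>\<close> in degree \<open>n\<close> as part of a morphism of complexes: the cochain maps take values where they
  should, \<open>\<delta>\<^sup>n\<close> is additive, and the square formed by \<open>\<delta>\<^sup>n\<close>, \<open>\<delta>\<^sup>n\<^sup>+\<^sup>1\<close> and the differentials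
  \<open>D\<^sub>R\<close>, \<open>D\<^sub>L\<close> commutes.\<close>

definition cochain_morphism_at ::
  "('x::topological_space, 'e::real_normed_vector) chart set \<Rightarrow> 'x \<Rightarrow>
   ('a::{topological_space,ab_group_add}, 'f::real_normed_vector) chart set \<Rightarrow>
   (nat \<Rightarrow> ('x list \<Rightarrow> 'a) \<Rightarrow> 'x list \<Rightarrow> 'a) \<Rightarrow>
   (nat \<Rightarrow> (('x, 'e) tvec list \<Rightarrow> ('a, 'f) tvec) \<Rightarrow> ('x, 'e) tvec list \<Rightarrow> ('a, 'f) tvec) \<Rightarrow>
   (nat \<Rightarrow> ('x list \<Rightarrow> 'a) \<Rightarrow> ('x, 'e) tvec list \<Rightarrow> ('a, 'f) tvec) \<Rightarrow> nat \<Rightarrow> bool" where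
  "cochain_morphism_at \<A> e \<B> D\<^sub>R D\<^sub>L \<delta> n \<longleftrightarrow>
     (\<forall>f\<in>CR \<A> e \<B> n. D\<^sub>R n f \<in> CR \<A> e \<B> (n + 1)) \<and>
     (\<forall>f\<in>CR \<A> e \<B> n. \<delta> n f \<in> CL \<A> e \<B> n) \<and>
     (\<forall>f\<in>CR \<A> e \<B> n. \<forall>g\<in>CR \<A> e \<B> n. \<forall>us.
        length us = n \<and> set us \<subseteq> tangent_space \<A> e \<longrightarrow>
        \<delta> n (\<lambda>xs. f xs + g xs) us = (\<lambda>d. \<delta> n f us d + \<delta> n g us d)) \<and>
     (\<forall>f\<in>CR \<A> e \<B> n. \<forall>us.
        length us = n + 1 \<and> set us \<subseteq> tangent_space \<A> e \<longrightarrow>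
        \<delta> (n + 1) (D\<^sub>R n f) us = D\<^sub>L n (\<delta> n f) us)"

end

(* For a cochain f that vanishes when one of its arguments is the base point, the mixed differential
   delta f (a_1, ..., a_n) is the limit of f (x_1(t), ..., x_n(t)) / t^n as t tends to 0 from the
   right, for any curves x_i through the base point with velocities a_i. If instead x_j is moved by
   t^m b + o(t^m), then f changes by t^(n-1+m) delta f (a_1, ..., b, ..., a_n) + o(t^(n-1+m)).
   Along such curves, and up to o(t^(n+1)), the i-th summand of d_R f is rho_y(f) - f minus a
   telescoping sum in which the x_j are replaced one after the other by x_i |> x_j. The first part is
   of order t^(n+1) and yields the action, because rho_y - id vanishes both for y = 1 and at the zero
   of A. As x_i |> x_j - x_j is t^2 [a_i, a_j] + o(t^2) in a chart, the second part yields the bracket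
   terms. Such limits are insensitive to changes of charts and to the nonlinear addition of A, so no
   higher-order chain rule is needed. *)
theory Submission
  imports Defs
begin

section \<open>Coordinates on finite-dimensional normed spaces\<close>

text \<open>Both sides of the identity are leading coefficients, of order \<open>n + 1\<close>, of
  one and the same curve in \<open>A\<close>: the values of \<open>dR f\<close> along segments that
  are straight in a chart. Uniqueness of limits then gives equality. Vanishing on the coordinate
  faces is what makes such limits exist: of the 2^n corners of an iterated difference only one
  survives, or two when the base point leaves the face of one slot. A chart change acts on a leading
  coefficient of any order through its first derivative alone, as its quadratic remainder is of
  higher order. The obstacle is analytic. Powers of the model space are represented by the
  infinite-dimensional space of bounded sequences, and \<open>smooth_on\<close> gives continuity of
  derivatives only for each fixed direction. The functions concerned depend on finitely many bounded
  functionals; expanding directions in these upgrades directionwise continuity to joint continuity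
  in base point and directions, which is the input for estimating differences by
  derivatives.\<close>

lemma closed_span_insert:
  fixes a :: "'v::real_normed_vector"
  assumes cl: "closed (span B)"
  shows "closed (span (insert a B))"
proof (cases "a \<in> span B")
  case True
  then show ?thesis using cl by (simp add: span_redundant)
next
  case False
  define d where "d = infdist a (span B)"
  have ne: "span B \<noteq> {}" using span_zero by blast
  have d: "d > 0"
    unfolding d_def using False cl ne by (metis in_closed_iff_infdist_zero infdist_nonneg less_eq_real_def)
  \<comment> \<open>The norm controls the coefficient of \<open>a\<close>, because \<open>a\<close>
    has positive distance \<open>d\<close> from the closed subspace. Hence the coefficients of a
    convergent sequence are Cauchy.\<close>
  have far: "\<bar>k\<bar> * d \<le> norm (k *\<^sub>R a + s)" if "s \<in> span B" for k s
  proof (cases "k = 0")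
    case False
    have "d \<le> dist a (- (inverse k *\<^sub>R s))"
      unfolding d_def by (intro infdist_le span_neg span_scale that)
    also have "\<dots> = norm (inverse k *\<^sub>R (k *\<^sub>R a + s))"
      using False by (simp add: dist_norm scaleR_right_distrib)
    also have "\<dots> = inverse \<bar>k\<bar> * norm (k *\<^sub>R a + s)" by simp
    finally show ?thesis using False by (simp add: field_simps)
  qed simp
  have "x \<in> span (insert a B)"
    if y: "\<And>n. y n \<in> span (insert a B)" and lim: "y \<longlonglongrightarrow> x" for y x
  proof -
    from y have "\<forall>n. \<exists>k. y n - k *\<^sub>R a \<in> span B"
      by (auto simp: span_insert)
    then obtain k where k: "\<And>n. y n - k n *\<^sub>R a \<in> span B" by metis
    have "Cauchy k"
    proof (rule metric_CauchyI)
      fix \<epsilon> :: real assume "\<epsilon> > 0"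
      with d have "\<epsilon> * d > 0" by simp
      from metric_CauchyD[OF LIMSEQ_imp_Cauchy[OF lim] this]
      obtain M where M: "\<And>m n. m \<ge> M \<Longrightarrow> n \<ge> M \<Longrightarrow> dist (y m) (y n) < \<epsilon> * d" by blast
      have "dist (k m) (k n) < \<epsilon>" if "m \<ge> M" "n \<ge> M" for m n
      proof -
        have "\<bar>k m - k n\<bar> * d
            \<le> norm ((k m - k n) *\<^sub>R a + ((y m - k m *\<^sub>R a) - (y n - k n *\<^sub>R a)))"
          by (intro far span_diff k)
        also have "\<dots> = dist (y m) (y n)" by (simp add: dist_norm algebra_simps)
        also have "\<dots> < \<epsilon> * d" using M that by blast
        finally show ?thesis using d by (simp add: dist_real_def)
      qed
      then show "\<exists>M. \<forall>m\<ge>M. \<forall>n\<ge>M. dist (k m) (k n) < \<epsilon>" by blast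
    qed
    then obtain k0 where "k \<longlonglongrightarrow> k0" using Cauchy_convergent convergent_def by blast
    with lim have "(\<lambda>n. y n - k n *\<^sub>R a) \<longlonglongrightarrow> x - k0 *\<^sub>R a" by (intro tendsto_intros)
    then have "x - k0 *\<^sub>R a \<in> span B" by (rule closed_sequentially[OF cl k])
    then show ?thesis by (auto simp: span_insert)
  qed
  then show ?thesis unfolding closed_sequential_limits by blast
qed

lemma closed_span_finite:
  fixes B :: "'v::real_normed_vector set"
  shows "finite B \<Longrightarrow> closed (span B)"
  by (induction B rule: finite_induct) (simp_all add: closed_span_insert)

text \<open>The span of the other basis vectors is closed and misses \<open>b\<close>, so a vector
  with coefficient k at \<open>b\<close> has norm at least |k| times the distance from
  \<open>b\<close> to that span.\<close>

lemma bounded_linear_representation: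
  fixes B :: "'v::real_normed_vector set"
  assumes "finite B" "independent B" "span B = UNIV" "b \<in> B"
  shows "bounded_linear (\<lambda>x. representation B x b)"
proof -
  let ?S = "span (B - {b})"
  define d where "d = infdist b ?S"
  have ne: "?S \<noteq> {}" using span_zero by blast
  have "b \<notin> ?S" using assms(2,4) by (simp add: dependent_def)
  moreover have "closed ?S" using assms(1) by (intro closed_span_finite) simp
  ultimately have d: "d > 0"
    unfolding d_def using ne by (metis in_closed_iff_infdist_zero infdist_nonneg less_eq_real_def)
  have bd: "norm (representation B x b) \<le> norm x * inverse d" for x
  proof (cases "representation B x b = 0")
    case True
    then show ?thesis using d by simp
  next
    case False
    define k where "k = representation B x b"
    define s where "s = (\<Sum>b'\<in>B - {b}. representation B x b' *\<^sub>R b')"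
    have k: "k \<noteq> 0" using False by (simp add: k_def)
    have "(\<Sum>b'\<in>B. representation B x b' *\<^sub>R b') = x"
      using assms by (intro real_vector.sum_representation_eq) auto
    then have x: "x = k *\<^sub>R b + s"
      using assms(1,4) by (simp add: sum.remove k_def s_def)
    have "s \<in> ?S" unfolding s_def by (intro span_sum span_scale span_base)
    then have "d \<le> dist b (- (inverse k *\<^sub>R s))"
      unfolding d_def by (intro infdist_le span_neg span_scale)
    also have "\<dots> = norm (inverse k *\<^sub>R x)"
      using k by (simp add: dist_norm scaleR_right_distrib x)
    also have "\<dots> = inverse \<bar>k\<bar> * norm x" by simp
    finally show ?thesis using k d by (simp add: field_simps flip: k_def)
  qed
  show ?thesis
    using assms bd by (intro bounded_linear_intro[where K = "inverse d"])
      (simp_all add: real_vector.representation_add real_vector.representation_scale)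
qed

text \<open>The space of bounded sequences is infinite-dimensional, but the functions on it that occur depend
  only on finitely many bounded functionals \<open>l i\<close>; the vectors \<open>b i\<close> span the space modulo their
  common kernel.\<close>

definition fin_coords :: "'i set \<Rightarrow> ('i \<Rightarrow> 'v::real_normed_vector) \<Rightarrow> ('i \<Rightarrow> 'v \<Rightarrow> real) \<Rightarrow> bool" where
  "fin_coords I b l \<longleftrightarrow> finite I \<and> (\<forall>i\<in>I. bounded_linear (l i)) \<and>
     (\<forall>h. \<forall>i\<in>I. l i (h - (\<Sum>j\<in>I. l j h *\<^sub>R b j)) = 0)"

definition determined_by :: "'i set \<Rightarrow> ('i \<Rightarrow> 'v::real_normed_vector \<Rightarrow> real) \<Rightarrow> ('v \<Rightarrow> 'w) \<Rightarrow> bool" where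
  "determined_by I l G \<longleftrightarrow> (\<forall>y h. (\<forall>i\<in>I. l i h = 0) \<longrightarrow> G (y + h) = G y)"

text \<open>Meant for the model spaces of charts, where the functionals also separate points.
  Coefficient functionals of a spanning family pass easily to products and include dimension 0, with
  \<open>I\<close> empty.\<close>

definition full_coords :: "'i set \<Rightarrow> ('i \<Rightarrow> 'v::real_normed_vector) \<Rightarrow> ('i \<Rightarrow> 'v \<Rightarrow> real) \<Rightarrow> bool" where
  "full_coords I b l \<longleftrightarrow> finite I \<and> (\<forall>i\<in>I. bounded_linear (l i)) \<and>
     (\<forall>h. (\<Sum>j\<in>I. l j h *\<^sub>R b j) = h)"

lemma full_coords_fin_coords: "full_coords I b l \<Longrightarrow> fin_coords I b l"
  unfolding full_coords_def fin_coords_def by (auto simp: linear_simps)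

lemma full_coords_determined: "full_coords I b l \<Longrightarrow> determined_by I l G"
proof -
  assume "full_coords I b l"
  then have "h = 0" if "\<forall>i\<in>I. l i h = 0" for h
    using that unfolding full_coords_def by (metis (no_types, lifting) scale_eq_0_iff sum.neutral)
  then show ?thesis unfolding determined_by_def by (metis add.right_neutral)
qed

lemma full_coords_exists:
  assumes "finite B" "span B = (UNIV :: 'v::real_normed_vector set)"
  shows "\<exists>(I::'v set) (b::'v \<Rightarrow> 'v) l. full_coords I b l"
proof -
  obtain C where C: "C \<subseteq> B" "independent C" "B \<subseteq> span C"
    using maximal_independent_subset by blast
  then have "span C = UNIV" using assms(2)
    by (metis span_mono span_span top.extremum_uniqueI)
  moreover have "finite C" using C assms(1) finite_subset by blast
  ultimately have "full_coords C (\<lambda>x. x) (\<lambda>b x. representation C x b)"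
    unfolding full_coords_def using C
    by (auto intro!: bounded_linear_representation real_vector.sum_representation_eq)
  then show ?thesis by blast
qed

lemma full_coords_prod:
  assumes "full_coords I b l" "full_coords J b' l'"
  shows "full_coords (I <+> J) (case_sum (\<lambda>i. (b i, 0)) (\<lambda>j. (0, b' j)))
           (case_sum (\<lambda>i h. l i (fst h)) (\<lambda>j h. l' j (snd h)))"
proof -
  have "bounded_linear (\<lambda>h. l i (fst h))" if "i \<in> I" for i
    using assms that unfolding full_coords_def
    by (auto intro: bounded_linear_compose[OF _ bounded_linear_fst])
  moreover have "bounded_linear (\<lambda>h. l' i (snd h))" if "i \<in> J" for i
    using assms that unfolding full_coords_def
    by (auto intro: bounded_linear_compose[OF _ bounded_linear_snd])
  moreover have "(\<Sum>j\<in>I <+> J. case_sum (\<lambda>i h. l i (fst h)) (\<lambda>j h. l' j (snd h)) j h *\<^sub>R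
      case_sum (\<lambda>i. (b i, 0)) (\<lambda>j. (0, b' j)) j) = h" for h
    using assms unfolding full_coords_def
    by (cases h) (simp add: sum.Plus prod_eq_iff fst_sum snd_sum)
  ultimately show ?thesis
    using assms unfolding full_coords_def by auto
qed

section \<open>Bounded sequences as a substitute for powers of the model space\<close>

lemma bcontfun_nat [simp]: "(f :: nat \<Rightarrow> 'e::real_normed_vector) \<in> bcontfun \<longleftrightarrow> bounded (range f)"
  by (simp add: bcontfun_def)

lemma apply_single [simp]: "apply_bcontfun (single i a) j = (if j = i then a else 0)"
proof -
  have "range (\<lambda>j. if j = i then a else 0) \<subseteq> {a, 0}" by auto
  then have "bounded (range (\<lambda>j. if j = i then a else 0))"
    by (meson bounded_subset finite.emptyI finite.insertI finite_imp_bounded)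
  then show ?thesis
    unfolding single_def by (subst Bcontfun_inverse) auto
qed

lemma apply_sum_bcontfun [simp]:
  "apply_bcontfun (\<Sum>i\<in>I. F i) x = (\<Sum>i\<in>I. apply_bcontfun (F i) x)"
  by (induction I rule: infinite_finite_induct) auto

lemma norm_single [simp]: "norm (single i a) = norm a"
proof (rule antisym)
  show "norm (single i a) \<le> norm a" by (rule norm_bound) auto
  show "norm a \<le> norm (single i a)" using norm_bounded[of "single i a" i] by simp
qed

lemma bounded_linear_single: "bounded_linear (single i)"
  by (rule bounded_linear_intro[where K = 1]) (auto intro!: bcontfun_eqI)

lemma bounded_linear_apply_bcontfun:
  "bounded_linear (\<lambda>v :: 'b::topological_space \<Rightarrow>\<^sub>C 'e::real_normed_vector. apply_bcontfun v x)"
  by (rule bounded_linear_intro[where K = 1]) (auto intro: norm_bounded)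

text \<open>Subtracting the first \<open>n\<close> terms leaves a tail that the functionals do not
  see, so this is \<open>fin_coords\<close> but in general not \<open>full_coords\<close>.\<close>

lemma fin_coords_sequences:
  assumes "full_coords I b l"
  shows "fin_coords ({..<n} \<times> I) (\<lambda>(k, i). single k (b i)) (\<lambda>(k, i) v. l i (apply_bcontfun v k))"
proof -
  have "bounded_linear (\<lambda>v. l i (apply_bcontfun v k))" if "i \<in> I" for i and k :: nat
    using assms that unfolding full_coords_def
    by (auto intro: bounded_linear_compose[OF _ bounded_linear_apply_bcontfun])
  moreover have "l i (apply_bcontfun (h - (\<Sum>(k', i')\<in>{..<n} \<times> I. l i' (apply_bcontfun h k') *\<^sub>R single k' (b i'))) k) = 0"
    if "k < n" "i \<in> I" for h k i
  proof -
    have "apply_bcontfun (\<Sum>(k', i')\<in>{..<n} \<times> I. l i' (apply_bcontfun h k') *\<^sub>R single k' (b i')) k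
      = (\<Sum>k'<n. \<Sum>i'\<in>I. l i' (apply_bcontfun h k') *\<^sub>R (if k = k' then b i' else 0))"
      by (simp add: sum.cartesian_product case_prod_unfold)
    also have "\<dots> = (\<Sum>k'<n. if k = k' then \<Sum>i'\<in>I. l i' (apply_bcontfun h k') *\<^sub>R b i' else 0)"
      by (intro sum.cong refl) auto
    also have "\<dots> = apply_bcontfun h k"
      using that assms by (simp add: full_coords_def)
    finally show ?thesis using that assms by (simp add: full_coords_def linear_simps)
  qed
  ultimately show ?thesis
    using assms unfolding fin_coords_def full_coords_def
    by (auto simp: case_prod_unfold)
qed

lemma determined_by_local_rep:
  assumes "full_coords I b l"
  shows "determined_by ({..<n} \<times> I) (\<lambda>(k, i) v. l i (apply_bcontfun v k)) (local_rep c d n f)"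
proof -
  have zero: "apply_bcontfun h k = 0"
    if "\<forall>p\<in>{..<n} \<times> I. (case p of (k, i) \<Rightarrow> \<lambda>v. l i (apply_bcontfun v k)) h = 0" "k < n" for h k
  proof -
    have "\<forall>i\<in>I. l i (apply_bcontfun h k) = 0" using that by auto
    then have "(\<Sum>i\<in>I. l i (apply_bcontfun h k) *\<^sub>R b i) = 0" by simp
    then show ?thesis using assms by (simp add: full_coords_def)
  qed
  have "map (\<lambda>i. cinv c (apply_bcontfun (y + h) i)) [0..<n]
      = map (\<lambda>i. cinv c (apply_bcontfun y i)) [0..<n]"
    if "\<forall>p\<in>{..<n} \<times> I. (case p of (k, i) \<Rightarrow> \<lambda>v. l i (apply_bcontfun v k)) h = 0" for y h
    using zero[OF that] by simp
  then show ?thesis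
    unfolding determined_by_def local_rep_def by metis
qed

section \<open>Smooth maps and iterated derivatives\<close>

text \<open>Holds even at points without a derivative: \<open>frechet_derivative\<close> is a choice
  from the set of all derivatives, and the two sets agree.\<close>

lemma frechet_derivative_cong_open:
  assumes "open S" "x \<in> S" "\<And>y. y \<in> S \<Longrightarrow> F y = G y"
  shows "frechet_derivative F (at x) = frechet_derivative G (at x)"
proof -
  have "(F has_derivative D) (at x) \<longleftrightarrow> (G has_derivative D) (at x)" for D
    using has_derivative_transform_within_open[of _ _ x UNIV S] assms by metis
  then show ?thesis unfolding frechet_derivative_def by simp
qed

lemma frechet_derivative_shift:
  "frechet_derivative G (at (y + h)) = frechet_derivative (\<lambda>x. G (x + h)) (at y)"
proof -
  have shift: "((\<lambda>x. G (x + h)) has_derivative D) (at y)" if "(G has_derivative D) (at (y + h))"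
    for G :: "'a \<Rightarrow> 'b" and y h D
  proof -
    have "((\<lambda>x. x + h) has_derivative (\<lambda>x. x)) (at y)" by (auto intro!: derivative_eq_intros)
    from has_derivative_compose[OF this that] show ?thesis .
  qed
  have "(G has_derivative D) (at (y + h)) \<longleftrightarrow> ((\<lambda>x. G (x + h)) has_derivative D) (at y)" for D
    using shift[of G D y h] shift[of "\<lambda>x. G (x + h)" D "y + h" "- h"] by auto
  then show ?thesis unfolding frechet_derivative_def by simp
qed

text \<open>Invariance under translation by the common kernel passes to derivatives, so the
  dependence on finitely many functionals survives repeated differentiation.\<close>

lemma determined_by_deriv:
  "determined_by I l G \<Longrightarrow> determined_by I l (\<lambda>y. frechet_derivative G (at y) u)"
  unfolding determined_by_def by (simp add: frechet_derivative_shift)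

lemma frechet_derivative_linear:
  "F differentiable (at x) \<Longrightarrow> linear (frechet_derivative F (at x))"
  by (simp add: frechet_derivative_works has_derivative_linear)

text \<open>Along the common kernel \<open>G\<close> is constant, so its derivative vanishes there,
  and \<open>h\<close> differs from its coordinate expansion by a kernel vector. Only the finitely
  many directions \<open>b i\<close> remain.\<close>

lemma frechet_derivative_coords:
  assumes co: "fin_coords I b l" and det: "determined_by I l G" and diff: "G differentiable (at y)"
  shows "frechet_derivative G (at y) h = (\<Sum>i\<in>I. l i h *\<^sub>R frechet_derivative G (at y) (b i))"
proof -
  interpret D: linear "frechet_derivative G (at y)"
    using diff by (rule frechet_derivative_linear)
  have bl: "bounded_linear (l i)" if "i \<in> I" for i using co that by (simp add: fin_coords_def)
  have kernel: "frechet_derivative G (at y) k = 0" if k: "\<forall>i\<in>I. l i k = 0" for k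
  proof -
    have "G (y + t *\<^sub>R k) = G y" for t
      using det k bl unfolding determined_by_def by (simp add: linear_simps)
    then have "((\<lambda>t. G (y + t *\<^sub>R k)) has_derivative (\<lambda>t. 0)) (at 0)" by simp
    moreover have "((\<lambda>t. G (y + t *\<^sub>R k)) has_derivative (\<lambda>t. frechet_derivative G (at y) (t *\<^sub>R k))) (at 0)"
      using diff by (intro has_derivative_compose[where f = "\<lambda>t. y + t *\<^sub>R k" and g = G])
        (auto intro!: derivative_eq_intros simp: frechet_derivative_works)
    ultimately have "(\<lambda>t::real. 0) = (\<lambda>t. frechet_derivative G (at y) (t *\<^sub>R k))"
      by (rule has_derivative_unique)
    then have "0 = frechet_derivative G (at y) (1 *\<^sub>R k)" by meson
    then show ?thesis by simp
  qed
  have "frechet_derivative G (at y) (h - (\<Sum>i\<in>I. l i h *\<^sub>R b i)) = 0"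
    using co by (intro kernel) (simp add: fin_coords_def)
  then show ?thesis by (simp add: D.diff D.sum D.scale)
qed

section \<open>Closure properties of C^k and smooth maps\<close>

lemma Ck_cong:
  assumes "open S"
  shows "(\<And>x. x \<in> S \<Longrightarrow> F x = G x) \<Longrightarrow> Ck_on k S F \<longleftrightarrow> Ck_on k S G"
proof (induction k arbitrary: F G)
  case 0
  then show ?case using continuous_on_cong by (metis Ck_on.simps(1))
next
  case (Suc k)
  have fd: "frechet_derivative F (at x) = frechet_derivative G (at x)" if "x \<in> S" for x
    using frechet_derivative_cong_open[OF assms that] Suc.prems by blast
  have "F differentiable (at x) \<longleftrightarrow> G differentiable (at x)" if "x \<in> S" for x
    using assms Suc.prems that unfolding differentiable_def
    by (metis has_derivative_transform_within_open)
  moreover have "Ck_on k S (\<lambda>x. frechet_derivative F (at x) v)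
      \<longleftrightarrow> Ck_on k S (\<lambda>x. frechet_derivative G (at x) v)" for v
    by (rule Suc.IH) (simp add: fd)
  ultimately show ?case by simp
qed

lemma frechet_derivative_eq: "(F has_derivative D) (at x) \<Longrightarrow> frechet_derivative F (at x) v = D v"
  by (metis frechet_derivative_at)

lemma Ck_Suc_has_derivative:
  assumes "open S" and der: "\<And>x. x \<in> S \<Longrightarrow> (F has_derivative D x) (at x)"
    and "\<And>v. Ck_on k S (\<lambda>x. D x v)"
  shows "Ck_on (Suc k) S F"
proof -
  have "Ck_on k S (\<lambda>x. frechet_derivative F (at x) v) \<longleftrightarrow> Ck_on k S (\<lambda>x. D x v)" for v
    by (rule Ck_cong[OF assms(1)]) (simp add: frechet_derivative_eq[OF der])
  then show ?thesis using assms by (auto simp: differentiable_def)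
qed

lemma Ck_subset: "Ck_on k S F \<Longrightarrow> T \<subseteq> S \<Longrightarrow> Ck_on k T F"
  by (induction k arbitrary: F) (auto intro: continuous_on_subset)

lemma Ck_Suc_imp: "Ck_on (Suc k) S F \<Longrightarrow> Ck_on k S F"
proof (induction k arbitrary: F)
  case 0
  then show ?case
    by (auto intro!: continuous_at_imp_continuous_on differentiable_imp_continuous_within)
next
  case (Suc k)
  then show ?case by (metis Ck_on.simps(2))
qed

lemma Ck_const: "Ck_on k S (\<lambda>x. a)"
  by (induction k arbitrary: a) auto

lemma Ck_add:
  assumes "open S"
  shows "Ck_on k S F \<Longrightarrow> Ck_on k S G \<Longrightarrow> Ck_on k S (\<lambda>x. F x + G x)"
proof (induction k arbitrary: F G)
  case 0
  then show ?case by (simp add: continuous_on_add)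
next
  case (Suc k)
  show ?case
    by (rule Ck_Suc_has_derivative[OF assms, where D = "\<lambda>x v. frechet_derivative F (at x) v + frechet_derivative G (at x) v"])
      (use Suc in \<open>auto intro!: has_derivative_add simp: frechet_derivative_works\<close>)
qed

lemma Ck_sum:
  assumes "open S"
  shows "(\<And>i. i \<in> I \<Longrightarrow> Ck_on k S (F i)) \<Longrightarrow> Ck_on k S (\<lambda>x. \<Sum>i\<in>I. F i x)"
  by (induction I rule: infinite_finite_induct) (auto intro: Ck_const Ck_add[OF assms])

lemma Ck_bounded_linear_compose:
  assumes L: "bounded_linear L" and S: "open S"
  shows "Ck_on k S F \<Longrightarrow> Ck_on k S (\<lambda>x. L (F x))"
proof (induction k arbitrary: F)
  case 0
  then show ?case using L by (simp add: bounded_linear.continuous_on)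
next
  case (Suc k)
  have der: "((\<lambda>x. L (F x)) has_derivative (\<lambda>v. L (frechet_derivative F (at x) v))) (at x)" if "x \<in> S" for x
    using Suc.prems that by (intro bounded_linear.has_derivative[OF L]) (simp add: frechet_derivative_works)
  show ?case by (rule Ck_Suc_has_derivative[OF S der]) (use Suc in auto)
qed

lemma Ck_scaleR:
  assumes "open S"
  shows "Ck_on k S \<alpha> \<Longrightarrow> Ck_on k S F \<Longrightarrow> Ck_on k S (\<lambda>x. \<alpha> x *\<^sub>R F x)"
proof (induction k arbitrary: \<alpha> F)
  case 0
  then show ?case by (simp add: continuous_on_scaleR)
next
  case (Suc k)
  have der: "((\<lambda>x. \<alpha> x *\<^sub>R F x) has_derivative
      (\<lambda>v. \<alpha> x *\<^sub>R frechet_derivative F (at x) v + frechet_derivative \<alpha> (at x) v *\<^sub>R F x)) (at x)"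
    if "x \<in> S" for x
    using Suc.prems that by (intro has_derivative_scaleR) (simp_all add: frechet_derivative_works)
  have "Ck_on k S (\<lambda>x. \<alpha> x *\<^sub>R frechet_derivative F (at x) v + frechet_derivative \<alpha> (at x) v *\<^sub>R F x)" for v
    using Suc.prems by (intro Ck_add[OF assms] Suc.IH) (auto intro: Ck_Suc_imp)
  with der show ?case by (rule Ck_Suc_has_derivative[OF assms])
qed

lemma smooth_on_differentiable: "smooth_on S F \<Longrightarrow> x \<in> S \<Longrightarrow> F differentiable (at x)"
  unfolding smooth_on_def by (metis Ck_on.simps(2))

lemma smooth_on_has_derivative:
  "smooth_on S F \<Longrightarrow> x \<in> S \<Longrightarrow> (F has_derivative frechet_derivative F (at x)) (at x)"
  using smooth_on_differentiable frechet_derivative_works by blast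

lemma smooth_on_deriv: "smooth_on S F \<Longrightarrow> smooth_on S (\<lambda>x. frechet_derivative F (at x) v)"
  unfolding smooth_on_def by (metis Ck_on.simps(2))

lemma smooth_on_continuous: "smooth_on S F \<Longrightarrow> continuous_on S F"
  unfolding smooth_on_def by (metis Ck_on.simps(1))

lemma smooth_on_subset: "smooth_on S F \<Longrightarrow> T \<subseteq> S \<Longrightarrow> smooth_on T F"
  unfolding smooth_on_def using Ck_subset by blast

lemma smooth_on_cong:
  "open S \<Longrightarrow> (\<And>x. x \<in> S \<Longrightarrow> F x = G x) \<Longrightarrow> smooth_on S F \<longleftrightarrow> smooth_on S G"
  unfolding smooth_on_def using Ck_cong by metis

text \<open>Continuity of the derivative is only known for each fixed direction; expanding the inner
  derivative in finitely many coordinates turns the chain rule into products of smooth functions.\<close>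

lemma smooth_on_compose:
  assumes S: "open S" and T: "open T" and FST: "F ` S \<subseteq> T"
    and F: "smooth_on S F" and G: "smooth_on T G"
    and co: "fin_coords I b l" and det: "determined_by I l G"
  shows "smooth_on S (\<lambda>x. G (F x))"
proof -
  \<comment> \<open>The induction varies the outer map and keeps \<open>F\<close>: the chain rule
    produces derivatives of \<open>G\<close> along \<open>b i\<close>, composed with the same
    \<open>F\<close> and determined by the same functionals.\<close>
  have "Ck_on k S (\<lambda>x. G (F x))" for k
    using G det
  proof (induction k arbitrary: G)
    case 0
    have "continuous_on (F ` S) G"
      by (rule continuous_on_subset[OF smooth_on_continuous[OF 0(1)] FST])
    with smooth_on_continuous[OF F] have "continuous_on S (G \<circ> F)" by (rule continuous_on_compose)
    then show ?case by (simp only: Ck_on.simps o_def)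
  next
    case (Suc k)
    have der: "((\<lambda>x. G (F x)) has_derivative
        (\<lambda>v. frechet_derivative G (at (F x)) (frechet_derivative F (at x) v))) (at x)" if "x \<in> S" for x
    proof -
      have "F x \<in> T" using FST that by blast
      from has_derivative_compose[OF smooth_on_has_derivative[OF F that]
          smooth_on_has_derivative[OF Suc.prems(1) this]]
      show ?thesis .
    qed
    have "Ck_on k S (\<lambda>x. \<Sum>i\<in>I. l i (frechet_derivative F (at x) v) *\<^sub>R frechet_derivative G (at (F x)) (b i))" for v
    proof (rule Ck_sum[OF S], rule Ck_scaleR[OF S])
      fix i assume "i \<in> I"
      then have "bounded_linear (l i)" using co by (simp add: fin_coords_def)
      moreover have "Ck_on k S (\<lambda>x. frechet_derivative F (at x) v)"
        using smooth_on_deriv[OF F] unfolding smooth_on_def by simp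
      ultimately show "Ck_on k S (\<lambda>x. l i (frechet_derivative F (at x) v))"
        using Ck_bounded_linear_compose[OF _ S] by blast
      show "Ck_on k S (\<lambda>x. frechet_derivative G (at (F x)) (b i))"
        by (rule Suc.IH[OF smooth_on_deriv[OF Suc.prems(1)] determined_by_deriv[OF Suc.prems(2)]])
    qed
    moreover have "frechet_derivative G (at (F x)) (frechet_derivative F (at x) v)
        = (\<Sum>i\<in>I. l i (frechet_derivative F (at x) v) *\<^sub>R frechet_derivative G (at (F x)) (b i))"
      if "x \<in> S" for x v
    proof -
      have "F x \<in> T" using FST that by blast
      then show ?thesis
        by (intro frechet_derivative_coords[OF co Suc.prems(2)] smooth_on_differentiable[OF Suc.prems(1)])
    qed
    then have "Ck_on k S (\<lambda>x. frechet_derivative G (at (F x)) (frechet_derivative F (at x) v))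
      \<longleftrightarrow> Ck_on k S (\<lambda>x. \<Sum>i\<in>I. l i (frechet_derivative F (at x) v) *\<^sub>R frechet_derivative G (at (F x)) (b i))" for v
      by (intro Ck_cong[OF S])
    ultimately have "Ck_on k S (\<lambda>x. frechet_derivative G (at (F x)) (frechet_derivative F (at x) v))" for v
      by simp
    with der show ?case by (rule Ck_Suc_has_derivative[OF S])
  qed
  then show ?thesis by (simp add: smooth_on_def)
qed

lemma smooth_on_const: "smooth_on S (\<lambda>x. a)"
  by (simp add: smooth_on_def Ck_const)

lemma smooth_on_bounded_linear_compose:
  "bounded_linear L \<Longrightarrow> open S \<Longrightarrow> smooth_on S F \<Longrightarrow> smooth_on S (\<lambda>x. L (F x))"
  by (simp add: smooth_on_def Ck_bounded_linear_compose)

lemma smooth_on_id: "smooth_on S (\<lambda>x. x)"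
proof -
  have "Ck_on k S (\<lambda>x. x)" for k
  proof (cases k)
    case (Suc m)
    have "frechet_derivative (\<lambda>x::'a. x) (at x) v = v" for x v
      by (rule frechet_derivative_eq) (rule has_derivative_ident)
    then show ?thesis unfolding Suc by (simp add: Ck_const)
  qed simp
  then show ?thesis by (simp add: smooth_on_def)
qed

lemma smooth_on_sum:
  "open S \<Longrightarrow> (\<And>i. i \<in> I \<Longrightarrow> smooth_on S (F i)) \<Longrightarrow> smooth_on S (\<lambda>x. \<Sum>i\<in>I. F i x)"
  by (simp add: smooth_on_def Ck_sum)

lemma smooth_on_add:
  "open S \<Longrightarrow> smooth_on S F \<Longrightarrow> smooth_on S G \<Longrightarrow> smooth_on S (\<lambda>x. F x + G x)"
  by (simp add: smooth_on_def Ck_add)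

lemma smooth_on_Pair:
  assumes "open S" "smooth_on S F" "smooth_on S G"
  shows "smooth_on S (\<lambda>x. (F x, G x))"
proof -
  have "bounded_linear (\<lambda>y::'b. (y, 0::'c))" "bounded_linear (\<lambda>y::'c. (0::'b, y))"
    by (intro bounded_linear_Pair bounded_linear_ident bounded_linear_zero)+
  then have "smooth_on S (\<lambda>x. (F x, 0) + (0, G x))"
    using assms by (intro smooth_on_add) (auto intro: smooth_on_bounded_linear_compose)
  then show ?thesis by simp
qed

section \<open>Iterated directional derivatives\<close>

lemma iter_deriv_Nil: "iter_deriv F [] = F"
  by (rule ext) simp

lemma iter_deriv_Cons: "iter_deriv F (v # vs) = (\<lambda>q. frechet_derivative (iter_deriv F vs) (at q) v)"
  by (rule ext) simp

lemma iter_deriv_append: "iter_deriv F (us @ vs) = iter_deriv (iter_deriv F vs) us"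
  by (induction us) (simp_all only: append_Nil append_Cons iter_deriv_Nil iter_deriv_Cons)

text \<open>The last vector of the list is differentiated first. Induction from the end of the list
  therefore replaces \<open>F\<close> by one of its directional derivatives.\<close>

lemma iter_deriv_snoc:
  "iter_deriv F (vs @ [v]) = iter_deriv (\<lambda>q. frechet_derivative F (at q) v) vs"
  by (simp only: iter_deriv_append iter_deriv_Cons iter_deriv_Nil)

lemma smooth_on_iter_deriv: "smooth_on S F \<Longrightarrow> smooth_on S (iter_deriv F vs)"
  by (induction vs) (simp_all only: iter_deriv_Nil iter_deriv_Cons smooth_on_deriv)

lemma iter_deriv_cong:
  assumes "open S" "\<And>x. x \<in> S \<Longrightarrow> F x = G x"
  shows "x \<in> S \<Longrightarrow> iter_deriv F vs x = iter_deriv G vs x"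
proof (induction vs arbitrary: x)
  case (Cons v vs)
  then show ?case
    using frechet_derivative_cong_open[OF assms(1), of x "iter_deriv F vs" "iter_deriv G vs"]
    by simp
qed (simp add: assms)

lemma iter_deriv_sum:
  assumes S: "open S" and F: "\<And>i. i \<in> I \<Longrightarrow> smooth_on S (F i)" and I: "finite I"
  shows "x \<in> S \<Longrightarrow> iter_deriv (\<lambda>q. \<Sum>i\<in>I. a i *\<^sub>R F i q) vs x = (\<Sum>i\<in>I. a i *\<^sub>R iter_deriv (F i) vs x)"
proof (induction vs arbitrary: x)
  case (Cons v vs)
  have "frechet_derivative (iter_deriv (\<lambda>q. \<Sum>i\<in>I. a i *\<^sub>R F i q) vs) (at x)
      = frechet_derivative (\<lambda>q. \<Sum>i\<in>I. a i *\<^sub>R iter_deriv (F i) vs q) (at x)"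
    by (rule frechet_derivative_cong_open[OF S]) (use Cons in auto)
  moreover have "((\<lambda>q. \<Sum>i\<in>I. a i *\<^sub>R iter_deriv (F i) vs q) has_derivative
      (\<lambda>v. \<Sum>i\<in>I. a i *\<^sub>R frechet_derivative (iter_deriv (F i) vs) (at x) v)) (at x)"
    using F Cons.prems
    by (intro has_derivative_sum has_derivative_scaleR_right smooth_on_has_derivative[where S = S]
        smooth_on_iter_deriv) auto
  ultimately show ?case by (simp add: frechet_derivative_eq)
qed simp

lemma iter_deriv_add_scaled:
  assumes S: "open S" and F: "smooth_on S F" "smooth_on S G" and x: "x \<in> S"
  shows "iter_deriv (\<lambda>q. s *\<^sub>R F q + t *\<^sub>R G q) vs x = s *\<^sub>R iter_deriv F vs x + t *\<^sub>R iter_deriv G vs x"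
  using iter_deriv_sum[OF S, of UNIV "\<lambda>i. if i then F else G" x "\<lambda>i. if i then s else t" vs] F x
  by (simp add: UNIV_bool add.commute)

lemma iter_deriv_slot_linear:
  assumes S: "open S" and F: "smooth_on S F" and x: "x \<in> S"
  shows "iter_deriv F (us @ (s *\<^sub>R v + t *\<^sub>R w) # vs) x
    = s *\<^sub>R iter_deriv F (us @ v # vs) x + t *\<^sub>R iter_deriv F (us @ w # vs) x"
proof -
  let ?G = "iter_deriv F vs"
  have G: "smooth_on S ?G" using F by (rule smooth_on_iter_deriv)
  have ap: "iter_deriv F (us @ v # vs) = iter_deriv (\<lambda>q. frechet_derivative ?G (at q) v) us" for v
    by (simp only: iter_deriv_append iter_deriv_Cons)
  have "frechet_derivative ?G (at q) (s *\<^sub>R v + t *\<^sub>R w)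
      = s *\<^sub>R frechet_derivative ?G (at q) v + t *\<^sub>R frechet_derivative ?G (at q) w" if "q \<in> S" for q
    using frechet_derivative_linear[OF smooth_on_differentiable[OF G that]]
    by (simp add: linear_add linear_scale)
  then have "iter_deriv F (us @ (s *\<^sub>R v + t *\<^sub>R w) # vs) x
    = iter_deriv (\<lambda>q. s *\<^sub>R frechet_derivative ?G (at q) v + t *\<^sub>R frechet_derivative ?G (at q) w) us x"
    unfolding ap by (intro iter_deriv_cong[OF S]) (use x in auto)
  also have "\<dots> = s *\<^sub>R iter_deriv F (us @ v # vs) x + t *\<^sub>R iter_deriv F (us @ w # vs) x"
    unfolding ap by (intro iter_deriv_add_scaled[OF S] smooth_on_deriv G x)
  finally show ?thesis .
qed

lemma iter_deriv_map_scaleR: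
  assumes S: "open S" and F: "smooth_on S F"
  shows "x \<in> S \<Longrightarrow> iter_deriv F (map (\<lambda>k. \<tau> k *\<^sub>R w k) ks) x
    = prod_list (map \<tau> ks) *\<^sub>R iter_deriv F (map w ks) x"
proof (induction ks arbitrary: x)
  case (Cons k ks)
  let ?G = "iter_deriv F (map w ks)"
  have "frechet_derivative (iter_deriv F (map (\<lambda>k. \<tau> k *\<^sub>R w k) ks)) (at x)
      = frechet_derivative (\<lambda>x. prod_list (map \<tau> ks) *\<^sub>R ?G x) (at x)"
    by (rule frechet_derivative_cong_open[OF S]) (use Cons in auto)
  moreover have D: "(?G has_derivative frechet_derivative ?G (at x)) (at x)"
    using F Cons.prems by (intro smooth_on_has_derivative[where S = S] smooth_on_iter_deriv)
  then have "((\<lambda>x. prod_list (map \<tau> ks) *\<^sub>R ?G x) has_derivative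
      (\<lambda>v. prod_list (map \<tau> ks) *\<^sub>R frechet_derivative ?G (at x) v)) (at x)"
    by (rule has_derivative_scaleR_right)
  ultimately have "frechet_derivative (iter_deriv F (map (\<lambda>k. \<tau> k *\<^sub>R w k) ks)) (at x) v
      = prod_list (map \<tau> ks) *\<^sub>R frechet_derivative ?G (at x) v" for v
    by (simp add: frechet_derivative_eq)
  then show ?case using linear_scale[OF has_derivative_linear[OF D]] by simp
qed simp

text \<open>Expanding the innermost direction moves it into the scalar factors
  \<open>l i (w k t)\<close>; what is differentiated further is the derivative of \<open>F\<close>
  along a constant vector \<open>b i\<close>, which is again smooth. With no directions left,
  continuity of \<open>F\<close> suffices.\<close>

lemma tendsto_iter_deriv:
  assumes S: "open S" "p \<in> S" and co: "fin_coords I b l" and q: "(q \<longlongrightarrow> p) \<FF>"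
  shows "smooth_on S F \<Longrightarrow> determined_by I l F \<Longrightarrow> (\<And>k. k \<in> set ks \<Longrightarrow> (w k \<longlongrightarrow> w0 k) \<FF>) \<Longrightarrow>
    ((\<lambda>t. iter_deriv F (map (\<lambda>k. w k t) ks) (q t)) \<longlongrightarrow> iter_deriv F (map w0 ks) p) \<FF>"
proof (induction ks arbitrary: F rule: rev_induct)
  case Nil
  have "isCont F p"
    using smooth_on_continuous[OF Nil(1)] S by (simp add: continuous_on_eq_continuous_at)
  then show ?case using q by (simp add: isCont_tendsto_compose)
next
  case (snoc k ks)
  have I: "finite I" using co by (simp add: fin_coords_def)
  have expand: "iter_deriv F (vs @ [v]) x
      = (\<Sum>i\<in>I. l i v *\<^sub>R iter_deriv (\<lambda>q. frechet_derivative F (at q) (b i)) vs x)" if "x \<in> S" for vs v x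
  proof -
    have "iter_deriv F (vs @ [v]) x
        = iter_deriv (\<lambda>q. \<Sum>i\<in>I. l i v *\<^sub>R frechet_derivative F (at q) (b i)) vs x"
      unfolding iter_deriv_snoc
      using frechet_derivative_coords[OF co snoc.prems(2) smooth_on_differentiable[OF snoc.prems(1)]]
      by (intro iter_deriv_cong[OF S(1)]) (use that in auto)
    also have "\<dots> = (\<Sum>i\<in>I. l i v *\<^sub>R iter_deriv (\<lambda>q. frechet_derivative F (at q) (b i)) vs x)"
      using that snoc.prems(1) by (intro iter_deriv_sum[OF S(1) _ I] smooth_on_deriv)
    finally show ?thesis .
  qed
  have "((\<lambda>t. \<Sum>i\<in>I. l i (w k t) *\<^sub>R iter_deriv (\<lambda>q. frechet_derivative F (at q) (b i)) (map (\<lambda>k. w k t) ks) (q t))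
      \<longlongrightarrow> (\<Sum>i\<in>I. l i (w0 k) *\<^sub>R iter_deriv (\<lambda>q. frechet_derivative F (at q) (b i)) (map w0 ks) p)) \<FF>"
  proof (intro tendsto_sum tendsto_scaleR)
    fix i assume "i \<in> I"
    then show "((\<lambda>t. l i (w k t)) \<longlongrightarrow> l i (w0 k)) \<FF>"
      using co snoc.prems(3) by (intro bounded_linear.tendsto[of "l i"]) (auto simp: fin_coords_def)
    show "((\<lambda>t. iter_deriv (\<lambda>q. frechet_derivative F (at q) (b i)) (map (\<lambda>k. w k t) ks) (q t))
        \<longlongrightarrow> iter_deriv (\<lambda>q. frechet_derivative F (at q) (b i)) (map w0 ks) p) \<FF>"
      using snoc.prems by (intro snoc.IH smooth_on_deriv determined_by_deriv) auto
  qed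
  moreover have "\<forall>\<^sub>F t in \<FF>. q t \<in> S" using topological_tendstoD[OF q] S by blast
  then have "\<forall>\<^sub>F t in \<FF>. (\<Sum>i\<in>I. l i (w k t) *\<^sub>R iter_deriv (\<lambda>q. frechet_derivative F (at q) (b i)) (map (\<lambda>k. w k t) ks) (q t))
      = iter_deriv F (map (\<lambda>k. w k t) (ks @ [k])) (q t)"
    by eventually_elim (simp add: expand)
  ultimately show ?case
    using S by (simp add: expand tendsto_cong)
qed

section \<open>Iterated differences\<close>

text \<open>The alternating sum of \<open>F\<close> over the corners of the parallelepiped at
  \<open>z\<close> with edges \<open>hs\<close>; the finite-difference analogue of
  \<open>iter_deriv\<close>.\<close>

fun idiff :: "('v::real_normed_vector \<Rightarrow> 'w::real_normed_vector) \<Rightarrow> 'v list \<Rightarrow> 'v \<Rightarrow> 'w" where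
  "idiff F [] z = F z"
| "idiff F (h # hs) z = idiff F hs (z + h) - idiff F hs z"

text \<open>Translations commute, so an edge can be split off at the end as well, in the order in
  which \<open>iter_deriv_snoc\<close> peels off derivatives.\<close>

lemma idiff_snoc: "idiff F (hs @ [h]) z = idiff F hs (z + h) - idiff F hs z"
proof (induction hs arbitrary: z)
  case (Cons a hs)
  have "idiff F hs (z + a + h) = idiff F hs (z + h + a)" by (simp add: algebra_simps)
  then show ?case by (simp add: Cons.IH)
qed simp

lemma idiff_const: "idiff (\<lambda>q. a) hs z = (if hs = [] then a else 0)"
  by (induction hs arbitrary: z) auto

lemma idiff_minus_const: "hs \<noteq> [] \<Longrightarrow> idiff (\<lambda>q. F q - a) hs z = idiff F hs z"
proof -
  have "idiff (\<lambda>q. F q - G q) hs z = idiff F hs z - idiff G hs z" for G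
    by (induction hs arbitrary: z) simp_all
  then show "hs \<noteq> [] \<Longrightarrow> ?thesis" by (simp add: idiff_const)
qed

text \<open>The norm condition keeps every corner, that is \<open>z\<close> plus any subset sum of
  \<open>hs\<close>, inside the ball.\<close>

lemma has_derivative_idiff:
  assumes G: "smooth_on (ball p \<delta>) G"
  shows "norm (z - p) + sum_list (map norm hs) < \<delta> \<Longrightarrow>
    (idiff G hs has_derivative (\<lambda>v. idiff (\<lambda>q. frechet_derivative G (at q) v) hs z)) (at z)"
proof (induction hs arbitrary: z)
  case Nil
  then have "z \<in> ball p \<delta>" by (simp add: dist_norm norm_minus_commute)
  moreover have "idiff G [] = G" by (rule ext) simp
  ultimately show ?case using smooth_on_has_derivative[OF G] by simp
next
  case (Cons h hs)
  have "norm (z + h - p) \<le> norm (z - p) + norm h"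
    using norm_triangle_ineq[of "z - p" h] by (simp add: algebra_simps)
  with Cons.prems have "norm (z + h - p) + sum_list (map norm hs) < \<delta>" by simp
  note D = Cons.IH[OF this]
  have "((\<lambda>z. z + h) has_derivative (\<lambda>v. v)) (at z)" by (auto intro!: derivative_eq_intros)
  note shifted = has_derivative_compose[OF this D]
  have "norm (z - p) + sum_list (map norm hs) < \<delta>"
    using Cons.prems norm_ge_zero[of h] unfolding list.map sum_list.Cons by linarith
  note has_derivative_diff[OF shifted Cons.IH[OF this]]
  moreover have "idiff G (h # hs) = (\<lambda>z. idiff G hs (z + h) - idiff G hs z)" by (rule ext) simp
  ultimately show ?case by simp
qed

text \<open>The mean value inequality, one edge at a time: the last edge is traded for a derivative
  along \<open>h\<close>, and the induction hypothesis bounds the remaining difference of that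
  derivative with the same \<open>L\<close> and \<open>C\<close>.\<close>

lemma norm_idiff_le:
  assumes "smooth_on (ball p \<delta>) G"
    and "\<And>q. q \<in> ball p \<delta> \<Longrightarrow> norm (iter_deriv G hs q - L) \<le> C"
    and "norm (z - p) + sum_list (map norm hs) < \<delta>"
  shows "norm (idiff G hs z - L) \<le> C"
  using assms
proof (induction hs arbitrary: G z rule: rev_induct)
  case Nil
  then show ?case by (auto simp: dist_norm norm_minus_commute)
next
  case (snoc h hs)
  let ?D = "\<lambda>q. frechet_derivative G (at q) h"
  \<comment> \<open>The linear term makes the increment of \<open>g\<close> over [0, 1] the error to
    be bounded, and the derivative of \<open>g\<close> the corresponding error for the
    differentiated map.\<close>
  define g where "g s = idiff G hs (z + s *\<^sub>R h) - s *\<^sub>R L" for s :: real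
  have near: "norm (z + s *\<^sub>R h - p) + sum_list (map norm hs) < \<delta>" if "s \<in> {0..1}" for s
  proof -
    have "norm (z + s *\<^sub>R h - p) \<le> norm (z - p) + norm (s *\<^sub>R h)"
      using norm_triangle_ineq[of "z - p" "s *\<^sub>R h"] by (simp add: algebra_simps)
    also have "norm (s *\<^sub>R h) \<le> norm h"
      using that by (simp add: mult_left_le_one_le)
    finally show ?thesis using snoc.prems(3) by simp
  qed
  have bound: "norm (idiff ?D hs (z + s *\<^sub>R h) - L) \<le> C" if "s \<in> {0..1}" for s
    using smooth_on_deriv[OF snoc.prems(1)] snoc.prems(2) near[OF that]
    by (intro snoc.IH) (simp_all add: iter_deriv_snoc)
  have der: "(g has_derivative (\<lambda>t. t *\<^sub>R (idiff ?D hs (z + s *\<^sub>R h) - L))) (at s within {0..1})"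
    if "s \<in> {0..1}" for s
  proof -
    note D = has_derivative_idiff[OF snoc.prems(1) near[OF that]]
    have "((\<lambda>s. z + s *\<^sub>R h) has_derivative (\<lambda>t. t *\<^sub>R h)) (at s)"
      by (auto intro!: derivative_eq_intros)
    note has_derivative_compose[OF this D]
    moreover have "idiff (\<lambda>q. frechet_derivative G (at q) (t *\<^sub>R h)) hs (z + s *\<^sub>R h)
        = t *\<^sub>R idiff ?D hs (z + s *\<^sub>R h)" for t
    proof -
      have "(\<lambda>v. idiff (\<lambda>q. frechet_derivative G (at q) v) hs (z + s *\<^sub>R h)) (t *\<^sub>R h)
         = t *\<^sub>R (\<lambda>v. idiff (\<lambda>q. frechet_derivative G (at q) v) hs (z + s *\<^sub>R h)) h"
        by (rule linear_scale[OF has_derivative_linear[OF D]])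
      then show ?thesis .
    qed
    ultimately have "((\<lambda>s. idiff G hs (z + s *\<^sub>R h)) has_derivative (\<lambda>t. t *\<^sub>R idiff ?D hs (z + s *\<^sub>R h))) (at s)"
      by simp
    moreover have "((\<lambda>s. s *\<^sub>R L) has_derivative (\<lambda>t. t *\<^sub>R L)) (at s)"
      by (auto intro!: derivative_eq_intros)
    ultimately have "(g has_derivative (\<lambda>t. t *\<^sub>R idiff ?D hs (z + s *\<^sub>R h) - t *\<^sub>R L)) (at s)"
      unfolding g_def by (rule has_derivative_diff)
    then show ?thesis by (simp add: has_derivative_at_withinI scaleR_diff_right)
  qed
  have "norm (g 1 - g 0) \<le> C * norm (1 - 0 :: real)"
  proof (rule differentiable_bound[OF _ der])
    fix s :: real assume "s \<in> {0..1}"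
    note b = bound[OF this]
    show "onorm (\<lambda>t. t *\<^sub>R (idiff ?D hs (z + s *\<^sub>R h) - L)) \<le> C"
      using order_trans[OF norm_ge_zero b] mult_left_mono[OF b abs_ge_zero]
      by (intro onorm_bound) (simp_all add: mult.commute)
  qed auto
  then show ?case by (simp add: g_def idiff_snoc algebra_simps)
qed

text \<open>The exponents may differ between slots: a slot whose increment is a rack commutator moves
  at second order, and a slot that contains the value of an \<open>n\<close>-cochain moves at order \<open>n\<close>.\<close>

lemma tendsto_idiff:
  fixes F :: "'v::real_normed_vector \<Rightarrow> 'w::real_normed_vector"
  assumes S: "open S" "p \<in> S" and F: "smooth_on S F"
    and co: "fin_coords I b l" and det: "determined_by I l F"
    and w: "\<And>k. k \<in> set ks \<Longrightarrow> (w k \<longlongrightarrow> w0 k) (at_right 0)"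
    and m: "\<And>k. k \<in> set ks \<Longrightarrow> m k \<ge> 1"
    and z: "(z \<longlongrightarrow> p) (at_right 0)"
  shows "((\<lambda>t. inverse (t ^ sum_list (map m ks)) *\<^sub>R idiff F (map (\<lambda>k. t ^ m k *\<^sub>R w k t) ks) (z t))
    \<longlongrightarrow> iter_deriv F (map w0 ks) p) (at_right (0::real))"
proof (rule tendstoI)
  fix \<epsilon> :: real assume "\<epsilon> > 0"
  define L where "L = iter_deriv F (map w0 ks) p"
  \<comment> \<open>The base point is made independent of \<open>t\<close>: the corners of the
    difference spread around \<open>z t\<close>, so the estimate has to hold on a whole ball about
    \<open>p\<close>.\<close>
  have fst: "filterlim fst (at_right 0) (at_right (0::real) \<times>\<^sub>F nhds p)"
    and snd: "filterlim snd (nhds p) (at_right (0::real) \<times>\<^sub>F nhds p)"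
    by (rule filterlim_fst filterlim_snd)+
  have "((\<lambda>x. iter_deriv F (map (\<lambda>k. w k (fst x)) ks) (snd x)) \<longlongrightarrow> L) (at_right 0 \<times>\<^sub>F nhds p)"
    unfolding L_def
    by (rule tendsto_iter_deriv[OF S co snd F det]) (intro filterlim_compose[OF w fst])
  then have "\<forall>\<^sub>F x in at_right 0 \<times>\<^sub>F nhds p.
      dist (iter_deriv F (map (\<lambda>k. w k (fst x)) ks) (snd x)) L < \<epsilon> / 2"
    using \<open>\<epsilon> > 0\<close> by (intro tendstoD) auto
  then obtain P Q where P: "eventually P (at_right (0::real))" and Q: "eventually Q (nhds p)"
    and PQ: "\<And>t q. P t \<Longrightarrow> Q q \<Longrightarrow> dist (iter_deriv F (map (\<lambda>k. w k t) ks) q) L < \<epsilon> / 2"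
    unfolding eventually_prod_filter by auto
  have "\<forall>\<^sub>F q in nhds p. Q q \<and> q \<in> S"
    using Q S eventually_conj eventually_nhds_in_open by blast
  then obtain \<delta> where \<delta>: "\<delta> > 0" and ball: "\<And>q. q \<in> ball p \<delta> \<Longrightarrow> Q q \<and> q \<in> S"
    unfolding eventually_nhds_metric by (auto simp: dist_commute)
  have Fb: "smooth_on (ball p \<delta>) F" using F ball by (blast intro: smooth_on_subset)
  have "((\<lambda>t. norm (t ^ m k *\<^sub>R w k t)) \<longlongrightarrow> 0) (at_right 0)" if "k \<in> set ks" for k
  proof -
    have "((\<lambda>t. t ^ m k *\<^sub>R w k t) \<longlongrightarrow> 0 ^ m k *\<^sub>R w0 k) (at_right 0)"
      by (intro tendsto_intros w that)
    moreover have "0 ^ m k *\<^sub>R w0 k = 0" using m[OF that] by (simp add: power_0_left)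
    ultimately show ?thesis by (simp only: tendsto_norm_zero)
  qed
  then have "((\<lambda>t. sum_list (map (\<lambda>k. norm (t ^ m k *\<^sub>R w k t)) ks)) \<longlongrightarrow> 0) (at_right 0)"
  proof (induction ks)
    case (Cons k ks)
    then have "((\<lambda>t. norm (t ^ m k *\<^sub>R w k t) + sum_list (map (\<lambda>k. norm (t ^ m k *\<^sub>R w k t)) ks)) \<longlongrightarrow> 0 + 0) (at_right 0)"
      by (intro tendsto_add) auto
    then show ?case by simp
  qed simp
  moreover have "((\<lambda>t. norm (z t - p)) \<longlongrightarrow> 0) (at_right 0)"
    using z by (simp add: LIM_zero tendsto_norm_zero)
  ultimately have "((\<lambda>t. norm (z t - p) + sum_list (map (\<lambda>k. norm (t ^ m k *\<^sub>R w k t)) ks)) \<longlongrightarrow> 0 + 0) (at_right 0)"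
    by (intro tendsto_add)
  then have "\<forall>\<^sub>F t in at_right 0. norm (z t - p) + sum_list (map (\<lambda>k. norm (t ^ m k *\<^sub>R w k t)) ks) < \<delta>"
    using \<delta> by (intro order_tendstoD(2)) auto
  moreover have "\<forall>\<^sub>F t in at_right (0::real). t > 0" by (rule eventually_at_right_less)
  ultimately show "\<forall>\<^sub>F t in at_right 0. dist (inverse (t ^ sum_list (map m ks)) *\<^sub>R
      idiff F (map (\<lambda>k. t ^ m k *\<^sub>R w k t) ks) (z t)) (iter_deriv F (map w0 ks) p) < \<epsilon>"
    using P
  proof eventually_elim
    case (elim t)
    define T where "T = t ^ sum_list (map m ks)"
    have T: "T > 0" using elim by (simp add: T_def)
    have prod: "prod_list (map (\<lambda>k. t ^ m k) ks) = T"
      unfolding T_def by (induction ks) (simp_all add: power_add)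
    \<comment> \<open>Multilinearity extracts the powers of \<open>t\<close> from the directions, so
      a derivative within \<epsilon> / 2 of \<open>L\<close> becomes one within \<open>T\<close>
      times \<epsilon> / 2 of \<open>T *\<^sub>R L\<close>. The half leaves room for the strict
      inequality at the end.\<close>
    have "norm (idiff F (map (\<lambda>k. t ^ m k *\<^sub>R w k t) ks) (z t) - T *\<^sub>R L) \<le> T * (\<epsilon> / 2)"
    proof (rule norm_idiff_le[OF Fb])
      fix q assume q: "q \<in> ball p \<delta>"
      have "iter_deriv F (map (\<lambda>k. t ^ m k *\<^sub>R w k t) ks) q = T *\<^sub>R iter_deriv F (map (\<lambda>k. w k t) ks) q"
        using iter_deriv_map_scaleR[OF open_ball Fb q, of "\<lambda>k. t ^ m k" "\<lambda>k. w k t" ks] prod by simp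
      then have "norm (iter_deriv F (map (\<lambda>k. t ^ m k *\<^sub>R w k t) ks) q - T *\<^sub>R L)
          = T * dist (iter_deriv F (map (\<lambda>k. w k t) ks) q) L"
        using T by (simp add: dist_norm flip: scaleR_diff_right)
      also have "\<dots> \<le> T * (\<epsilon> / 2)"
        using PQ[of t q] ball[OF q] elim T by (intro mult_left_mono) auto
      finally show "norm (iter_deriv F (map (\<lambda>k. t ^ m k *\<^sub>R w k t) ks) q - T *\<^sub>R L) \<le> T * (\<epsilon> / 2)" .
    qed (use elim in \<open>simp add: o_def\<close>)
    then have "inverse T * norm (idiff F (map (\<lambda>k. t ^ m k *\<^sub>R w k t) ks) (z t) - T *\<^sub>R L) \<le> \<epsilon> / 2"
      using T by (simp add: field_simps)
    moreover have "norm (inverse T *\<^sub>R idiff F (map (\<lambda>k. t ^ m k *\<^sub>R w k t) ks) (z t) - L)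
       = norm (inverse T *\<^sub>R (idiff F (map (\<lambda>k. t ^ m k *\<^sub>R w k t) ks) (z t) - T *\<^sub>R L))"
      using T by (simp add: scaleR_diff_right)
    ultimately show ?case using T \<open>\<epsilon> > 0\<close> by (simp add: dist_norm T_def L_def)
  qed
qed

section \<open>Germs of smooth maps\<close>

definition smooth_at :: "'v::real_normed_vector \<Rightarrow> ('v \<Rightarrow> 'w::real_normed_vector) \<Rightarrow> bool" where
  "smooth_at p F \<longleftrightarrow> (\<exists>S. open S \<and> p \<in> S \<and> smooth_on S F)"

lemma smooth_atI: "open S \<Longrightarrow> p \<in> S \<Longrightarrow> smooth_on S F \<Longrightarrow> smooth_at p F"
  unfolding smooth_at_def by blast

lemma smooth_at_cong:
  assumes "\<forall>\<^sub>F q in nhds p. F q = G q" "smooth_at p F"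
  shows "smooth_at p G"
proof -
  obtain S T where "open S" "p \<in> S" "smooth_on S F" "open T" "p \<in> T" "\<And>q. q \<in> T \<Longrightarrow> F q = G q"
    using assms unfolding smooth_at_def eventually_nhds by blast
  then have "smooth_on (S \<inter> T) G"
    using smooth_on_cong[of "S \<inter> T" F G] smooth_on_subset[of S F "S \<inter> T"] by auto
  then show ?thesis
    using \<open>open S\<close> \<open>open T\<close> \<open>p \<in> S\<close> \<open>p \<in> T\<close> by (intro smooth_atI[of "S \<inter> T"]) auto
qed

lemma smooth_at_has_derivative:
  "smooth_at p F \<Longrightarrow> (F has_derivative frechet_derivative F (at p)) (at p)"
  unfolding smooth_at_def using smooth_on_has_derivative by blast

lemma smooth_at_tendsto: "smooth_at p F \<Longrightarrow> (F \<longlongrightarrow> F p) (nhds p)"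
  using smooth_at_has_derivative[of p F] has_derivative_continuous[of F _ p UNIV]
  by (simp add: continuous_at tendsto_at_iff_tendsto_nhds)

lemma smooth_at_const: "smooth_at p (\<lambda>x. a)"
  by (rule smooth_atI[OF open_UNIV]) (auto simp: smooth_on_const)

lemma smooth_at_id: "smooth_at p (\<lambda>x. x)"
  by (rule smooth_atI[OF open_UNIV]) (auto simp: smooth_on_id)

lemma smooth_at_bounded_linear: "bounded_linear L \<Longrightarrow> smooth_at p F \<Longrightarrow> smooth_at p (\<lambda>x. L (F x))"
  unfolding smooth_at_def using smooth_on_bounded_linear_compose by blast

lemma smooth_at_add: "smooth_at p F \<Longrightarrow> smooth_at p G \<Longrightarrow> smooth_at p (\<lambda>x. F x + G x)"
  unfolding smooth_at_def
proof (elim exE conjE)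
  fix S T assume "open S" "p \<in> S" "smooth_on S F" "open T" "p \<in> T" "smooth_on T G"
  then show "\<exists>S. open S \<and> p \<in> S \<and> smooth_on S (\<lambda>x. F x + G x)"
    by (intro exI[of _ "S \<inter> T"]) (auto intro: smooth_on_add smooth_on_subset)
qed

lemma smooth_at_sum:
  "(\<And>i. i \<in> I \<Longrightarrow> smooth_at p (F i)) \<Longrightarrow> smooth_at p (\<lambda>x. \<Sum>i\<in>I. F i x)"
  by (induction I rule: infinite_finite_induct) (auto intro: smooth_at_const smooth_at_add)

lemma smooth_at_Pair: "smooth_at p F \<Longrightarrow> smooth_at p G \<Longrightarrow> smooth_at p (\<lambda>x. (F x, G x))"
  unfolding smooth_at_def
proof (elim exE conjE)
  fix S T assume "open S" "p \<in> S" "smooth_on S F" "open T" "p \<in> T" "smooth_on T G"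
  then show "\<exists>S. open S \<and> p \<in> S \<and> smooth_on S (\<lambda>x. (F x, G x))"
    by (intro exI[of _ "S \<inter> T"]) (auto intro: smooth_on_Pair smooth_on_subset)
qed

lemma smooth_at_compose:
  assumes co: "fin_coords I b l" "determined_by I l G" and F: "smooth_at p F" and G: "smooth_at (F p) G"
  shows "smooth_at p (\<lambda>x. G (F x))"
proof -
  obtain S where S: "open S" "p \<in> S" "smooth_on S F" using F smooth_at_def by blast
  obtain T where T: "open T" "F p \<in> T" "smooth_on T G" using G smooth_at_def by blast
  have "open (F -` T \<inter> S)"
    using continuous_on_open_vimage[OF S(1)] smooth_on_continuous[OF S(3)] T(1) by blast
  then have "smooth_on (F -` T \<inter> S) (\<lambda>x. G (F x))"
    using S T by (intro smooth_on_compose[OF _ T(1) _ _ T(3) co]) (auto intro: smooth_on_subset)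
  with \<open>open (F -` T \<inter> S)\<close> show ?thesis
    using S T by (intro smooth_atI[of "F -` T \<inter> S"]) auto
qed

text \<open>With \<open>idiff F [(x, 0), (0, y)] (p, q) = F (p + x, q + y) - F (p + x, q) - F (p, q + y) + F (p, q)\<close>,
  this identifies the limits of such second differences with the iterated partial derivatives in
  the definitions of the bracket and of the action.\<close>

lemma iter_deriv_partials:
  assumes F: "smooth_at (p, q) F"
  shows "iter_deriv F [(u, 0), (0, v)] (p, q)
    = frechet_derivative (\<lambda>x. frechet_derivative (\<lambda>y. F (x, y)) (at q) v) (at p) u"
proof -
  obtain S where S: "open S" "(p, q) \<in> S" "smooth_on S F" using F smooth_at_def by blast
  let ?G = "\<lambda>z. frechet_derivative F (at z) (0, v)"
  have pair: "((\<lambda>x. (x, q)) has_derivative (\<lambda>h. (h, 0))) (at p)"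
    by (auto intro!: derivative_eq_intros)
  have pair': "((\<lambda>y. (x, y)) has_derivative (\<lambda>h. (0, h))) (at q)" for x
    by (auto intro!: derivative_eq_intros)
  have "(?G has_derivative frechet_derivative ?G (at (p, q))) (at (p, q))"
    using S by (intro smooth_on_has_derivative smooth_on_deriv)
  note total = has_derivative_compose[OF pair this]
  have inner: "frechet_derivative (\<lambda>y. F (x, y)) (at q) v = ?G (x, q)" if "(x, q) \<in> S" for x
    by (rule frechet_derivative_eq)
      (rule has_derivative_compose[OF pair' smooth_on_has_derivative[OF S(3) that]])
  have "open ((\<lambda>x. (x, q)) -` S)"
    by (intro open_vimage S(1) continuous_intros)
  then have "frechet_derivative (\<lambda>x. frechet_derivative (\<lambda>y. F (x, y)) (at q) v) (at p)
      = frechet_derivative (\<lambda>x. ?G (x, q)) (at p)"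
    using S(2) by (intro frechet_derivative_cong_open) (auto simp: inner)
  then have "frechet_derivative (\<lambda>x. frechet_derivative (\<lambda>y. F (x, y)) (at q) v) (at p) u
      = frechet_derivative (\<lambda>x. ?G (x, q)) (at p) u" by simp
  also have "\<dots> = frechet_derivative ?G (at (p, q)) (u, 0)"
    by (rule frechet_derivative_eq[OF total])
  finally show ?thesis by (simp add: iter_deriv_Cons iter_deriv_Nil)
qed

section \<open>Smooth maps into manifolds\<close>

lemma smooth_at_compose_full:
  fixes G :: "'v::real_normed_vector \<Rightarrow> 'w::real_normed_vector"
    and l :: "'i \<Rightarrow> 'v \<Rightarrow> real"
  assumes "full_coords I b l" "smooth_at p F" "smooth_at (F p) G"
  shows "smooth_at p (\<lambda>x. G (F x))"
  by (rule smooth_at_compose[where F = F and G = G and p = p,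
        OF full_coords_fin_coords[OF assms(1)] full_coords_determined[OF assms(1)] assms(2,3)])

lemma chart_cinv:
  assumes "is_chart c" "x \<in> fst c"
  shows "cinv c (snd c x) = x"
  using assms unfolding is_chart_def by (blast intro: homeomorphism_apply1)

lemma chart_image_cinv:
  assumes "is_chart c" "y \<in> snd c ` fst c"
  shows "snd c (cinv c y) = y" "cinv c y \<in> fst c"
  using assms(2) by (auto simp: chart_cinv[OF assms(1)])

lemma open_chart_image:
  assumes "is_chart c" "open W" "W \<subseteq> fst c"
  shows "open (snd c ` W)"
proof -
  have h: "homeomorphism (fst c) (snd c ` fst c) (snd c) (cinv c)" and o: "open (snd c ` fst c)"
    using assms(1) by (auto simp: is_chart_def)
  have "openin (top_of_set (fst c)) W" using assms(2,3) by (simp add: openin_open_eq open_subset)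
  then have "openin (top_of_set (snd c ` fst c)) (snd c ` W)"
    using homeomorphism_imp_open_map[OF h] by blast
  then show ?thesis using o openin_open_trans by blast
qed

lemma cinv_tendsto:
  assumes "is_chart c" "y \<in> snd c ` fst c"
  shows "(cinv c \<longlongrightarrow> cinv c y) (nhds y)"
proof -
  have "continuous_on (snd c ` fst c) (cinv c)" "open (snd c ` fst c)"
    using assms(1) by (auto simp: is_chart_def homeomorphism_def)
  then have "isCont (cinv c) y" using assms(2) continuous_on_eq_continuous_at by blast
  then show ?thesis by (simp add: isCont_def tendsto_at_iff_tendsto_nhds)
qed

lemma manifold_chart: "smooth_manifold \<A> \<Longrightarrow> c \<in> charts_at \<A> p \<Longrightarrow> is_chart c"
  by (simp add: smooth_manifold_def charts_at_def)

lemma manifold_chart_exists: "smooth_manifold \<A> \<Longrightarrow> \<exists>c. c \<in> charts_at \<A> p"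
  unfolding smooth_manifold_def charts_at_def by blast

lemma chart_at_charts_at: "smooth_manifold \<A> \<Longrightarrow> chart_at \<A> p \<in> charts_at \<A> p"
  unfolding chart_at_def using manifold_chart_exists by (rule someI_ex)

lemma charts_atD: "c \<in> charts_at \<A> p \<Longrightarrow> p \<in> fst c"
  by (simp add: charts_at_def)

lemma manifold_coords:
  fixes \<A> :: "('x::{t2_space,second_countable_topology}, 'e::real_normed_vector) chart set"
  shows "smooth_manifold \<A> \<Longrightarrow> \<exists>(I::'e set) (b::'e \<Rightarrow> 'e) l. full_coords I b l"
  unfolding smooth_manifold_def using full_coords_exists by blast

text \<open>Families of points parametrized by a normed space. They can be fed jointly into products
  and cochains without an atlas on a power of the manifold. Membership in the chart domain is a
  separate condition because charts are total functions, with arbitrary values elsewhere.\<close>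

definition msmooth_at ::
  "('x::topological_space, 'e::real_normed_vector) chart set \<Rightarrow> 'u::real_normed_vector \<Rightarrow> ('u \<Rightarrow> 'x) \<Rightarrow> bool" where
  "msmooth_at \<A> p h \<longleftrightarrow> (\<forall>d\<in>charts_at \<A> (h p).
     (\<forall>\<^sub>F q in nhds p. h q \<in> fst d) \<and> smooth_at p (\<lambda>q. snd d (h q)))"

lemma msmooth_at_tendsto:
  fixes \<A> :: "('x::{t2_space,second_countable_topology}, 'e::real_normed_vector) chart set"
  assumes A: "smooth_manifold \<A>" and h: "msmooth_at \<A> p h"
  shows "(h \<longlongrightarrow> h p) (nhds p)"
proof -
  obtain d where d: "d \<in> charts_at \<A> (h p)" using manifold_chart_exists[OF A] by blast
  note ch = manifold_chart[OF A d]
  have "((\<lambda>q. snd d (h q)) \<longlongrightarrow> snd d (h p)) (nhds p)"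
    using h d smooth_at_tendsto unfolding msmooth_at_def by blast
  moreover have "(cinv d \<longlongrightarrow> h p) (nhds (snd d (h p)))"
    using cinv_tendsto[OF ch, of "snd d (h p)"] chart_cinv[OF ch] charts_atD[OF d] by simp
  ultimately have "((\<lambda>q. cinv d (snd d (h q))) \<longlongrightarrow> h p) (nhds p)"
    by (rule filterlim_compose[rotated])
  moreover have "\<forall>\<^sub>F q in nhds p. h q \<in> fst d" using h d by (simp add: msmooth_at_def)
  then have "\<forall>\<^sub>F q in nhds p. cinv d (snd d (h q)) = h q"
    by eventually_elim (rule chart_cinv[OF ch])
  ultimately show ?thesis by (simp add: tendsto_cong)
qed

lemma msmooth_at_cinv:
  fixes \<A> :: "('x::{t2_space,second_countable_topology}, 'e::real_normed_vector) chart set"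
  assumes A: "smooth_manifold \<A>" and c: "c \<in> \<A>" "g p \<in> snd c ` fst c" and g: "smooth_at p g"
  shows "msmooth_at \<A> p (\<lambda>q. cinv c (g q))"
  unfolding msmooth_at_def
proof (intro ballI conjI)
  fix d assume d: "d \<in> charts_at \<A> (cinv c (g p))"
  have ch: "is_chart c" "is_chart d" using A c d by (auto simp: smooth_manifold_def charts_at_def)
  let ?U = "snd c ` (fst c \<inter> fst d)"
  have U: "open ?U" using ch by (intro open_chart_image) (auto simp: is_chart_def)
  have gU: "g p \<in> ?U" using c(2) d chart_cinv[OF ch(1)] by (auto simp: charts_at_def)
  have "\<forall>\<^sub>F q in nhds p. g q \<in> ?U"
    using topological_tendstoD[OF smooth_at_tendsto[OF g] U gU] .
  then show "\<forall>\<^sub>F q in nhds p. cinv c (g q) \<in> fst d"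
    by eventually_elim (auto simp: chart_cinv[OF ch(1)])
  have "smooth_on ?U (snd d \<circ> cinv c)"
    using A c d by (simp add: smooth_manifold_def charts_at_def)
  then have sm: "smooth_at (g p) (snd d \<circ> cinv c)" by (rule smooth_atI[OF U gU])
  obtain I :: "'e set" and b :: "'e \<Rightarrow> 'e" and l where "full_coords I b l"
    using manifold_coords[OF A] by blast
  from smooth_at_compose_full[OF this g sm] show "smooth_at p (\<lambda>q. snd d (cinv c (g q)))" by simp
qed

lemma smooth_mapD:
  assumes "smooth_map \<A> \<B> f" "c \<in> charts_at \<A> p" "d \<in> charts_at \<B> (f p)"
  shows "\<exists>W. open W \<and> p \<in> W \<and> W \<subseteq> fst c \<and> f ` W \<subseteq> fst d \<and>
    smooth_on (snd c ` W) (snd d \<circ> f \<circ> cinv c)"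
  using assms unfolding smooth_map_def by blast

lemma msmooth_at_compose:
  fixes \<A> :: "('x::{t2_space,second_countable_topology}, 'e::real_normed_vector) chart set"
  assumes A: "smooth_manifold \<A>" and F: "smooth_map \<A> \<B> F" and h: "msmooth_at \<A> p h"
  shows "msmooth_at \<B> p (\<lambda>q. F (h q))"
  unfolding msmooth_at_def
proof (intro ballI)
  fix d assume d: "d \<in> charts_at \<B> (F (h p))"
  obtain c where c: "c \<in> charts_at \<A> (h p)" using manifold_chart_exists[OF A] by blast
  note ch = manifold_chart[OF A c]
  from smooth_mapD[OF F c d] obtain W where W: "open W" "h p \<in> W" "W \<subseteq> fst c" "F ` W \<subseteq> fst d"
      "smooth_on (snd c ` W) (snd d \<circ> F \<circ> cinv c)"
    by blast
  have evW: "\<forall>\<^sub>F q in nhds p. h q \<in> W"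
    using topological_tendstoD[OF msmooth_at_tendsto[OF A h] W(1,2)] .
  then have ev: "\<forall>\<^sub>F q in nhds p. F (h q) \<in> fst d"
    by eventually_elim (use W(4) in blast)
  have "snd c (h p) \<in> snd c ` W" using W(2) by blast
  from smooth_atI[OF open_chart_image[OF ch W(1,3)] this W(5)]
  have sm: "smooth_at (snd c (h p)) (snd d \<circ> F \<circ> cinv c)" .
  obtain I :: "'e set" and b :: "'e \<Rightarrow> 'e" and l where co: "full_coords I b l"
    using manifold_coords[OF A] by blast
  have "smooth_at p (\<lambda>q. snd c (h q))" using h c by (simp add: msmooth_at_def)
  from smooth_at_compose_full[OF co this sm]
  have "smooth_at p (\<lambda>q. (snd d \<circ> F \<circ> cinv c) (snd c (h q)))" .
  moreover have "\<forall>\<^sub>F q in nhds p. (snd d \<circ> F \<circ> cinv c) (snd c (h q)) = snd d (F (h q))"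
    using evW by eventually_elim (use W(3) chart_cinv[OF ch] in auto)
  ultimately have "smooth_at p (\<lambda>q. snd d (F (h q)))" by (rule smooth_at_cong[rotated])
  with ev show "(\<forall>\<^sub>F q in nhds p. F (h q) \<in> fst d) \<and> smooth_at p (\<lambda>q. snd d (F (h q)))" by simp
qed

lemma cinv_prod:
  assumes "is_chart c" "is_chart c'" "x \<in> fst c" "y \<in> fst c'"
  shows "cinv (fst c \<times> fst c', map_prod (snd c) (snd c')) (snd c x, snd c' y) = (x, y)"
proof -
  have "inj_on (snd c) (fst c)" "inj_on (snd c') (fst c')"
    using assms chart_cinv by (metis inj_onI)+
  then have "inj_on (map_prod (snd c) (snd c')) (fst c \<times> fst c')" by (rule map_prod_inj_on)
  then show ?thesis
    using inv_into_f_f[of "map_prod (snd c) (snd c')" "fst c \<times> fst c'" "(x, y)"] assms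
    by (simp add: cinv_def)
qed

lemma msmooth_at_compose2:
  fixes \<A> :: "('x::{t2_space,second_countable_topology}, 'e::real_normed_vector) chart set"
    and \<B> :: "('y::{t2_space,second_countable_topology}, 'f::real_normed_vector) chart set"
  assumes A: "smooth_manifold \<A>" and B: "smooth_manifold \<B>"
    and F: "smooth_map (prod_atlas \<A> \<B>) \<C> (\<lambda>(x, y). F x y)"
    and h: "msmooth_at \<A> p h" and k: "msmooth_at \<B> p k"
  shows "msmooth_at \<C> p (\<lambda>q. F (h q) (k q))"
  unfolding msmooth_at_def
proof (intro ballI)
  fix d assume d: "d \<in> charts_at \<C> (F (h p) (k p))"
  obtain c c' where c: "c \<in> charts_at \<A> (h p)" and c': "c' \<in> charts_at \<B> (k p)"
    using manifold_chart_exists A B by metis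
  note ch = manifold_chart[OF A c] manifold_chart[OF B c']
  let ?c = "(fst c \<times> fst c', map_prod (snd c) (snd c'))"
  have "?c \<in> prod_atlas \<A> \<B>"
    using c c' unfolding charts_at_def prod_atlas_def by blast
  then have "?c \<in> charts_at (prod_atlas \<A> \<B>) (h p, k p)"
    using c c' by (simp add: charts_at_def)
  moreover have "d \<in> charts_at \<C> ((\<lambda>(x, y). F x y) (h p, k p))" using d by simp
  ultimately have "\<exists>W. open W \<and> (h p, k p) \<in> W \<and> W \<subseteq> fst ?c \<and> (\<lambda>(x, y). F x y) ` W \<subseteq> fst d \<and>
      smooth_on (snd ?c ` W) (snd d \<circ> (\<lambda>(x, y). F x y) \<circ> cinv ?c)"
    by (rule smooth_mapD[OF F])
  then obtain W where W: "open W" "(h p, k p) \<in> W" "W \<subseteq> fst c \<times> fst c'"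
      "(\<lambda>(x, y). F x y) ` W \<subseteq> fst d"
      "smooth_on (map_prod (snd c) (snd c') ` W) (snd d \<circ> (\<lambda>(x, y). F x y) \<circ> cinv ?c)"
    unfolding fst_conv snd_conv by blast
  \<comment> \<open>A rectangle inside \<open>W\<close> allows membership to be tested factor by
    factor, and its image under the product chart is a product of open sets.\<close>
  obtain W1 W2 where W12: "open W1" "open W2" "h p \<in> W1" "k p \<in> W2" "W1 \<times> W2 \<subseteq> W"
    using open_prod_elim[OF W(1,2)] by (metis mem_Sigma_iff)
  have sub: "W1 \<subseteq> fst c" "W2 \<subseteq> fst c'" using W12 W(3) by auto
  have ev: "\<forall>\<^sub>F q in nhds p. h q \<in> W1 \<and> k q \<in> W2"
    using topological_tendstoD[OF msmooth_at_tendsto[OF A h] W12(1,3)]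
      topological_tendstoD[OF msmooth_at_tendsto[OF B k] W12(2,4)] by eventually_elim simp
  then have "\<forall>\<^sub>F q in nhds p. F (h q) (k q) \<in> fst d"
    by eventually_elim (use W(4) W12(5) in auto)
  moreover have "smooth_at p (\<lambda>q. snd d (F (h q) (k q)))"
  proof -
    have "open (snd c ` W1 \<times> snd c' ` W2)"
      using open_chart_image[OF ch(1) W12(1) sub(1)] open_chart_image[OF ch(2) W12(2) sub(2)]
      by (rule open_Times)
    moreover have "snd c ` W1 \<times> snd c' ` W2 \<subseteq> map_prod (snd c) (snd c') ` W"
      using W12(5) by force
    then have "smooth_on (snd c ` W1 \<times> snd c' ` W2) (snd d \<circ> (\<lambda>(x, y). F x y) \<circ> cinv ?c)"
      by (rule smooth_on_subset[OF W(5)])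
    moreover have "(snd c (h p), snd c' (k p)) \<in> snd c ` W1 \<times> snd c' ` W2" using W12 by blast
    ultimately have sm: "smooth_at (snd c (h p), snd c' (k p)) (snd d \<circ> (\<lambda>(x, y). F x y) \<circ> cinv ?c)"
      by (intro smooth_atI)
    obtain I :: "'e set" and b :: "'e \<Rightarrow> 'e" and l where co: "full_coords I b l"
      using manifold_coords[OF A] by blast
    obtain J :: "'f set" and b' :: "'f \<Rightarrow> 'f" and l' where co': "full_coords J b' l'"
      using manifold_coords[OF B] by blast
    have "smooth_at p (\<lambda>q. (snd c (h q), snd c' (k q)))"
      by (rule smooth_at_Pair) (use h k c c' in \<open>auto simp: msmooth_at_def\<close>)
    from smooth_at_compose_full[OF full_coords_prod[OF co co'] this sm]
    have "smooth_at p (\<lambda>q. (snd d \<circ> (\<lambda>(x, y). F x y) \<circ> cinv ?c) (snd c (h q), snd c' (k q)))" .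
    moreover have "\<forall>\<^sub>F q in nhds p. (snd d \<circ> (\<lambda>(x, y). F x y) \<circ> cinv ?c) (snd c (h q), snd c' (k q))
        = snd d (F (h q) (k q))"
      using ev by eventually_elim (simp add: cinv_prod[OF ch] subsetD[OF sub(1)] subsetD[OF sub(2)])
    ultimately show ?thesis by (rule smooth_at_cong[rotated])
  qed
  ultimately show "(\<forall>\<^sub>F q in nhds p. F (h q) (k q) \<in> fst d) \<and> smooth_at p (\<lambda>q. snd d (F (h q) (k q)))"
    by simp
qed

lemma msmooth_at_const:
  fixes \<A> :: "('x::{t2_space,second_countable_topology}, 'e::real_normed_vector) chart set"
  shows "msmooth_at \<A> p (\<lambda>q. a)"
  unfolding msmooth_at_def by (auto simp: charts_atD intro: smooth_at_const)

section \<open>Smoothness of cochains near the base point\<close>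

lemma CR_vanish: "f \<in> CR \<A> e \<B> n \<Longrightarrow> length xs = n \<Longrightarrow> e \<in> set xs \<Longrightarrow> f xs = 0"
  by (simp add: CR_def)

lemma CR_replicate: "f \<in> CR \<A> e \<B> n \<Longrightarrow> n \<ge> 1 \<Longrightarrow> f (replicate n e) = 0"
  by (auto simp: CR_def)

lemma open_coordinates_in:
  assumes "open W"
  shows "open {v :: nat \<Rightarrow>\<^sub>C 'e::real_normed_vector. \<forall>i<n. apply_bcontfun v i \<in> W}"
proof -
  have "{v :: nat \<Rightarrow>\<^sub>C 'e. \<forall>i<n. apply_bcontfun v i \<in> W} = (\<Inter>i\<in>{..<n}. (\<lambda>v. apply_bcontfun v i) -` W)"
    by auto
  moreover have "open ((\<lambda>v :: nat \<Rightarrow>\<^sub>C 'e. apply_bcontfun v i) -` W)" for i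
    using assms by (intro open_vimage bounded_linear.continuous_on[OF bounded_linear_apply_bcontfun]) auto
  ultimately show ?thesis by (simp add: open_INT)
qed

lemma msmooth_at_CR:
  fixes \<A> :: "('x::{t2_space,second_countable_topology}, 'e::real_normed_vector) chart set"
    and \<B> :: "('a::{topological_space,ab_group_add}, 'f::real_normed_vector) chart set"
  assumes A: "smooth_manifold \<A>" and f: "f \<in> CR \<A> e \<B> n" and n: "n \<ge> 1" "length hs = n"
    and hs: "\<And>h. h \<in> set hs \<Longrightarrow> msmooth_at \<A> p h \<and> h p = e"
  shows "msmooth_at \<B> p (\<lambda>q. f (map (\<lambda>h. h q) hs))"
  unfolding msmooth_at_def
proof (intro ballI)
  have hp: "map (\<lambda>h. h p) hs = replicate n e"
    using hs n by (intro replicate_eqI) auto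
  fix d assume "d \<in> charts_at \<B> (f (map (\<lambda>h. h p) hs))"
  then have d: "d \<in> charts_at \<B> (f (replicate n e))" by (simp add: hp)
  obtain c where c: "c \<in> charts_at \<A> e" using manifold_chart_exists[OF A] by blast
  note ch = manifold_chart[OF A c]
  let ?S = "\<lambda>W. {v. \<forall>i<n. apply_bcontfun v i \<in> snd c ` W}"
  from f c d obtain W where W: "open W" "e \<in> W" "W \<subseteq> fst c"
      "\<And>xs. length xs = n \<Longrightarrow> set xs \<subseteq> W \<Longrightarrow> f xs \<in> fst d"
      "smooth_on (?S W) (local_rep c d n f)"
    unfolding CR_def by blast
  have ev: "\<forall>\<^sub>F q in nhds p. \<forall>h\<in>set hs. h q \<in> W"
  proof (intro eventually_ball_finite ballI)
    fix h assume "h \<in> set hs"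
    then have "(h \<longlongrightarrow> e) (nhds p)" using msmooth_at_tendsto[OF A] hs by metis
    then show "\<forall>\<^sub>F q in nhds p. h q \<in> W" using W by (blast intro: topological_tendstoD)
  qed simp
  then have "\<forall>\<^sub>F q in nhds p. f (map (\<lambda>h. h q) hs) \<in> fst d"
    by eventually_elim (rule W(4), use n in auto)
  moreover have "smooth_at p (\<lambda>q. snd d (f (map (\<lambda>h. h q) hs)))"
  proof -
    \<comment> \<open>All arguments are packed into one sequence; \<open>local_rep\<close> does not
      see its zero tail.\<close>
    let ?P = "\<lambda>q. \<Sum>i<n. single i (snd c ((hs ! i) q))"
    have P: "apply_bcontfun (?P q) i = snd c ((hs ! i) q)" if "i < n" for q i
      using that by simp
    have smP: "smooth_at p ?P"
    proof (rule smooth_at_sum, rule smooth_at_bounded_linear[OF bounded_linear_single])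
      fix i assume "i \<in> {..<n}"
      then have "msmooth_at \<A> p (hs ! i) \<and> (hs ! i) p = e" using hs n by simp
      then show "smooth_at p (\<lambda>q. snd c ((hs ! i) q))" using c unfolding msmooth_at_def by auto
    qed
    have smf: "smooth_at (?P p) (local_rep c d n f)"
    proof (rule smooth_atI[OF _ _ W(5)])
      show "open (?S W)" by (rule open_coordinates_in[OF open_chart_image[OF ch W(1,3)]])
      have "(hs ! i) p = e" if "i < n" for i using hs n(2) that by simp
      then show "?P p \<in> ?S W" using P W(2) by simp
    qed
    obtain I :: "'e set" and b :: "'e \<Rightarrow> 'e" and l where co: "full_coords I b l"
      using manifold_coords[OF A] by blast
    have "smooth_at p (\<lambda>q. local_rep c d n f (?P q))"
      by (rule smooth_at_compose[OF fin_coords_sequences[OF co] determined_by_local_rep[OF co] smP smf])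
    moreover have "\<forall>\<^sub>F q in nhds p. local_rep c d n f (?P q) = snd d (f (map (\<lambda>h. h q) hs))"
      using ev
    proof eventually_elim
      case (elim q)
      have "map (\<lambda>i. cinv c (apply_bcontfun (?P q) i)) [0..<n] = map (\<lambda>h. h q) hs"
      proof (rule nth_equalityI)
        fix i assume "i < length (map (\<lambda>i. cinv c (apply_bcontfun (?P q) i)) [0..<n])"
        then have i: "i < n" by simp
        then have "(hs ! i) q \<in> fst c" using elim n(2) W(3) by auto
        then show "map (\<lambda>i. cinv c (apply_bcontfun (?P q) i)) [0..<n] ! i = map (\<lambda>h. h q) hs ! i"
          using i n(2) P[OF i] chart_cinv[OF ch] by simp
      qed (simp add: n)
      then show ?case unfolding local_rep_def by (rule arg_cong)
    qed
    ultimately show ?thesis by (rule smooth_at_cong[rotated])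
  qed
  ultimately show "(\<forall>\<^sub>F q in nhds p. f (map (\<lambda>h. h q) hs) \<in> fst d) \<and> smooth_at p (\<lambda>q. snd d (f (map (\<lambda>h. h q) hs)))"
    by simp
qed

text \<open>Smoothness at a point yields a ball, whereas \<open>CR\<close> asks for smoothness on a
  cylinder whose tail is unrestricted. The projection \<open>?P\<close> resets the tail to the
  coordinates of \<open>e\<close>; it maps the cylinder over a small \<open>W\<close> into the ball
  and leaves \<open>local_rep\<close> unchanged.\<close>

lemma CR_I:
  fixes \<A> :: "('x::{t2_space,second_countable_topology}, 'e::real_normed_vector) chart set"
    and \<B> :: "('a::{topological_space,ab_group_add}, 'f::real_normed_vector) chart set"
  assumes A: "smooth_manifold \<A>" and n: "n \<ge> 1"
    and vanish: "\<And>xs. length xs = n \<Longrightarrow> e \<in> set xs \<Longrightarrow> f xs = 0"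
    and smooth: "\<And>c. c \<in> charts_at \<A> e \<Longrightarrow>
      msmooth_at \<B> (const_bcontfun (snd c e)) (\<lambda>v. f (map (\<lambda>i. cinv c (apply_bcontfun v i)) [0..<n]))"
  shows "f \<in> CR \<A> e \<B> n"
proof -
  have "\<exists>W. open W \<and> e \<in> W \<and> W \<subseteq> fst c \<and>
      (\<forall>xs. length xs = n \<and> set xs \<subseteq> W \<longrightarrow> f xs \<in> fst d) \<and>
      smooth_on {v. \<forall>i<n. apply_bcontfun v i \<in> snd c ` W} (local_rep c d n f)"
    if c: "c \<in> charts_at \<A> e" and d: "d \<in> charts_at \<B> (f (replicate n e))" for c d
  proof -
    note ch = manifold_chart[OF A c]
    let ?p = "const_bcontfun (snd c e) :: nat \<Rightarrow>\<^sub>C 'e"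
    let ?P = "\<lambda>w :: nat \<Rightarrow> 'e. ?p + (\<Sum>i<n. single i (w i - snd c e))"
    have P: "apply_bcontfun (?P w) i = (if i < n then w i else snd c e)" for w i
      by simp
    have "map (\<lambda>i. cinv c (apply_bcontfun ?p i)) [0..<n] = replicate n e"
      using chart_cinv[OF ch charts_atD[OF c]] by (simp add: map_replicate_trivial)
    with smooth[OF c] d have ev: "\<forall>\<^sub>F v in nhds ?p. f (map (\<lambda>i. cinv c (apply_bcontfun v i)) [0..<n]) \<in> fst d"
      and sm: "smooth_at ?p (local_rep c d n f)"
      unfolding msmooth_at_def local_rep_def by auto
    from sm obtain S where S: "open S" "?p \<in> S" "smooth_on S (local_rep c d n f)"
      unfolding smooth_at_def by blast
    have "\<forall>\<^sub>F v in nhds ?p. v \<in> S \<and> f (map (\<lambda>i. cinv c (apply_bcontfun v i)) [0..<n]) \<in> fst d"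
      using ev eventually_nhds_in_open[OF S(1,2)] by eventually_elim simp
    then obtain \<epsilon> where \<epsilon>: "\<epsilon> > 0" and ball: "\<And>v. dist v ?p < \<epsilon> \<Longrightarrow>
        v \<in> S \<and> f (map (\<lambda>i. cinv c (apply_bcontfun v i)) [0..<n]) \<in> fst d"
      unfolding eventually_nhds_metric by blast
    \<comment> \<open>The norm of a sequence is a supremum, so strict bounds on the terms give only
      a weak bound on the norm; radius \<epsilon> / 2 keeps the projection strictly inside the ball
      of radius \<epsilon>.\<close>
    define W where "W = fst c \<inter> snd c -` ball (snd c e) (\<epsilon> / 2)"
    have "continuous_on (fst c) (snd c)" "open (fst c)"
      using ch by (auto simp: is_chart_def homeomorphism_def)
    then have "open W" unfolding W_def
      using continuous_on_open_vimage[of "fst c" "snd c"] by (simp add: Int_commute)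
    have Pball: "dist (?P w) ?p < \<epsilon>" if w: "\<And>i. i < n \<Longrightarrow> w i \<in> snd c ` W" for w
    proof -
      have "norm (w i - snd c e) \<le> \<epsilon> / 2" if "i < n" for i
        using w[OF that] by (auto simp: W_def dist_norm norm_minus_commute)
      then have "norm (\<Sum>i<n. single i (w i - snd c e)) \<le> \<epsilon> / 2"
        using \<epsilon> by (intro norm_bound) simp
      then show ?thesis using \<epsilon> by (simp add: dist_norm)
    qed
    have "f xs \<in> fst d" if "length xs = n" "set xs \<subseteq> W" for xs
    proof -
      have xs: "xs ! i \<in> W" if "i < n" for i
        using that \<open>length xs = n\<close> \<open>set xs \<subseteq> W\<close> nth_mem by blast
      have "map (\<lambda>i. cinv c (apply_bcontfun (?P (\<lambda>i. snd c (xs ! i))) i)) [0..<n] = xs"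
        by (rule nth_equalityI) (use that xs chart_cinv[OF ch] in \<open>simp_all add: W_def\<close>)
      then show ?thesis using ball[OF Pball[of "\<lambda>i. snd c (xs ! i)"]] xs by auto
    qed
    moreover have "smooth_on {v. \<forall>i<n. apply_bcontfun v i \<in> snd c ` W} (local_rep c d n f)"
    proof -
      let ?T = "{v. \<forall>i<n. apply_bcontfun v i \<in> snd c ` W}"
      have T: "open ?T"
        using \<open>open W\<close> by (intro open_coordinates_in open_chart_image[OF ch]) (auto simp: W_def)
      obtain I :: "'e set" and b :: "'e \<Rightarrow> 'e" and l where co: "full_coords I b l"
        using manifold_coords[OF A] by blast
      have "smooth_on ?T (\<lambda>v. single i (apply_bcontfun v i - snd c e))" for i
      proof -
        have "smooth_on ?T (\<lambda>v. apply_bcontfun v i + (- snd c e))"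
          by (rule smooth_on_add[OF T smooth_on_bounded_linear_compose[OF bounded_linear_apply_bcontfun T smooth_on_id] smooth_on_const])
        from smooth_on_bounded_linear_compose[OF bounded_linear_single T this] show ?thesis by simp
      qed
      then have smP: "smooth_on ?T (\<lambda>v. ?P (apply_bcontfun v))"
        by (rule smooth_on_add[OF T smooth_on_const smooth_on_sum[OF T]])
      have "?P (apply_bcontfun v) \<in> S" if "v \<in> ?T" for v
        using ball[OF Pball[of "apply_bcontfun v"]] that by blast
      then have "(\<lambda>v. ?P (apply_bcontfun v)) ` ?T \<subseteq> S" by blast
      from smooth_on_compose[OF T S(1) this smP S(3) fin_coords_sequences[OF co] determined_by_local_rep[OF co]]
      have "smooth_on ?T (\<lambda>v. local_rep c d n f (?P (apply_bcontfun v)))" .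
      moreover have "local_rep c d n f (?P (apply_bcontfun v)) = local_rep c d n f v" for v
        unfolding local_rep_def by (intro arg_cong[where f = "\<lambda>xs. snd d (f xs)"]) simp
      ultimately show ?thesis by simp
    qed
    ultimately show ?thesis
      using \<open>open W\<close> \<epsilon> charts_atD[OF c] by (intro exI[of _ W]) (auto simp: W_def)
  qed
  then show ?thesis unfolding CR_def using vanish by (intro CollectI conjI ballI allI impI) auto
qed

section \<open>Asymptotics along curves\<close>

text \<open>Curves are germs at \<open>0\<close> from the right.  Their values far from \<open>0\<close> and at \<open>0\<close> are irrelevant.\<close>

definition conv :: "('x, 'e::real_normed_vector) chart \<Rightarrow> 'x \<Rightarrow> (real \<Rightarrow> 'x) \<Rightarrow> bool" where
  "conv c p x \<longleftrightarrow> (\<forall>\<^sub>F t in at_right 0. x t \<in> fst c) \<and>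
     ((\<lambda>t. snd c (x t)) \<longlongrightarrow> snd c p) (at_right 0)"

text \<open>\<open>L\<close> is the leading coefficient of order \<open>m\<close> of the curve at
  \<open>p\<close>; for \<open>m = 1\<close> it is the velocity from the right.\<close>

definition asy :: "('x, 'e::real_normed_vector) chart \<Rightarrow> 'x \<Rightarrow> nat \<Rightarrow> (real \<Rightarrow> 'x) \<Rightarrow> 'e \<Rightarrow> bool" where
  "asy c p m x L \<longleftrightarrow> (\<forall>\<^sub>F t in at_right 0. x t \<in> fst c) \<and>
     ((\<lambda>t. inverse (t ^ m) *\<^sub>R (snd c (x t) - snd c p)) \<longlongrightarrow> L) (at_right 0)"

lemma at_right_0_pos: "\<forall>\<^sub>F t in at_right (0::real). t > 0"
  by (rule eventually_at_right_less)

lemma scaleR_power_inverse: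
  assumes "t > (0::real)"
  shows "t ^ m *\<^sub>R (inverse (t ^ m) *\<^sub>R y) = (y :: 'v::real_vector)"
  using assms by simp

lemma tendsto_zero_if_scaled:
  fixes y :: "real \<Rightarrow> 'v::real_normed_vector"
  assumes "((\<lambda>t. inverse (t ^ m) *\<^sub>R y t) \<longlongrightarrow> L) (at_right 0)" "m \<ge> 1"
  shows "(y \<longlongrightarrow> 0) (at_right 0)"
proof -
  have "((\<lambda>t::real. t ^ m) \<longlongrightarrow> 0 ^ m) (at_right 0)" by (intro tendsto_intros)
  from tendsto_scaleR[OF this assms(1)]
  have "((\<lambda>t::real. t ^ m *\<^sub>R (inverse (t ^ m) *\<^sub>R y t)) \<longlongrightarrow> 0) (at_right 0)"
    using assms(2) by (simp add: power_0_left)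
  moreover have "\<forall>\<^sub>F t in at_right 0. t ^ m *\<^sub>R (inverse (t ^ m) *\<^sub>R y t) = y t"
    using at_right_0_pos by eventually_elim (rule scaleR_power_inverse)
  ultimately show ?thesis by (rule Lim_transform_eventually)
qed

lemma asy_conv: "asy c p m x L \<Longrightarrow> m \<ge> 1 \<Longrightarrow> conv c p x"
  unfolding asy_def conv_def using tendsto_zero_if_scaled LIM_zero_iff by blast

lemma asy_unique: "asy c p m x L \<Longrightarrow> asy c p m x L' \<Longrightarrow> L = L'"
  unfolding asy_def using tendsto_unique[OF trivial_limit_at_right_real] by blast

lemma asy_const: "p \<in> fst c \<Longrightarrow> asy c p m (\<lambda>t. p) 0"
  by (simp add: asy_def)

lemma conv_const: "p \<in> fst c \<Longrightarrow> conv c p (\<lambda>t. p)"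
  by (simp add: conv_def)

lemma eventually_nhds_compose:
  "\<forall>\<^sub>F z in nhds p. P z \<Longrightarrow> (z \<longlongrightarrow> p) F \<Longrightarrow> \<forall>\<^sub>F t in F. P (z t)"
  unfolding filterlim_def le_filter_def eventually_filtermap by blast

text \<open>The case of a single slot, labelled \<open>()\<close>, of \<open>tendsto_idiff\<close>.
  Only the difference of \<open>y\<close> and \<open>z\<close> has an order; \<open>z\<close> itself
  may approach \<open>p\<close> at any speed.\<close>

lemma tendsto_difference_quotient:
  fixes F :: "'v::real_normed_vector \<Rightarrow> 'w::real_normed_vector" and l :: "'i \<Rightarrow> 'v \<Rightarrow> real"
  assumes co: "full_coords I b l" and F: "smooth_at p F" and m: "m \<ge> 1"
    and y: "((\<lambda>t. inverse (t ^ m) *\<^sub>R (y t - z t)) \<longlongrightarrow> L) (at_right 0)"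
    and z: "(z \<longlongrightarrow> p) (at_right 0)"
  shows "((\<lambda>t. inverse (t ^ m) *\<^sub>R (F (y t) - F (z t))) \<longlongrightarrow> frechet_derivative F (at p) L) (at_right 0)"
proof -
  obtain S where S: "open S" "p \<in> S" "smooth_on S F" using F smooth_at_def by blast
  have "((\<lambda>t. inverse (t ^ sum_list (map (\<lambda>_. m) [()])) *\<^sub>R
      idiff F (map (\<lambda>_. t ^ m *\<^sub>R (inverse (t ^ m) *\<^sub>R (y t - z t))) [()]) (z t))
      \<longlongrightarrow> iter_deriv F (map (\<lambda>_. L) [()]) p) (at_right 0)"
    by (rule tendsto_idiff[OF S full_coords_fin_coords[OF co] full_coords_determined[OF co] y m z])
  moreover have "\<forall>\<^sub>F t in at_right 0. inverse (t ^ sum_list (map (\<lambda>_. m) [()])) *\<^sub>R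
      idiff F (map (\<lambda>_. t ^ m *\<^sub>R (inverse (t ^ m) *\<^sub>R (y t - z t))) [()]) (z t)
      = inverse (t ^ m) *\<^sub>R (F (y t) - F (z t))"
    using at_right_0_pos by eventually_elim (simp add: scaleR_power_inverse del: scaleR_scaleR)
  ultimately have "((\<lambda>t. inverse (t ^ m) *\<^sub>R (F (y t) - F (z t))) \<longlongrightarrow> iter_deriv F (map (\<lambda>_. L) [()]) p) (at_right 0)"
    by (rule Lim_transform_eventually)
  then show ?thesis by simp (simp only: iter_deriv_Nil)
qed

text \<open>A leading coefficient of any order transforms like a tangent vector, which is what
  allows values of \<open>n\<close>-th differentials to be elements of a tangent space.\<close>

lemma asy_change_chart:
  fixes \<A> :: "('x::{t2_space,second_countable_topology}, 'e::real_normed_vector) chart set"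
  assumes A: "smooth_manifold \<A>" and c: "c \<in> charts_at \<A> p" and d: "d \<in> charts_at \<A> p"
    and m: "m \<ge> 1" and x: "asy c p m x L"
  shows "asy d p m x (frechet_derivative (snd d \<circ> cinv c) (at (snd c p)) L)"
proof -
  note ch = manifold_chart[OF A c]
  have cp: "cinv c (snd c p) = p" using chart_cinv[OF ch charts_atD[OF c]] .
  have "msmooth_at \<A> (snd c p) (\<lambda>q. cinv c q)"
    using c by (intro msmooth_at_cinv[OF A _ _ smooth_at_id]) (auto simp: charts_at_def)
  then have ev: "\<forall>\<^sub>F q in nhds (snd c p). cinv c q \<in> fst d"
    and sm: "smooth_at (snd c p) (\<lambda>q. snd d (cinv c q))"
    using d unfolding msmooth_at_def cp by auto
  obtain I :: "'e set" and b :: "'e \<Rightarrow> 'e" and l where co: "full_coords I b l"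
    using manifold_coords[OF A] by blast
  from asy_conv[OF x m] have xc: "\<forall>\<^sub>F t in at_right 0. x t \<in> fst c"
    and lim: "((\<lambda>t. snd c (x t)) \<longlongrightarrow> snd c p) (at_right 0)" by (auto simp: conv_def)
  have inv: "\<forall>\<^sub>F t in at_right 0. cinv c (snd c (x t)) = x t"
    using xc by eventually_elim (rule chart_cinv[OF ch])
  have "\<forall>\<^sub>F t in at_right 0. cinv c (snd c (x t)) \<in> fst d"
    by (rule eventually_nhds_compose[OF ev lim])
  with inv have "\<forall>\<^sub>F t in at_right 0. x t \<in> fst d" by eventually_elim simp
  moreover have "((\<lambda>t. inverse (t ^ m) *\<^sub>R (snd d (cinv c (snd c (x t))) - snd d (cinv c (snd c p))))
      \<longlongrightarrow> frechet_derivative (\<lambda>q. snd d (cinv c q)) (at (snd c p)) L) (at_right 0)"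
    using x by (intro tendsto_difference_quotient[OF co sm m]) (auto simp: asy_def)
  then have "((\<lambda>t. inverse (t ^ m) *\<^sub>R (snd d (x t) - snd d p))
      \<longlongrightarrow> frechet_derivative (\<lambda>q. snd d (cinv c q)) (at (snd c p)) L) (at_right 0)"
    by (rule Lim_transform_eventually) (use inv in \<open>eventually_elim, simp add: cp\<close>)
  ultimately show ?thesis by (simp add: asy_def o_def)
qed

text \<open>A segment that is straight in one chart realizes the tangent vector; the transformation
  law in \<open>tangent_space\<close> gives the right velocity in all other charts.\<close>

lemma asy_tangent_line:
  fixes \<A> :: "('x::{t2_space,second_countable_topology}, 'e::real_normed_vector) chart set"
  assumes A: "smooth_manifold \<A>" and c: "c \<in> charts_at \<A> p" and u: "u \<in> tangent_space \<A> p"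
    and d: "d \<in> charts_at \<A> p"
  shows "asy d p 1 (\<lambda>t. cinv c (snd c p + t *\<^sub>R u c)) (u d)"
proof -
  note ch = manifold_chart[OF A c]
  have U: "open (snd c ` fst c)" using ch by (simp add: is_chart_def)
  have "((\<lambda>t::real. snd c p + t *\<^sub>R u c) \<longlongrightarrow> snd c p + 0 *\<^sub>R u c) (at_right 0)"
    by (intro tendsto_intros)
  then have "((\<lambda>t::real. snd c p + t *\<^sub>R u c) \<longlongrightarrow> snd c p) (at_right 0)" by simp
  from topological_tendstoD[OF this U imageI[OF charts_atD[OF c]]]
  have "\<forall>\<^sub>F t in at_right (0::real). snd c p + t *\<^sub>R u c \<in> snd c ` fst c" .
  then have ev: "\<forall>\<^sub>F t in at_right (0::real). cinv c (snd c p + t *\<^sub>R u c) \<in> fst c \<and>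
      snd c (cinv c (snd c p + t *\<^sub>R u c)) = snd c p + t *\<^sub>R u c"
    by eventually_elim (simp add: chart_image_cinv[OF ch])
  have "\<forall>\<^sub>F t in at_right (0::real).
      u c = inverse (t ^ 1) *\<^sub>R (snd c (cinv c (snd c p + t *\<^sub>R u c)) - snd c p)"
    using ev at_right_0_pos by eventually_elim simp
  with tendsto_const have "((\<lambda>t. inverse (t ^ 1) *\<^sub>R (snd c (cinv c (snd c p + t *\<^sub>R u c)) - snd c p))
      \<longlongrightarrow> u c) (at_right 0)" by (rule Lim_transform_eventually)
  moreover have "\<forall>\<^sub>F t in at_right (0::real). cinv c (snd c p + t *\<^sub>R u c) \<in> fst c"
    using ev by eventually_elim simp
  ultimately have "asy c p 1 (\<lambda>t. cinv c (snd c p + t *\<^sub>R u c)) (u c)"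
    by (simp only: asy_def)
  note asy_change_chart[OF A c d order_refl this]
  moreover have "u d = frechet_derivative (snd d \<circ> cinv c) (at (snd c p)) (u c)"
    using u c d unfolding tangent_space_def by blast
  ultimately show ?thesis by (simp only:)
qed

lemma smooth_at_fst_snd: "smooth_at p fst" "smooth_at p snd"
  by (rule smooth_at_bounded_linear[OF bounded_linear_fst smooth_at_id]
      smooth_at_bounded_linear[OF bounded_linear_snd smooth_at_id])+

lemma msmooth_at_cinv_fst_snd:
  fixes \<A> :: "('x::{t2_space,second_countable_topology}, 'e::real_normed_vector) chart set"
  assumes A: "smooth_manifold \<A>" and c: "c \<in> charts_at \<A> p"
  shows "msmooth_at \<A> (snd c p, z) (\<lambda>q. cinv c (fst q))"
    and "msmooth_at \<A> (z', snd c p) (\<lambda>q. cinv c (snd q))"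
proof -
  have "c \<in> \<A>" "snd c p \<in> snd c ` fst c" using c by (auto simp: charts_at_def)
  then show "msmooth_at \<A> (snd c p, z) (\<lambda>q. cinv c (fst q))"
    and "msmooth_at \<A> (z', snd c p) (\<lambda>q. cinv c (snd q))"
    by (auto intro: msmooth_at_cinv[OF A _ _ smooth_at_fst_snd(1)] msmooth_at_cinv[OF A _ _ smooth_at_fst_snd(2)])
qed

text \<open>Treats two situations at once: \<open>X\<close> acting on itself by the rack product,
  and \<open>X\<close> acting on \<open>A\<close> by \<rho>. In both, the base point of the target
  is fixed and \<open>e\<close> acts trivially.\<close>

context
  fixes \<A> :: "('x::{t2_space,second_countable_topology}, 'e::real_normed_vector) chart set"
    and \<B> :: "('y::{t2_space,second_countable_topology}, 'f::real_normed_vector) chart set"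
    and F :: "'x \<Rightarrow> 'y \<Rightarrow> 'y" and e :: 'x and y0 :: 'y
  assumes A: "smooth_manifold \<A>" and B: "smooth_manifold \<B>"
    and F: "smooth_map (prod_atlas \<A> \<B>) \<B> (\<lambda>(x, y). F x y)"
    and Fo: "\<And>x. F x y0 = y0" and Fe: "\<And>y. F e y = y"
begin

text \<open>Source and target charts of the second argument are kept apart because
  \<open>tmap\<close> uses the chosen chart at the source but is evaluated in every chart at the
  target.\<close>

private abbreviation G where "G c b d z \<equiv> snd d (F (cinv c (fst z)) (cinv b (snd z)))"

private lemma local_smooth:
  assumes c: "c \<in> charts_at \<A> e" and b: "b \<in> charts_at \<B> y0" and d: "d \<in> charts_at \<B> y0"
  shows "smooth_at (snd c e, snd b y0) (G c b d)"
    and "\<forall>\<^sub>F z in nhds (snd c e, snd b y0). F (cinv c (fst z)) (cinv b (snd z)) \<in> fst d"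
proof -
  have "cinv b (snd b y0) = y0" by (rule chart_cinv[OF manifold_chart[OF B b] charts_atD[OF b]])
  moreover have "msmooth_at \<B> (snd c e, snd b y0) (\<lambda>z. F (cinv c (fst z)) (cinv b (snd z)))"
    by (intro msmooth_at_compose2[OF A B F] msmooth_at_cinv_fst_snd A B c b)
  ultimately show "smooth_at (snd c e, snd b y0) (G c b d)"
    and "\<forall>\<^sub>F z in nhds (snd c e, snd b y0). F (cinv c (fst z)) (cinv b (snd z)) \<in> fst d"
    using d unfolding msmooth_at_def by (simp_all add: Fo)
qed

lemma conv_action:
  assumes c: "c \<in> charts_at \<A> e" and b: "b \<in> charts_at \<B> y0" and d: "d \<in> charts_at \<B> y0"
    and x: "conv c e x" and y: "conv b y0 y"
  shows "conv d y0 (\<lambda>t. F (x t) (y t))"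
proof -
  note chc = manifold_chart[OF A c] and chb = manifold_chart[OF B b]
  have inv: "\<forall>\<^sub>F t in at_right 0. cinv c (snd c (x t)) = x t \<and> cinv b (snd b (y t)) = y t"
    using conjunct1[OF x[unfolded conv_def]] conjunct1[OF y[unfolded conv_def]]
    by eventually_elim (simp add: chart_cinv[OF chc] chart_cinv[OF chb])
  have lim: "((\<lambda>t. (snd c (x t), snd b (y t))) \<longlongrightarrow> (snd c e, snd b y0)) (at_right 0)"
    using x y by (intro tendsto_Pair) (auto simp: conv_def)
  from eventually_nhds_compose[OF local_smooth(2)[OF c b d] lim] inv
  have "\<forall>\<^sub>F t in at_right 0. F (x t) (y t) \<in> fst d" by eventually_elim simp
  moreover have "((\<lambda>t. G c b d (snd c (x t), snd b (y t))) \<longlongrightarrow> G c b d (snd c e, snd b y0)) (at_right 0)"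
    by (rule filterlim_compose[OF smooth_at_tendsto[OF local_smooth(1)[OF c b d]] lim])
  then have "((\<lambda>t. snd d (F (x t) (y t))) \<longlongrightarrow> G c b d (snd c e, snd b y0)) (at_right 0)"
    by (rule Lim_transform_eventually) (use inv in \<open>eventually_elim, simp\<close>)
  ultimately show ?thesis
    by (simp add: conv_def Fo chart_cinv[OF chb charts_atD[OF b]])
qed

text \<open>A second difference with one edge in each argument. Of its four corners, those at (x,
  y0) and (e, y0) have the same value and cancel, and the one at (e, y) is y itself. What remains
  has order \<open>1 + m\<close>, and \<open>iter_deriv_partials\<close> identifies the limit with
  the endomorphism-valued derivative.\<close>

lemma tendsto_action:
  assumes d: "d \<in> charts_at \<B> y0" and m: "m \<ge> 1"
    and x: "asy (chart_at \<A> e) e 1 x (u (chart_at \<A> e))"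
    and y: "asy (chart_at \<B> y0) y0 m y (v (chart_at \<B> y0))"
  shows "((\<lambda>t. inverse (t ^ Suc m) *\<^sub>R (snd d (F (x t) (y t)) - snd d (y t)))
    \<longlongrightarrow> tmap_End \<A> e (\<lambda>x. tmap \<B> \<B> y0 (F x)) u v d) (at_right 0)"
proof -
  define c where "c = chart_at \<A> e"
  define b where "b = chart_at \<B> y0"
  have c: "c \<in> charts_at \<A> e" and b: "b \<in> charts_at \<B> y0"
    unfolding c_def b_def by (rule chart_at_charts_at[OF A] chart_at_charts_at[OF B])+
  note chc = manifold_chart[OF A c] and chb = manifold_chart[OF B b]
  have ce: "cinv c (snd c e) = e" and bo: "cinv b (snd b y0) = y0"
    using chart_cinv chc chb charts_atD c b by metis+
  note sm = local_smooth(1)[OF c b d]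
  obtain S where S: "open S" "(snd c e, snd b y0) \<in> S" "smooth_on S (G c b d)"
    using sm smooth_at_def by blast
  obtain I :: "'e set" and bs :: "'e \<Rightarrow> 'e" and l where co: "full_coords I bs l"
    using manifold_coords[OF A] by blast
  obtain J :: "'f set" and bs' :: "'f \<Rightarrow> 'f" and l' where co': "full_coords J bs' l'"
    using manifold_coords[OF B] by blast
  note co2 = full_coords_prod[OF co co']
  \<comment> \<open>Booleans label the two edges: \<open>True\<close> is the edge in the first
    argument, of order 1, and \<open>False\<close> the edge in the second, of order
    \<open>m\<close>.\<close>
  define w where "w k t = (if k then (inverse (t ^ 1) *\<^sub>R (snd c (x t) - snd c e), 0)
    else (0, inverse (t ^ m) *\<^sub>R (snd b (y t) - snd b y0)))" for k t
  define w0 where "w0 k = (if k then (u c, 0) else (0, v b))" for k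
  have w: "(w k \<longlongrightarrow> w0 k) (at_right 0)" for k
  proof (cases k)
    case True
    have "((\<lambda>t. inverse (t ^ 1) *\<^sub>R (snd c (x t) - snd c e)) \<longlongrightarrow> u c) (at_right 0)"
      using x by (simp add: asy_def c_def)
    then show ?thesis
      unfolding w_def w0_def using True by (simp only: if_True) (rule tendsto_Pair[OF _ tendsto_const])
  next
    case False
    have "((\<lambda>t. inverse (t ^ m) *\<^sub>R (snd b (y t) - snd b y0)) \<longlongrightarrow> v b) (at_right 0)"
      using y by (simp add: asy_def b_def)
    then show ?thesis
      unfolding w_def w0_def using False by (simp only: if_False) (rule tendsto_Pair[OF tendsto_const])
  qed
  let ?m = "\<lambda>k. if k then 1 else m"
  have lim: "((\<lambda>t. inverse (t ^ sum_list (map ?m [True, False])) *\<^sub>R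
      idiff (G c b d) (map (\<lambda>k. t ^ ?m k *\<^sub>R w k t) [True, False]) (snd c e, snd b y0))
      \<longlongrightarrow> iter_deriv (G c b d) (map w0 [True, False]) (snd c e, snd b y0)) (at_right 0)"
    using m by (intro tendsto_idiff[OF S full_coords_fin_coords[OF co2] full_coords_determined[OF co2] w _ tendsto_const]) auto
  have inv: "\<forall>\<^sub>F t in at_right 0. cinv c (snd c (x t)) = x t \<and> cinv b (snd b (y t)) = y t"
    using conjunct1[OF x[unfolded asy_def, folded c_def]] conjunct1[OF y[unfolded asy_def, folded b_def]]
    by eventually_elim (simp add: chart_cinv[OF chc] chart_cinv[OF chb])
  have "\<forall>\<^sub>F t in at_right 0. inverse (t ^ sum_list (map ?m [True, False])) *\<^sub>R
      idiff (G c b d) (map (\<lambda>k. t ^ ?m k *\<^sub>R w k t) [True, False]) (snd c e, snd b y0)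
      = inverse (t ^ Suc m) *\<^sub>R (snd d (F (x t) (y t)) - snd d (y t))"
    using inv at_right_0_pos
  proof eventually_elim
    case (elim t)
    have "map (\<lambda>k. t ^ ?m k *\<^sub>R w k t) [True, False] = [(snd c (x t) - snd c e, 0), (0, snd b (y t) - snd b y0)]"
      using elim by (simp add: w_def)
    then show ?case using elim by (simp add: Fe Fo ce bo)
  qed
  from Lim_transform_eventually[OF lim this]
  have "((\<lambda>t. inverse (t ^ Suc m) *\<^sub>R (snd d (F (x t) (y t)) - snd d (y t)))
      \<longlongrightarrow> iter_deriv (G c b d) [(u c, 0), (0, v b)] (snd c e, snd b y0)) (at_right 0)"
    by (simp add: w0_def)
  moreover have "iter_deriv (G c b d) [(u c, 0), (0, v b)] (snd c e, snd b y0)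
      = tmap_End \<A> e (\<lambda>x. tmap \<B> \<B> y0 (F x)) u v d"
    using d unfolding iter_deriv_partials[OF sm] tmap_End_def tmap_def
    by (simp add: Let_def Fo o_def flip: c_def b_def)
  ultimately show ?thesis by simp
qed

end

section \<open>Lie racks and their modules\<close>

locale lie_rack_module =
  fixes \<A> :: "('x::{t2_space,second_countable_topology}, 'e::real_normed_vector) chart set"
    and r :: "'x \<Rightarrow> 'x \<Rightarrow> 'x" and e :: 'x
    and \<B> :: "('a::{t2_space,second_countable_topology,ab_group_add}, 'f::real_normed_vector) chart set"
    and \<rho> :: "'x \<Rightarrow> 'a \<Rightarrow> 'a"
  assumes lie_rack: "lie_rack \<A> r e" and module: "smooth_As_module \<A> r e \<B> \<rho>"
begin

lemma rack_manifold: "smooth_manifold \<A>"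
  and smooth_r: "smooth_map (prod_atlas \<A> \<A>) \<A> (\<lambda>(x, y). r x y)"
  and r_e_left [simp]: "r e x = x" and r_e_right [simp]: "r x e = e"
  using lie_rack by (auto simp: lie_rack_def pointed_rack_def)

lemma module_manifold: "smooth_manifold \<B>"
  and smooth_add: "smooth_map (prod_atlas \<B> \<B>) \<B> (\<lambda>(a, b). a + b)"
  and smooth_uminus: "smooth_map \<B> \<B> (\<lambda>a. - a)"
  and smooth_\<rho>: "smooth_map (prod_atlas \<A> \<B>) \<B> (\<lambda>(x, a). \<rho> x a)"
  and \<rho>_add: "\<rho> x (a + b) = \<rho> x a + \<rho> x b"
  and \<rho>_e [simp]: "\<rho> e a = a"
  using module by (auto simp: smooth_As_module_def abelian_lie_group_def)

lemma \<rho>_0 [simp]: "\<rho> x 0 = 0"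
  using \<rho>_add[of x 0 0] by simp

lemma msmooth_add: "msmooth_at \<B> p h \<Longrightarrow> msmooth_at \<B> p k \<Longrightarrow> msmooth_at \<B> p (\<lambda>q. h q + k q)"
  by (rule msmooth_at_compose2[OF module_manifold module_manifold smooth_add])

lemma msmooth_uminus: "msmooth_at \<B> p h \<Longrightarrow> msmooth_at \<B> p (\<lambda>q. - h q)"
  by (rule msmooth_at_compose[OF module_manifold smooth_uminus])

lemma msmooth_diff: "msmooth_at \<B> p h \<Longrightarrow> msmooth_at \<B> p k \<Longrightarrow> msmooth_at \<B> p (\<lambda>q. h q - k q)"
  using msmooth_add[OF _ msmooth_uminus] by fastforce

lemma msmooth_sum:
  "(\<And>i. i \<in> I \<Longrightarrow> msmooth_at \<B> p (h i)) \<Longrightarrow> msmooth_at \<B> p (\<lambda>q. \<Sum>i\<in>I. h i q)"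
  by (induction I rule: infinite_finite_induct) (simp_all add: msmooth_at_const msmooth_add)

lemma msmooth_signed: "msmooth_at \<B> p h \<Longrightarrow> msmooth_at \<B> p (\<lambda>q. signed k (h q))"
  unfolding signed_def by (cases "even k") (simp_all add: msmooth_uminus)

lemma msmooth_\<rho>: "msmooth_at \<A> p h \<Longrightarrow> msmooth_at \<B> p k \<Longrightarrow> msmooth_at \<B> p (\<lambda>q. \<rho> (h q) (k q))"
  by (rule msmooth_at_compose2[OF rack_manifold module_manifold smooth_\<rho>])

lemma msmooth_r: "msmooth_at \<A> p h \<Longrightarrow> msmooth_at \<A> p k \<Longrightarrow> msmooth_at \<A> p (\<lambda>q. r (h q) (k q))"
  by (rule msmooth_at_compose2[OF rack_manifold rack_manifold smooth_r])

lemma msmooth_rprod: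
  "hs \<noteq> [] \<Longrightarrow> (\<And>h. h \<in> set hs \<Longrightarrow> msmooth_at \<A> p h) \<Longrightarrow>
    msmooth_at \<A> p (\<lambda>q. rprod r (map (\<lambda>h. h q) hs))"
proof (induction hs rule: induct_list012)
  case (3 h k hs)
  then have "msmooth_at \<A> p (\<lambda>q. rprod r (map (\<lambda>h. h q) (k # hs)))" by simp
  with msmooth_r[OF 3(4), of h] show ?case by simp
qed simp_all

lemma rprod_e: "xs \<noteq> [] \<Longrightarrow> last xs = e \<Longrightarrow> rprod r xs = e"
  by (induction xs rule: induct_list012) auto

text \<open>Velocities are recorded in all charts at once because \<open>delta\<close> works in a
  given chart \<open>c\<close>, while \<open>tmap\<close> and \<open>tmap_End\<close> work in
  \<open>chart_at\<close>.\<close>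

definition vel :: "(real \<Rightarrow> 'x) \<Rightarrow> ('x, 'e) tvec \<Rightarrow> bool" where
  "vel x u \<longleftrightarrow> (\<forall>c\<in>charts_at \<A> e. asy c e 1 x (u c))"

lemma velD: "vel x u \<Longrightarrow> c \<in> charts_at \<A> e \<Longrightarrow> asy c e 1 x (u c)"
  by (simp add: vel_def)

lemma vel_conv: "vel x u \<Longrightarrow> c \<in> charts_at \<A> e \<Longrightarrow> conv c e x"
  by (rule asy_conv[OF velD order_refl])

lemma conv_r:
  assumes "c \<in> charts_at \<A> e" "conv c e x" "conv c e y"
  shows "conv c e (\<lambda>t. r (x t) (y t))"
  by (rule conv_action[OF rack_manifold rack_manifold smooth_r r_e_right r_e_left assms(1,1,1,2,3)])

lemma tendsto_bracket:
  assumes x: "vel x u" and y: "vel y v" and d: "d \<in> charts_at \<A> e"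
  shows "((\<lambda>t. inverse (t ^ 2) *\<^sub>R (snd d (r (x t) (y t)) - snd d (y t)))
    \<longlongrightarrow> bracket \<A> r e u v d) (at_right 0)"
  unfolding bracket_def ad_def Ad_def Suc_1[symmetric]
  by (rule tendsto_action[where u = u and v = v, OF rack_manifold rack_manifold smooth_r r_e_right r_e_left d order_refl
      velD[OF x chart_at_charts_at[OF rack_manifold]] velD[OF y chart_at_charts_at[OF rack_manifold]]])

text \<open>The product differs from \<open>y\<close> only at second order, so it inherits the
  velocity of \<open>y\<close>.\<close>

lemma vel_r:
  assumes x: "vel x u" and y: "vel y v"
  shows "vel (\<lambda>t. r (x t) (y t)) v"
  unfolding vel_def
proof
  fix d assume d: "d \<in> charts_at \<A> e"
  have "((\<lambda>t::real. t) \<longlongrightarrow> 0) (at_right 0)" by (rule tendsto_ident_at)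
  from tendsto_add[OF tendsto_scaleR[OF this tendsto_bracket[OF x y d]]
      conjunct2[OF velD[OF y d, unfolded asy_def]]]
  have "((\<lambda>t. t *\<^sub>R inverse (t ^ 2) *\<^sub>R (snd d (r (x t) (y t)) - snd d (y t))
      + inverse (t ^ 1) *\<^sub>R (snd d (y t) - snd d e)) \<longlongrightarrow> v d) (at_right 0)"
    unfolding scale_zero_left add_0 .
  moreover have "\<forall>\<^sub>F t in at_right 0. t *\<^sub>R inverse (t ^ 2) *\<^sub>R (snd d (r (x t) (y t)) - snd d (y t))
      + inverse (t ^ 1) *\<^sub>R (snd d (y t) - snd d e)
      = inverse (t ^ 1) *\<^sub>R (snd d (r (x t) (y t)) - snd d e)"
    using at_right_0_pos
  proof eventually_elim
    case (elim t)
    then have "t * inverse (t ^ 2) = inverse (t ^ 1)" by (simp add: power2_eq_square field_simps)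
    then show ?case unfolding scaleR_scaleR by (simp only:) (simp only: scaleR_diff_right, simp)
  qed
  ultimately have "((\<lambda>t. inverse (t ^ 1) *\<^sub>R (snd d (r (x t) (y t)) - snd d e)) \<longlongrightarrow> v d) (at_right 0)"
    by (rule Lim_transform_eventually)
  with conv_r[OF d vel_conv[OF x d] vel_conv[OF y d]]
  show "asy d e 1 (\<lambda>t. r (x t) (y t)) (v d)" by (simp add: asy_def conv_def)
qed

text \<open>By \<open>vel_r\<close> only the last factor matters. This is why the operators indexed
  by iterated products in \<open>dR\<close> contribute the action of a single tangent
  vector.\<close>

lemma vel_rprod:
  "hs \<noteq> [] \<Longrightarrow> length us = length hs \<Longrightarrow> (\<And>i. i < length hs \<Longrightarrow> vel (hs ! i) (us ! i)) \<Longrightarrow>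
    vel (\<lambda>t. rprod r (map (\<lambda>h. h t) hs)) (last us)"
proof (induction hs arbitrary: us rule: induct_list012)
  case (2 h)
  then show ?case by (cases us) auto
next
  case (3 h k hs)
  then obtain u us' where us: "us = u # us'" "length us' = length (k # hs)" by (cases us) auto
  have "vel ((k # hs) ! i) (us' ! i)" if "i < length (k # hs)" for i
    using 3(5)[of "Suc i"] that us by simp
  then have "vel (\<lambda>t. rprod r (map (\<lambda>h. h t) (k # hs))) (last us')"
    using us by (intro 3(2)) auto
  moreover have "vel h u" using 3(5)[of 0] us by simp
  moreover have "us' \<noteq> []" using us by auto
  ultimately show ?case using vel_r[of h u] us by simp
qed simp

lemma conv_\<rho>:
  assumes "c \<in> charts_at \<A> e" "d \<in> charts_at \<B> 0" "conv c e x" "conv d 0 \<alpha>"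
  shows "conv d 0 (\<lambda>t. \<rho> (x t) (\<alpha> t))"
  by (rule conv_action[OF rack_manifold module_manifold smooth_\<rho> \<rho>_0 \<rho>_e assms(1,2,2,3,4)])

lemma tendsto_act:
  assumes x: "vel x u" and \<alpha>: "\<And>b. b \<in> charts_at \<B> 0 \<Longrightarrow> asy b 0 m \<alpha> (v b)"
    and m: "m \<ge> 1" and d: "d \<in> charts_at \<B> 0"
  shows "((\<lambda>t. inverse (t ^ Suc m) *\<^sub>R (snd d (\<rho> (x t) (\<alpha> t)) - snd d (\<alpha> t)))
    \<longlongrightarrow> act \<A> e \<B> \<rho> u v d) (at_right 0)"
  unfolding act_def
  by (rule tendsto_action[where u = u and v = v, OF rack_manifold module_manifold smooth_\<rho> \<rho>_0 \<rho>_e d m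
        velD[OF x chart_at_charts_at[OF rack_manifold]] \<alpha>[OF chart_at_charts_at[OF module_manifold]]])

text \<open>Since \<rho> fixes 0, the entry of the tangent map at such a chart is constantly 0 in
  the rack element that is differentiated.\<close>

lemma act_outside: "d \<notin> charts_at \<B> 0 \<Longrightarrow> act \<A> e \<B> \<rho> u v d = 0"
  unfolding act_def tmap_End_def tmap_def Let_def
  by (simp add: frechet_derivative_eq[OF has_derivative_const])

text \<open>In a chart, \<open>(a, b) \<mapsto> a - b\<close> is constant on the diagonal and is the identity for \<open>b = 0\<close>.\<close>

lemma asy_close_diff:
  assumes d: "d \<in> charts_at \<B> 0" and \<alpha>: "conv d 0 \<alpha>" and \<beta>: "conv d 0 \<beta>" and m: "m \<ge> 1"
    and lim: "((\<lambda>t. inverse (t ^ m) *\<^sub>R (snd d (\<alpha> t) - snd d (\<beta> t))) \<longlongrightarrow> L) (at_right 0)"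
  shows "asy d 0 m (\<lambda>t. \<alpha> t - \<beta> t) L"
proof -
  let ?o = "snd d 0"
  let ?\<nu> = "\<lambda>z. snd d (cinv d (fst z) - cinv d (snd z))"
  note ch = manifold_chart[OF module_manifold d]
  have d0: "cinv d ?o = 0" by (rule chart_cinv[OF ch charts_atD[OF d]])
  have "msmooth_at \<B> (?o, ?o) (\<lambda>z. cinv d (fst z) - cinv d (snd z))"
    by (rule msmooth_diff[OF msmooth_at_cinv_fst_snd[OF module_manifold d]])
  then have sm: "smooth_at (?o, ?o) ?\<nu>"
    and ev: "\<forall>\<^sub>F z in nhds (?o, ?o). cinv d (fst z) - cinv d (snd z) \<in> fst d"
    using d unfolding msmooth_at_def by (auto simp: d0)
  obtain I :: "'f set" and b :: "'f \<Rightarrow> 'f" and l where co: "full_coords I b l"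
    using manifold_coords[OF module_manifold] by blast
  have inv: "\<forall>\<^sub>F t in at_right 0. cinv d (snd d (\<alpha> t)) = \<alpha> t \<and> cinv d (snd d (\<beta> t)) = \<beta> t"
    using conjunct1[OF \<alpha>[unfolded conv_def]] conjunct1[OF \<beta>[unfolded conv_def]]
    by eventually_elim (simp add: chart_cinv[OF ch])
  have l\<alpha>: "((\<lambda>t. (snd d (\<alpha> t), snd d (\<beta> t))) \<longlongrightarrow> (?o, ?o)) (at_right 0)"
    and l\<beta>: "((\<lambda>t. (snd d (\<beta> t), snd d (\<beta> t))) \<longlongrightarrow> (?o, ?o)) (at_right 0)"
    using \<alpha> \<beta> by (auto intro!: tendsto_Pair simp: conv_def)
  from eventually_nhds_compose[OF ev l\<alpha>] inv
  have mem: "\<forall>\<^sub>F t in at_right 0. \<alpha> t - \<beta> t \<in> fst d" by eventually_elim simp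
  \<comment> \<open>The pair (\<alpha>, \<beta>) is compared with the diagonal pair (\<beta>,
    \<beta>): the differences of their entries are \<alpha> - \<beta> and 0.\<close>
  have "((\<lambda>t. inverse (t ^ m) *\<^sub>R ((snd d (\<alpha> t), snd d (\<beta> t)) - (snd d (\<beta> t), snd d (\<beta> t)))) \<longlongrightarrow> (L, 0))
      (at_right 0)"
    using tendsto_Pair[OF lim tendsto_const[of 0]] by simp
  from tendsto_difference_quotient[OF full_coords_prod[OF co co] sm m this l\<beta>]
  have "((\<lambda>t. inverse (t ^ m) *\<^sub>R (snd d (cinv d (snd d (\<alpha> t)) - cinv d (snd d (\<beta> t))) - snd d 0))
      \<longlongrightarrow> frechet_derivative ?\<nu> (at (?o, ?o)) (L, 0)) (at_right 0)"
    by simp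
  moreover have "\<forall>\<^sub>F t in at_right 0.
      inverse (t ^ m) *\<^sub>R (snd d (cinv d (snd d (\<alpha> t)) - cinv d (snd d (\<beta> t))) - snd d 0)
      = inverse (t ^ m) *\<^sub>R (snd d (\<alpha> t - \<beta> t) - snd d 0)"
    using inv by eventually_elim simp
  ultimately have "((\<lambda>t. inverse (t ^ m) *\<^sub>R (snd d (\<alpha> t - \<beta> t) - snd d 0))
      \<longlongrightarrow> frechet_derivative ?\<nu> (at (?o, ?o)) (L, 0)) (at_right 0)"
    by (rule Lim_transform_eventually)
  moreover have "frechet_derivative ?\<nu> (at (?o, ?o)) (L, 0) = L"
  proof -
    have "((\<lambda>x. (x, ?o)) has_derivative (\<lambda>h. (h, 0))) (at ?o)"
      by (auto intro!: derivative_eq_intros)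
    note has_derivative_compose[OF this smooth_at_has_derivative[OF sm]]
    moreover have "((\<lambda>x. ?\<nu> (x, ?o)) has_derivative (\<lambda>h. h)) (at ?o)"
    proof (rule has_derivative_transform_within_open[OF has_derivative_ident])
      show "open (snd d ` fst d)" using ch by (simp add: is_chart_def)
      show "?o \<in> snd d ` fst d" using charts_atD[OF d] by simp
      show "x = ?\<nu> (x, ?o)" if "x \<in> snd d ` fst d" for x
        using chart_image_cinv[OF ch that] by (simp add: d0)
    qed
    ultimately have "(\<lambda>h. frechet_derivative ?\<nu> (at (?o, ?o)) (h, 0)) = (\<lambda>h. h)"
      by (rule has_derivative_unique)
    then show ?thesis by (rule fun_cong)
  qed
  ultimately show ?thesis using mem by (simp add: asy_def)
qed

text \<open>The remaining additive rules reduce to this one, negation being subtraction from 0 and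
  addition being subtraction of a negative.\<close>

lemma asy_diff:
  assumes d: "d \<in> charts_at \<B> 0" and m: "m \<ge> 1"
    and \<alpha>: "asy d 0 m \<alpha> L" and \<beta>: "asy d 0 m \<beta> M"
  shows "asy d 0 m (\<lambda>t. \<alpha> t - \<beta> t) (L - M)"
proof (rule asy_close_diff[OF d asy_conv[OF \<alpha> m] asy_conv[OF \<beta> m] m])
  have "((\<lambda>t. inverse (t ^ m) *\<^sub>R (snd d (\<alpha> t) - snd d 0) - inverse (t ^ m) *\<^sub>R (snd d (\<beta> t) - snd d 0))
      \<longlongrightarrow> L - M) (at_right 0)"
    using \<alpha> \<beta> by (intro tendsto_diff) (auto simp: asy_def)
  then show "((\<lambda>t. inverse (t ^ m) *\<^sub>R (snd d (\<alpha> t) - snd d (\<beta> t))) \<longlongrightarrow> L - M) (at_right 0)"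
    by (simp flip: scaleR_diff_right)
qed

lemma asy_uminus:
  assumes "d \<in> charts_at \<B> 0" "m \<ge> 1" "asy d 0 m \<alpha> L"
  shows "asy d 0 m (\<lambda>t. - \<alpha> t) (- L)"
  using asy_diff[OF assms(1,2) asy_const[OF charts_atD[OF assms(1)]] assms(3)] by simp

lemma asy_add:
  assumes "d \<in> charts_at \<B> 0" "m \<ge> 1" "asy d 0 m \<alpha> L" "asy d 0 m \<beta> M"
  shows "asy d 0 m (\<lambda>t. \<alpha> t + \<beta> t) (L + M)"
  using asy_diff[OF assms(1,2,3) asy_uminus[OF assms(1,2,4)]] by simp

lemma asy_sum:
  assumes "d \<in> charts_at \<B> 0" "m \<ge> 1"
  shows "(\<And>i. i \<in> I \<Longrightarrow> asy d 0 m (\<alpha> i) (L i)) \<Longrightarrow> asy d 0 m (\<lambda>t. \<Sum>i\<in>I. \<alpha> i t) (\<Sum>i\<in>I. L i)"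
  by (induction I rule: infinite_finite_induct)
    (simp_all add: asy_const[OF charts_atD[OF assms(1)]] asy_add[OF assms])

lemma asy_signed:
  assumes "d \<in> charts_at \<B> 0" "m \<ge> 1" "asy d 0 m \<alpha> L"
  shows "asy d 0 m (\<lambda>t. signed k (\<alpha> t)) ((- 1) ^ k *\<^sub>R L)"
  using assms(3) asy_uminus[OF assms] by (cases "even k") (simp_all add: signed_def)

end

section \<open>Differences of maps that vanish on coordinate faces\<close>

lemma local_rep_vanish:
  assumes f: "f \<in> CR \<A> e \<B> n" and c: "is_chart c" "e \<in> fst c" and k: "k < n" "apply_bcontfun v k = snd c e"
  shows "local_rep c d n f v = snd d 0"
proof -
  have "e = (\<lambda>i. cinv c (apply_bcontfun v i)) k" using c k by (simp add: chart_cinv)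
  then have "e \<in> set (map (\<lambda>i. cinv c (apply_bcontfun v i)) [0..<n])" using k(1) by fastforce
  then show ?thesis unfolding local_rep_def using CR_vanish[OF f] by simp
qed

text \<open>No edge moves slot \<open>k\<close>, so all corners stay on its face.\<close>

lemma idiff_face:
  fixes G :: "(nat \<Rightarrow>\<^sub>C 'e::real_normed_vector) \<Rightarrow> 'w::real_normed_vector"
  assumes G: "\<And>v. apply_bcontfun v k = p \<Longrightarrow> G v = 0"
  shows "k \<notin> set ks \<Longrightarrow> apply_bcontfun v k = p \<Longrightarrow> idiff G (map (\<lambda>k. single k (h k)) ks) v = 0"
  by (induction ks arbitrary: v) (simp_all add: G)

text \<open>The base point may lie off the face of slot \<open>j\<close>, hence the second surviving term.\<close>

lemma idiff_faces:
  fixes G :: "(nat \<Rightarrow>\<^sub>C 'e::real_normed_vector) \<Rightarrow> 'w::real_normed_vector"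
  assumes G: "\<And>k v. k < n \<Longrightarrow> apply_bcontfun v k = p \<Longrightarrow> G v = 0"
  shows "distinct ks \<Longrightarrow> set ks \<subseteq> {..<n} \<Longrightarrow> (\<And>k. k \<in> set ks - {j} \<Longrightarrow> apply_bcontfun v k = p) \<Longrightarrow>
    idiff G (map (\<lambda>k. single k (h k)) ks) v = G (v + (\<Sum>k\<in>set ks. single k (h k)))
      - (if j \<in> set ks then G (v + (\<Sum>k\<in>set ks - {j}. single k (h k))) else 0)"
proof (induction ks arbitrary: v)
  case (Cons k ks)
  have IH: "idiff G (map (\<lambda>k. single k (h k)) ks) w = G (w + (\<Sum>k\<in>set ks. single k (h k)))
      - (if j \<in> set ks then G (w + (\<Sum>k\<in>set ks - {j}. single k (h k))) else 0)"
    if "\<And>k. k \<in> set ks - {j} \<Longrightarrow> apply_bcontfun w k = p" for w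
    using Cons.prems that by (intro Cons.IH) auto
  have k: "k \<notin> set ks" "k < n" using Cons.prems by auto
  have "apply_bcontfun (v + single k (h k)) i = p" if "i \<in> set ks - {j}" for i
    using Cons.prems(3)[of i] that k by auto
  note shifted = IH[OF this]
  show ?case
  \<comment> \<open>Splitting off an edge other than \<open>j\<close> leaves an unmoved half on the
    face of slot \<open>k\<close>, which contributes 0. For the edge \<open>j\<close> both halves
    survive.\<close>
  proof (cases "k = j")
    case True
    have "idiff G (map (\<lambda>k. single k (h k)) ks) v = G (v + (\<Sum>k\<in>set ks. single k (h k)))"
      using IH[of v] Cons.prems(3) k True by auto
    then show ?thesis using shifted True k by (simp add: add.assoc)
  next
    case False
    have "idiff G (map (\<lambda>k. single k (h k)) ks) v = 0"
      using k False Cons.prems(3)[of k] by (intro idiff_face[of k p] G) auto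
    moreover have "insert k (set ks) - {j} = insert k (set ks - {j})" using False by auto
    ultimately show ?thesis using shifted False k by (simp add: add.assoc)
  qed
qed simp

section \<open>Cochains along curves\<close>

lemma single_scaleR: "single k (s *\<^sub>R a) = s *\<^sub>R single k a"
  using bounded_linear_single by (rule linear_simps)

lemma single_add: "single k (a + b) = single k a + single k b"
  using bounded_linear_single by (rule linear_simps)

lemma local_rep_eq:
  assumes c: "is_chart c" and ys: "length ys = n"
    "\<And>k. k < n \<Longrightarrow> ys ! k \<in> fst c \<and> apply_bcontfun v k = snd c (ys ! k)"
  shows "map (\<lambda>i. cinv c (apply_bcontfun v i)) [0..<n] = ys" "local_rep c d n f v = snd d (f ys)"
proof -
  show "map (\<lambda>i. cinv c (apply_bcontfun v i)) [0..<n] = ys"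
    by (rule nth_equalityI) (use ys chart_cinv[OF c] in auto)
  then show "local_rep c d n f v = snd d (f ys)" by (simp add: local_rep_def)
qed

lemma length_del: "k < length xs \<Longrightarrow> length (del k xs) = length xs - 1"
  by (simp add: del_def)

lemma nth_del:
  "k < length xs \<Longrightarrow> l < length xs - 1 \<Longrightarrow> del k xs ! l = (if l < k then xs ! l else xs ! Suc l)"
  by (auto simp: del_def nth_append)

lemma map_del: "map g (del k xs) = del k (map g xs)"
  by (simp add: del_def take_map drop_map)

lemma set_del_subset: "set (del k xs) \<subseteq> set xs"
  by (auto simp: del_def dest: in_set_takeD in_set_dropD)

context lie_rack_module
begin

lemma msmooth_CR_coords:
  assumes f: "f \<in> CR \<A> e \<B> n" "n \<ge> 1" and c: "c \<in> charts_at \<A> e"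
  shows "msmooth_at \<B> (const_bcontfun (snd c e)) (\<lambda>v. f (map (\<lambda>i. cinv c (apply_bcontfun v i)) [0..<n]))"
proof -
  let ?p = "const_bcontfun (snd c e) :: nat \<Rightarrow>\<^sub>C 'e"
  let ?hs = "map (\<lambda>i v. cinv c (apply_bcontfun v i)) [0..<n] :: ((nat \<Rightarrow>\<^sub>C 'e) \<Rightarrow> 'x) list"
  have "msmooth_at \<A> ?p (\<lambda>v. cinv c (apply_bcontfun v i))" for i
  proof (rule msmooth_at_cinv[OF rack_manifold])
    show "smooth_at ?p (\<lambda>v. apply_bcontfun v i)"
      by (rule smooth_at_bounded_linear[OF bounded_linear_apply_bcontfun smooth_at_id])
  qed (use c in \<open>auto simp: charts_at_def\<close>)
  then have "msmooth_at \<B> ?p (\<lambda>v. f (map (\<lambda>h. h v) ?hs))"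
    using chart_cinv[OF manifold_chart[OF rack_manifold c] charts_atD[OF c]]
    by (intro msmooth_at_CR[OF rack_manifold f]) auto
  then show ?thesis by (simp add: o_def)
qed

lemma local_rep_smooth:
  assumes f: "f \<in> CR \<A> e \<B> n" "n \<ge> 1" and c: "c \<in> charts_at \<A> e" and d: "d \<in> charts_at \<B> 0"
  shows "smooth_at (const_bcontfun (snd c e)) (local_rep c d n f)"
    and "\<forall>\<^sub>F v in nhds (const_bcontfun (snd c e)). f (map (\<lambda>i. cinv c (apply_bcontfun v i)) [0..<n]) \<in> fst d"
proof -
  have "map (\<lambda>i. cinv c (apply_bcontfun (const_bcontfun (snd c e)) i)) [0..<n] = replicate n e"
    using chart_cinv[OF manifold_chart[OF rack_manifold c] charts_atD[OF c]] by (simp add: map_replicate_trivial)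
  with d have "d \<in> charts_at \<B> (f (map (\<lambda>i. cinv c (apply_bcontfun (const_bcontfun (snd c e)) i)) [0..<n]))"
    using CR_replicate[OF f] by simp
  with msmooth_CR_coords[OF f c] show "smooth_at (const_bcontfun (snd c e)) (local_rep c d n f)"
    and "\<forall>\<^sub>F v in nhds (const_bcontfun (snd c e)). f (map (\<lambda>i. cinv c (apply_bcontfun v i)) [0..<n]) \<in> fst d"
    unfolding msmooth_at_def local_rep_def by blast+
qed

lemma conv_CR:
  assumes f: "f \<in> CR \<A> e \<B> n" "n \<ge> 1" and c: "c \<in> charts_at \<A> e" and d: "d \<in> charts_at \<B> 0"
    and xs: "length xs = n" "\<And>k. k < n \<Longrightarrow> conv c e (xs ! k)"
  shows "conv d 0 (\<lambda>t. f (map (\<lambda>h. h t) xs))"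
proof -
  let ?p = "const_bcontfun (snd c e) :: nat \<Rightarrow>\<^sub>C 'e"
  let ?v = "\<lambda>t. ?p + (\<Sum>k<n. single k (snd c ((xs ! k) t) - snd c e))"
  note ch = manifold_chart[OF rack_manifold c]
  have "((\<lambda>t. single k (snd c ((xs ! k) t) - snd c e)) \<longlongrightarrow> single k (snd c e - snd c e)) (at_right 0)"
    if "k < n" for k
    using xs(2)[OF that]
    by (intro bounded_linear.tendsto[OF bounded_linear_single] tendsto_diff tendsto_const) (simp add: conv_def)
  then have "(?v \<longlongrightarrow> ?p + (\<Sum>k<n. single k (snd c e - snd c e))) (at_right 0)"
    by (intro tendsto_add tendsto_const tendsto_sum) auto
  moreover have "single k (0 :: 'e) = 0" for k
    by (rule bcontfun_eqI) simp
  ultimately have v: "(?v \<longlongrightarrow> ?p) (at_right 0)" by simp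
  have ev: "\<forall>\<^sub>F t in at_right 0. \<forall>k\<in>{..<n}. (xs ! k) t \<in> fst c"
    using xs(2) by (intro eventually_ball_finite) (auto simp: conv_def)
  have "map (\<lambda>i. cinv c (apply_bcontfun (?v t) i)) [0..<n] = map (\<lambda>h. h t) xs"
    "local_rep c d n f (?v t) = snd d (f (map (\<lambda>h. h t) xs))"
    if "\<forall>k\<in>{..<n}. (xs ! k) t \<in> fst c" for t
    using that xs(1) by (intro local_rep_eq[OF ch]; simp)+
  note eq = this
  have "\<forall>\<^sub>F t in at_right 0. f (map (\<lambda>h. h t) xs) \<in> fst d"
    using eventually_nhds_compose[OF local_rep_smooth(2)[OF f c d] v] ev
    by eventually_elim (simp only: eq)
  moreover have "((\<lambda>t. local_rep c d n f (?v t)) \<longlongrightarrow> local_rep c d n f ?p) (at_right 0)"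
    by (rule filterlim_compose[OF smooth_at_tendsto[OF local_rep_smooth(1)[OF f c d]] v])
  then have "((\<lambda>t. snd d (f (map (\<lambda>h. h t) xs))) \<longlongrightarrow> local_rep c d n f ?p) (at_right 0)"
    by (rule Lim_transform_eventually) (use ev in eventually_elim, rule eq)
  moreover have "local_rep c d n f ?p = snd d 0"
    using f(2) by (intro local_rep_vanish[OF f(1) ch charts_atD[OF c], of 0]) auto
  ultimately show ?thesis by (simp add: conv_def)
qed

text \<open>A difference with an edge in each of the \<open>n\<close> slots: order \<open>m\<close>
  in slot \<open>j\<close> and order 1 elsewhere. A corner avoids the faces of the other slots only
  if all of these have moved; the two such corners differ in slot \<open>j\<close> and are the two
  values of \<open>f\<close> in the statement.\<close>

lemma tendsto_slot:
  assumes f: "f \<in> CR \<A> e \<B> n" "n \<ge> 1" and c: "c \<in> charts_at \<A> e" and d: "d \<in> charts_at \<B> 0"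
    and xs: "length xs = n" and j: "j < n"
    and others: "\<And>k. k < n \<Longrightarrow> k \<noteq> j \<Longrightarrow> asy c e 1 (xs ! k) ((vs ! k) c)"
    and slot: "conv c e (xs ! j)" "conv c e y" and m: "m \<ge> 1"
    and lim: "((\<lambda>t. inverse (t ^ m) *\<^sub>R (snd c (y t) - snd c ((xs ! j) t))) \<longlongrightarrow> (vs ! j) c) (at_right 0)"
  shows "((\<lambda>t. inverse (t ^ (n - 1 + m)) *\<^sub>R
      (snd d (f (map (\<lambda>h. h t) (xs[j := y]))) - snd d (f (map (\<lambda>h. h t) xs))))
    \<longlongrightarrow> delta c e \<B> n f vs d) (at_right 0)"
proof -
  let ?p = "const_bcontfun (snd c e) :: nat \<Rightarrow>\<^sub>C 'e"
  note ch = manifold_chart[OF rack_manifold c]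
  let ?F = "local_rep c d n f"
  obtain S where S: "open S" "?p \<in> S" "smooth_on S ?F"
    using local_rep_smooth(1)[OF f c d] smooth_at_def by blast
  obtain I :: "'e set" and b :: "'e \<Rightarrow> 'e" and l where co: "full_coords I b l"
    using manifold_coords[OF rack_manifold] by blast
  define \<mu> where "\<mu> k = (if k = j then m else 1)" for k
  define h where "h k t = (if k = j then snd c (y t) - snd c ((xs ! j) t) else snd c ((xs ! k) t) - snd c e)" for k t
  define w where "w k t = single k (inverse (t ^ \<mu> k) *\<^sub>R h k t)" for k t
  \<comment> \<open>The base point has the curve \<open>xs ! j\<close> in slot \<open>j\<close> and
    \<open>e\<close> elsewhere, so adding all edges leads to \<open>y\<close> in slot
    \<open>j\<close> and to the curves \<open>xs ! k\<close> in the others.\<close>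
  define z where "z t = ?p + single j (snd c ((xs ! j) t) - snd c e)" for t
  have "(w k \<longlongrightarrow> single k ((vs ! k) c)) (at_right 0)" if "k \<in> set [0..<n]" for k
  proof -
    have "((\<lambda>t. inverse (t ^ \<mu> k) *\<^sub>R h k t) \<longlongrightarrow> (vs ! k) c) (at_right 0)"
      using lim others[of k] that by (cases "k = j") (simp_all add: h_def \<mu>_def asy_def)
    then show ?thesis unfolding w_def by (rule bounded_linear.tendsto[OF bounded_linear_single])
  qed
  note w = this
  have "((\<lambda>t. snd c ((xs ! j) t) - snd c e) \<longlongrightarrow> snd c e - snd c e) (at_right 0)"
    using slot(1) by (intro tendsto_diff tendsto_const) (simp add: conv_def)
  from tendsto_add[OF tendsto_const[of ?p] bounded_linear.tendsto[OF bounded_linear_single this]]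
  have "(z \<longlongrightarrow> ?p + single j (snd c e - snd c e)) (at_right 0)" by (simp only: z_def[abs_def])
  moreover have "?p + single j (snd c e - snd c e) = ?p" by (rule bcontfun_eqI) simp
  ultimately have z: "(z \<longlongrightarrow> ?p) (at_right 0)" by simp
  have \<mu>: "\<mu> k \<ge> 1" for k using m by (simp add: \<mu>_def)
  have main: "((\<lambda>t. inverse (t ^ sum_list (map \<mu> [0..<n])) *\<^sub>R
      idiff ?F (map (\<lambda>k. t ^ \<mu> k *\<^sub>R w k t) [0..<n]) (z t))
      \<longlongrightarrow> iter_deriv ?F (map (\<lambda>k. single k ((vs ! k) c)) [0..<n]) ?p) (at_right 0)"
    by (rule tendsto_idiff[OF S fin_coords_sequences[OF co] determined_by_local_rep[OF co] w \<mu> z])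
  have "sum_list (map \<mu> [0..<n]) = (\<Sum>k\<in>{0..<n}. \<mu> k)"
    by (simp add: interv_sum_list_conv_sum_set_nat)
  also have "\<dots> = \<mu> j + (\<Sum>k\<in>{0..<n} - {j}. \<mu> k)" using j by (intro sum.remove) auto
  also have "(\<Sum>k\<in>{0..<n} - {j}. \<mu> k) = (\<Sum>k\<in>{0..<n} - {j}. 1)"
    by (intro sum.cong) (auto simp: \<mu>_def)
  also have "\<dots> = n - 1" using j by simp
  also have "\<mu> j = m" by (simp add: \<mu>_def)
  finally have exponent: "sum_list (map \<mu> [0..<n]) = n - 1 + m" by simp
  have mem: "\<forall>\<^sub>F t in at_right 0. (\<forall>k\<in>{..<n}. (xs ! k) t \<in> fst c) \<and> y t \<in> fst c"
  proof (intro eventually_conj eventually_ball_finite ballI)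
    fix k assume "k \<in> {..<n}"
    then show "\<forall>\<^sub>F t in at_right 0. (xs ! k) t \<in> fst c"
      using others[of k] slot(1) by (cases "k = j") (auto simp: asy_def conv_def)
  qed (use slot(2) in \<open>auto simp: conv_def\<close>)
  have "\<forall>\<^sub>F t in at_right 0. inverse (t ^ sum_list (map \<mu> [0..<n])) *\<^sub>R
      idiff ?F (map (\<lambda>k. t ^ \<mu> k *\<^sub>R w k t) [0..<n]) (z t)
      = inverse (t ^ (n - 1 + m)) *\<^sub>R
        (snd d (f (map (\<lambda>h. h t) (xs[j := y]))) - snd d (f (map (\<lambda>h. h t) xs)))"
    using mem at_right_0_pos
  proof eventually_elim
    case (elim t)
    \<comment> \<open>The chart \<open>d\<close> need not send 0 to 0. Subtracting this value gives
      a map that vanishes on the faces, and a difference with at least one edge does not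
      change.\<close>
    let ?G = "\<lambda>v. ?F v - snd d 0"
    have G: "?G v = 0" if "k < n" "apply_bcontfun v k = snd c e" for k v
      using local_rep_vanish[OF f(1) ch charts_atD[OF c] that] by simp
    have "t ^ \<mu> k *\<^sub>R w k t = single k (h k t)" for k
      using elim(2) by (simp add: w_def flip: single_scaleR)
    then have "idiff ?F (map (\<lambda>k. t ^ \<mu> k *\<^sub>R w k t) [0..<n]) (z t)
        = idiff ?G (map (\<lambda>k. single k (h k t)) [0..<n]) (z t)"
      using f(2) by (subst idiff_minus_const) auto
    also have "\<dots> = ?G (z t + (\<Sum>k\<in>set [0..<n]. single k (h k t)))
        - (if j \<in> set [0..<n] then ?G (z t + (\<Sum>k\<in>set [0..<n] - {j}. single k (h k t))) else 0)"
      by (rule idiff_faces[OF G]) (auto simp: z_def)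
    also have "\<dots> = ?F (z t + (\<Sum>k\<in>{..<n}. single k (h k t))) - ?F (z t + (\<Sum>k\<in>{..<n} - {j}. single k (h k t)))"
      using j by (simp add: atLeast0LessThan)
    also have "?F (z t + (\<Sum>k\<in>{..<n}. single k (h k t))) = snd d (f (map (\<lambda>h. h t) (xs[j := y])))"
      using elim(1) xs
      by (intro local_rep_eq(2)[OF ch]) (auto simp: z_def h_def nth_list_update)
    also have "?F (z t + (\<Sum>k\<in>{..<n} - {j}. single k (h k t))) = snd d (f (map (\<lambda>h. h t) xs))"
      using elim(1) xs
      by (intro local_rep_eq(2)[OF ch]) (auto simp: z_def h_def)
    finally show ?case by (simp only: exponent)
  qed
  from Lim_transform_eventually[OF main this] show ?thesis
    using d by (simp add: delta_def)
qed

text \<open>The case of \<open>tendsto_slot\<close> in which slot 0 moves away from the constant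
  curve at \<open>e\<close>; there \<open>f\<close> vanishes, so the difference is the value
  itself.\<close>

lemma asy_CR:
  assumes f: "f \<in> CR \<A> e \<B> n" "n \<ge> 1" and c: "c \<in> charts_at \<A> e" and d: "d \<in> charts_at \<B> 0"
    and xs: "length xs = n" "\<And>k. k < n \<Longrightarrow> asy c e 1 (xs ! k) ((vs ! k) c)"
  shows "asy d 0 n (\<lambda>t. f (map (\<lambda>h. h t) xs)) (delta c e \<B> n f vs d)"
proof -
  let ?xs = "xs[0 := (\<lambda>t. e)]"
  have n: "0 < n" using f(2) by simp
  have "((\<lambda>t. inverse (t ^ (n - 1 + 1)) *\<^sub>R
      (snd d (f (map (\<lambda>h. h t) (?xs[0 := xs ! 0]))) - snd d (f (map (\<lambda>h. h t) ?xs))))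
    \<longlongrightarrow> delta c e \<B> n f vs d) (at_right 0)"
  proof (rule tendsto_slot[OF f c d _ n _ _ _ order_refl])
    show "length ?xs = n" using xs by simp
    show "asy c e 1 (?xs ! k) ((vs ! k) c)" if "k < n" "k \<noteq> 0" for k using that xs by simp
    show "conv c e (?xs ! 0)" using n xs(1) conv_const[OF charts_atD[OF c]] by simp
    show "conv c e (xs ! 0)" using asy_conv[OF xs(2)[OF n]] by simp
    show "((\<lambda>t. inverse (t ^ 1) *\<^sub>R (snd c ((xs ! 0) t) - snd c ((?xs ! 0) t))) \<longlongrightarrow> (vs ! 0) c) (at_right 0)"
      using xs(2)[OF n] n xs(1) by (simp add: asy_def)
  qed
  moreover have "f (map (\<lambda>h. h t) ?xs) = 0" for t
    using n xs(1) by (intro CR_vanish[OF f(1)]) (auto simp: map_update intro: set_update_memI)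
  moreover have "conv d 0 (\<lambda>t. f (map (\<lambda>h. h t) xs))"
    using asy_conv[OF xs(2)] by (intro conv_CR[OF f c d xs(1)]) simp
  ultimately show ?thesis using n by (simp add: asy_def conv_def)
qed

text \<open>The two cochain values are in general only of order \<open>n\<close>. Both the action
  and the telescoping sum compare them in a chart with the common curve \<open>f\<close> of the
  tuple without entry \<open>k\<close>, so their chart difference has order \<open>n + 1\<close>,
  and \<open>asy_close_diff\<close> turns it into a difference in \<open>A\<close>.\<close>

lemma asy_dR_term:
  assumes f: "f \<in> CR \<A> e \<B> n" "n \<ge> 1" and c: "c \<in> charts_at \<A> e" and d: "d \<in> charts_at \<B> 0"
    and X: "length X = Suc n" "length us = Suc n" "\<And>i. i \<le> n \<Longrightarrow> vel (X ! i) (us ! i)" and k: "k < n"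
  shows "asy d 0 (Suc n)
    (\<lambda>t. \<rho> (rprod r (take (Suc k) (map (\<lambda>h. h t) X))) (f (del k (map (\<lambda>h. h t) X)))
      - f (take k (map (\<lambda>h. h t) X) @ map (r (map (\<lambda>h. h t) X ! k)) (drop (Suc k) (map (\<lambda>h. h t) X))))
    (act \<A> e \<B> \<rho> (us ! k) (delta c e \<B> n f (del k us)) d
      - (\<Sum>j = Suc k..n. delta c e \<B> n f (del k (us[j := bracket \<A> r e (us ! k) (us ! j)])) d))"
proof -
  define R where "R j t = r ((X ! k) t) ((X ! j) t)" for j t
  \<comment> \<open>In \<open>Y j\<close> the entry \<open>k\<close> is deleted and the entries
    whose original index lies strictly between \<open>k\<close> and \<open>j\<close> are already
    replaced. Original index \<open>Suc l\<close> sits at position \<open>l\<close>, so passing from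
    \<open>Y j\<close> to \<open>Y (Suc j)\<close> changes position \<open>j - 1\<close>.\<close>
  define Y where "Y j = map (\<lambda>l. if l < k then X ! l else if Suc l < j then R (Suc l) else X ! Suc l) [0..<n]" for j
  define V where "V j = del k (us[j := bracket \<A> r e (us ! k) (us ! j)])" for j
  let ?f = "\<lambda>j t. f (map (\<lambda>h. h t) (Y j))"
  have velR: "vel (R j) (us ! j)" if "j \<le> n" for j
    unfolding R_def using k that by (intro vel_r[of _ "us ! k"] X(3)) auto
  have Y: "length (Y j) = n" for j by (simp add: Y_def)
  \<comment> \<open>Replacing an entry by its product does not change its velocity, so all
    intermediate tuples have the same velocities.\<close>
  have Yvel: "vel (Y j ! l) (del k us ! l)" if "l < n" for j l
    using that k X velR by (auto simp: Y_def nth_del)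
  have Ydel: "map (\<lambda>h. h t) (Y (Suc k)) = del k (map (\<lambda>h. h t) X)" for t
    by (rule nth_equalityI) (use k X in \<open>auto simp: Y_def nth_del length_del\<close>)
  have Yr: "map (\<lambda>h. h t) (Y (Suc n)) = take k (map (\<lambda>h. h t) X)
      @ map (r (map (\<lambda>h. h t) X ! k)) (drop (Suc k) (map (\<lambda>h. h t) X))" for t
    by (rule nth_equalityI) (use k X in \<open>auto simp: Y_def R_def nth_append\<close>)
  have step: "((\<lambda>t. inverse (t ^ Suc n) *\<^sub>R (snd d (?f (Suc j) t) - snd d (?f j t)))
      \<longlongrightarrow> delta c e \<B> n f (V j) d) (at_right 0)" if j: "j \<in> {Suc k..n}" for j
  proof -
    have jn: "j - 1 < n" "Suc (j - 1) = j" "k < j" "j \<le> n" using j by auto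
    have Vn: "V j ! l = (if Suc l = j then bracket \<A> r e (us ! k) (us ! j) else del k us ! l)" if "l < n" for l
      using that jn k X by (auto simp: V_def nth_del nth_list_update)
    have "\<not> j - 1 < k" using jn by linarith
    then have Yj: "Y j ! (j - 1) = X ! j" using jn(1,2) by (simp add: Y_def)
    have Ysuc: "Y (Suc j) = (Y j)[j - 1 := R j]"
      by (rule nth_equalityI) (use jn in \<open>auto simp: Y_def nth_list_update\<close>)
    \<comment> \<open>The replaced slot moves by a term of second order, whose coefficient is the
      bracket; the total order is \<open>n - 1 + 2\<close>.\<close>
    have "((\<lambda>t. inverse (t ^ (n - 1 + 2)) *\<^sub>R
        (snd d (f (map (\<lambda>h. h t) ((Y j)[j - 1 := R j]))) - snd d (?f j t)))
      \<longlongrightarrow> delta c e \<B> n f (V j) d) (at_right 0)"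
    proof (rule tendsto_slot[OF f c d Y jn(1)])
      show "asy c e 1 (Y j ! l) ((V j ! l) c)" if "l < n" "l \<noteq> j - 1" for l
        using velD[OF Yvel[OF that(1)] c] Vn[OF that(1)] that by auto
      show "conv c e (Y j ! (j - 1))" unfolding Yj using jn by (intro vel_conv[OF X(3) c])
      show "conv c e (R j)" using jn by (intro vel_conv[OF velR c])
      show "((\<lambda>t. inverse (t ^ 2) *\<^sub>R (snd c (R j t) - snd c ((Y j ! (j - 1)) t))) \<longlongrightarrow> (V j ! (j - 1)) c) (at_right 0)"
        unfolding Yj Vn[OF jn(1)] jn(2) R_def simp_thms(6) if_True
        using k jn by (intro tendsto_bracket X(3) c) auto
    qed simp
    moreover have "n - 1 + 2 = Suc n" using f(2) by simp
    ultimately show ?thesis by (simp only: Ysuc)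
  qed
  have "((\<lambda>t. \<Sum>j = Suc k..n. inverse (t ^ Suc n) *\<^sub>R (snd d (?f (Suc j) t) - snd d (?f j t)))
      \<longlongrightarrow> (\<Sum>j = Suc k..n. delta c e \<B> n f (V j) d)) (at_right 0)"
    by (rule tendsto_sum) (rule step)
  moreover have "(\<Sum>j = Suc k..n. snd d (?f (Suc j) t) - snd d (?f j t)) = snd d (?f (Suc n) t) - snd d (?f (Suc k) t)" for t
    using k by (intro sum_Suc_diff) auto
  ultimately have telescoped: "((\<lambda>t. inverse (t ^ Suc n) *\<^sub>R (snd d (?f (Suc n) t) - snd d (?f (Suc k) t)))
      \<longlongrightarrow> (\<Sum>j = Suc k..n. delta c e \<B> n f (V j) d)) (at_right 0)"
    by (simp only: flip: scaleR_sum_right)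
  let ?P = "\<lambda>t. rprod r (map (\<lambda>h. h t) (take (Suc k) X))"
  have "vel ?P (last (take (Suc k) us))"
    using k X by (intro vel_rprod) auto
  moreover have "last (take (Suc k) us) = us ! k" using k X(2) by (simp add: take_Suc_conv_app_nth)
  ultimately have P: "vel ?P (us ! k)" by simp
  have asyf: "asy b 0 n (?f (Suc k)) (delta c e \<B> n f (del k us) b)" if "b \<in> charts_at \<B> 0" for b
    by (rule asy_CR[OF f c that Y velD[OF Yvel c]])
  note action = tendsto_act[OF P asyf f(2) d]
  have "asy d 0 (Suc n) (\<lambda>t. \<rho> (?P t) (?f (Suc k) t) - ?f (Suc n) t)
      (act \<A> e \<B> \<rho> (us ! k) (delta c e \<B> n f (del k us)) d - (\<Sum>j = Suc k..n. delta c e \<B> n f (V j) d))"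
  proof (rule asy_close_diff[OF d])
    show "conv d 0 (\<lambda>t. \<rho> (?P t) (?f (Suc k) t))"
      by (rule conv_\<rho>[OF c d vel_conv[OF P c] asy_conv[OF asyf[OF d] f(2)]])
    show "conv d 0 (?f (Suc n))"
      by (rule conv_CR[OF f c d Y vel_conv[OF Yvel c]])
    have "((\<lambda>t. inverse (t ^ Suc n) *\<^sub>R (snd d (\<rho> (?P t) (?f (Suc k) t)) - snd d (?f (Suc k) t))
        - inverse (t ^ Suc n) *\<^sub>R (snd d (?f (Suc n) t) - snd d (?f (Suc k) t)))
      \<longlongrightarrow> act \<A> e \<B> \<rho> (us ! k) (delta c e \<B> n f (del k us)) d - (\<Sum>j = Suc k..n. delta c e \<B> n f (V j) d)) (at_right 0)"
      by (rule tendsto_diff[OF action telescoped])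
    then show "((\<lambda>t. inverse (t ^ Suc n) *\<^sub>R (snd d (\<rho> (?P t) (?f (Suc k) t)) - snd d (?f (Suc n) t)))
      \<longlongrightarrow> act \<A> e \<B> \<rho> (us ! k) (delta c e \<B> n f (del k us)) d - (\<Sum>j = Suc k..n. delta c e \<B> n f (V j) d)) (at_right 0)"
      by (simp flip: scaleR_diff_right)
  qed simp
  then show ?thesis by (simp only: Ydel Yr V_def take_map)
qed

end

section \<open>The comparison map\<close>

context lie_rack_module
begin

lemma CR_add:
  assumes n: "n \<ge> 1" and f: "f \<in> CR \<A> e \<B> n" and g: "g \<in> CR \<A> e \<B> n"
  shows "(\<lambda>xs. f xs + g xs) \<in> CR \<A> e \<B> n"
proof (rule CR_I[OF rack_manifold n])
  show "f xs + g xs = 0" if "length xs = n" "e \<in> set xs" for xs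
    using CR_vanish[OF f that] CR_vanish[OF g that] by simp
  show "msmooth_at \<B> (const_bcontfun (snd c e)) (\<lambda>v. f (map (\<lambda>i. cinv c (apply_bcontfun v i)) [0..<n])
      + g (map (\<lambda>i. cinv c (apply_bcontfun v i)) [0..<n]))" if "c \<in> charts_at \<A> e" for c
    by (rule msmooth_add[OF msmooth_CR_coords[OF f n that] msmooth_CR_coords[OF g n that]])
qed

lemma tangent_curves:
  assumes c: "c \<in> charts_at \<A> e" and us: "set us \<subseteq> tangent_space \<A> e"
  obtains X where "length X = length us" "\<And>i. i < length us \<Longrightarrow> vel (X ! i) (us ! i)"
proof
  let ?X = "map (\<lambda>u t. cinv c (snd c e + t *\<^sub>R u c)) us"
  show "length ?X = length us" by simp
  show "vel (?X ! i) (us ! i)" if "i < length us" for i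
    using that us asy_tangent_line[OF rack_manifold c] unfolding vel_def by (simp add: subset_iff)
qed

text \<open>The coordinates in two charts, each defined by an \<open>n\<close>-th derivative, are
  leading coefficients of one curve in \<open>A\<close>; hence the derivative of the chart change
  relates them.\<close>

lemma delta_tangent:
  assumes f: "f \<in> CR \<A> e \<B> n" "n \<ge> 1" and c: "c \<in> charts_at \<A> e"
    and us: "length us = n" "set us \<subseteq> tangent_space \<A> e"
  shows "delta c e \<B> n f us \<in> tangent_space \<B> 0"
proof -
  obtain X where X: "length X = n" "\<And>i. i < n \<Longrightarrow> vel (X ! i) (us ! i)"
    using tangent_curves[OF c us(2)] us(1) by metis
  have asyf: "asy d 0 n (\<lambda>t. f (map (\<lambda>h. h t) X)) (delta c e \<B> n f us d)" if "d \<in> charts_at \<B> 0" for d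
    by (rule asy_CR[OF f c that X(1) velD[OF X(2) c]])
  have "delta c e \<B> n f us d'
      = frechet_derivative (snd d' \<circ> cinv d) (at (snd d 0)) (delta c e \<B> n f us d)"
    if "d \<in> charts_at \<B> 0" "d' \<in> charts_at \<B> 0" for d d'
    by (rule asy_unique[OF asyf[OF that(2)] asy_change_chart[OF module_manifold that f(2) asyf[OF that(1)]]])
  moreover have "delta c e \<B> n f us d = 0" if "d \<notin> charts_at \<B> 0" for d
    using that by (simp add: delta_def)
  ultimately show ?thesis unfolding tangent_space_def by blast
qed

lemma delta_multilinear:
  assumes f: "f \<in> CR \<A> e \<B> n" "n \<ge> 1" and c: "c \<in> charts_at \<A> e"
    and us: "length us = n" and i: "i < n"
  shows "delta c e \<B> n f (us[i := (\<lambda>c. s *\<^sub>R v c + t *\<^sub>R w c)]) d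
    = s *\<^sub>R delta c e \<B> n f (us[i := v]) d + t *\<^sub>R delta c e \<B> n f (us[i := w]) d"
proof (cases "d \<in> charts_at \<B> 0")
  case True
  obtain S where S: "open S" "smooth_on S (local_rep c d n f)" "const_bcontfun (snd c e) \<in> S"
    using local_rep_smooth(1)[OF f c True] smooth_at_def by blast
  have split: "map (\<lambda>k. single k ((us[i := u] ! k) c)) [0..<n]
      = map (\<lambda>k. single k ((us ! k) c)) [0..<i] @ single i (u c) # map (\<lambda>k. single k ((us ! k) c)) [Suc i..<n]" for u
  proof -
    have "[0..<n] = [0..<i] @ i # [Suc i..<n]"
      using i by (metis le_add_same_cancel1 less_imp_add_positive upt_add_eq_append upt_conv_Cons zero_le less_imp_le_nat add_0)
    then show ?thesis using us i by simp
  qed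
  show ?thesis
    using True unfolding delta_def split by (simp add: single_add single_scaleR iter_deriv_slot_linear[OF S])
qed (simp add: delta_def)

lemma delta_CL:
  assumes "f \<in> CR \<A> e \<B> n" "n \<ge> 1" "c \<in> charts_at \<A> e"
  shows "delta c e \<B> n f \<in> CL \<A> e \<B> n"
  unfolding CL_def using delta_tangent[OF assms] delta_multilinear[OF assms] by auto

text \<open>Charts of \<open>A\<close> are not additive, so this is not linearity of the derivative.
  It follows from additivity of leading coefficients along common curves.\<close>

lemma delta_add:
  assumes n: "n \<ge> 1" and c: "c \<in> charts_at \<A> e" and f: "f \<in> CR \<A> e \<B> n" and g: "g \<in> CR \<A> e \<B> n"
    and us: "length us = n" "set us \<subseteq> tangent_space \<A> e"
  shows "delta c e \<B> n (\<lambda>xs. f xs + g xs) us d = delta c e \<B> n f us d + delta c e \<B> n g us d"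
proof (cases "d \<in> charts_at \<B> 0")
  case True
  obtain X where X: "length X = n" "\<And>i. i < n \<Longrightarrow> vel (X ! i) (us ! i)"
    using tangent_curves[OF c us(2)] us(1) by metis
  note asyX = asy_CR[OF _ n c True X(1) velD[OF X(2) c]]
  show ?thesis
    by (rule asy_unique[OF asyX[OF CR_add[OF n f g]] asy_add[OF True n asyX[OF f] asyX[OF g]]])
qed (simp add: delta_def)

end

text \<open>Common ground of the symmetric and the antisymmetric case. The decisive condition is
  \<open>asy_\<psi>\<close>: applying \<psi> raises the order by one, and the new leading
  coefficient is the right action of the velocity of the second argument. The conditions
  \<open>\<psi>_e\<close>, \<open>\<psi>_0\<close> and \<open>msmooth_\<psi>\<close> ensure that
  \<open>D\<close> maps cochains to cochains.\<close>

locale lie_rack_bimodule = lie_rack_module \<A> r e \<B> \<rho>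
  for \<A> :: "('x::{t2_space,second_countable_topology}, 'e::real_normed_vector) chart set"
    and r :: "'x \<Rightarrow> 'x \<Rightarrow> 'x" and e :: 'x
    and \<B> :: "('a::{t2_space,second_countable_topology,ab_group_add}, 'f::real_normed_vector) chart set"
    and \<rho> :: "'x \<Rightarrow> 'a \<Rightarrow> 'a" +
  fixes \<psi> :: "'x \<Rightarrow> 'x \<Rightarrow> 'a \<Rightarrow> 'a"
    and actR :: "('a, 'f) tvec \<Rightarrow> ('x, 'e) tvec \<Rightarrow> ('a, 'f) tvec"
  assumes \<psi>_e: "\<psi> x e a = 0" and \<psi>_0: "\<psi> x y 0 = 0"
    and msmooth_\<psi>: "\<And>(p :: nat \<Rightarrow>\<^sub>C 'e) x y a. msmooth_at \<A> p x \<Longrightarrow> msmooth_at \<A> p y \<Longrightarrow>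
      msmooth_at \<B> p a \<Longrightarrow> msmooth_at \<B> p (\<lambda>q. \<psi> (x q) (y q) (a q))"
    and asy_\<psi>: "\<And>x y \<alpha> u v w m d. vel x u \<Longrightarrow> vel y v \<Longrightarrow>
      (\<And>b. b \<in> charts_at \<B> 0 \<Longrightarrow> asy b 0 m \<alpha> (w b)) \<Longrightarrow> m \<ge> 1 \<Longrightarrow> d \<in> charts_at \<B> 0 \<Longrightarrow>
      asy d 0 (Suc m) (\<lambda>t. \<psi> (x t) (y t) (\<alpha> t)) (actR w v d)"
    and actR_outside: "\<And>w v d. d \<notin> charts_at \<B> 0 \<Longrightarrow> actR w v d = 0"
begin

abbreviation D where "D \<equiv> dR r (\<phi>_mod \<rho>) \<psi>"
abbreviation DL where "DL \<equiv> dL (bracket \<A> r e) (act \<A> e \<B> \<rho>) actR"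

lemma D_Suc:
  assumes "n \<ge> 1"
  shows "D n f xs = (\<Sum>k<n. signed k (\<rho> (rprod r (take (Suc k) xs)) (f (del k xs))
      - f (take k xs @ map (r (xs ! k)) (drop (Suc k) xs))))
    + signed (n - 1) (\<psi> (rprod r (take n xs)) (rprod r (del (n - 1) xs)) (f (take n xs)))"
proof -
  have "(\<Sum>i = 1..n. signed (i - 1) (\<rho> (rprod r (take i xs)) (f (del (i - 1) xs))
      - f (take (i - 1) xs @ map (r (xs ! (i - 1))) (drop i xs))))
    = (\<Sum>k<n. signed k (\<rho> (rprod r (take (Suc k) xs)) (f (del k xs))
      - f (take k xs @ map (r (xs ! k)) (drop (Suc k) xs))))"
    by (rule sum.reindex_bij_witness[of _ Suc "\<lambda>i. i - 1"]) auto
  then show ?thesis by (simp only: dR_def \<phi>_mod_def)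
qed

text \<open>Let entry \<open>i\<close> be \<open>e\<close>. In the summand \<open>k = i\<close> both
  operators are the identity and the two values of \<open>f\<close> cancel. In the others
  \<open>e\<close> is still an argument of \<open>f\<close>, since \<open>r x e = e\<close>. In the
  last term either \<open>f\<close> vanishes or, for \<open>i = n\<close>, the second product ends
  in \<open>e\<close> and equals \<open>e\<close>.\<close>

lemma D_vanish:
  assumes f: "f \<in> CR \<A> e \<B> n" "n \<ge> 1" and xs: "length xs = Suc n" "e \<in> set xs"
  shows "D n f xs = 0"
proof -
  obtain i where i: "i \<le> n" "xs ! i = e" using xs by (metis in_set_conv_nth less_Suc_eq_le)
  note zero = CR_vanish[OF f(1)]
  have del: "f (del k xs) = 0" if "k \<le> n" "k \<noteq> i" for k
  proof (rule zero)
    show "length (del k xs) = n" using xs(1) that by (simp add: length_del)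
    show "e \<in> set (del k xs)"
    proof (cases "i < k")
      case True
      then have "del k xs ! i = e" using nth_del[of k xs i] xs(1) i that by simp
      then show ?thesis using True that xs(1) by (metis diff_Suc_1 le_imp_less_Suc length_del less_le_trans nth_mem)
    next
      case False
      then have "del k xs ! (i - 1) = e" "i - 1 < n" using nth_del[of k xs "i - 1"] xs(1) i that by auto
      then show ?thesis using that xs(1) by (metis diff_Suc_1 le_imp_less_Suc length_del nth_mem)
    qed
  qed
  have "signed k (\<rho> (rprod r (take (Suc k) xs)) (f (del k xs))
      - f (take k xs @ map (r (xs ! k)) (drop (Suc k) xs))) = 0" if k: "k < n" for k
  proof (cases "k = i")
    case True
    have "rprod r (take (Suc k) xs) = e"
      using True i xs(1) by (intro rprod_e) (auto simp: take_Suc_conv_app_nth)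
    moreover have "take k xs @ map (r (xs ! k)) (drop (Suc k) xs) = del k xs"
      using True i by (simp add: del_def map_idI)
    ultimately show ?thesis by (simp add: signed_def)
  next
    case False
    have "f (take k xs @ map (r (xs ! k)) (drop (Suc k) xs)) = 0"
    proof (rule zero)
      show "length (take k xs @ map (r (xs ! k)) (drop (Suc k) xs)) = n" using k xs(1) by simp
      show "e \<in> set (take k xs @ map (r (xs ! k)) (drop (Suc k) xs))"
      proof (cases "i < k")
        case True
        then have "take k xs ! i = e" "i < length (take k xs)" using i k xs(1) by auto
        then have "e \<in> set (take k xs)" by (metis nth_mem)
        then show ?thesis by simp
      next
        case False
        then have "drop (Suc k) xs ! (i - Suc k) = e" "i - Suc k < length (drop (Suc k) xs)"
          using i k xs(1) \<open>k \<noteq> i\<close> by auto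
        then have "e \<in> set (drop (Suc k) xs)" by (metis nth_mem)
        then have "r (xs ! k) e \<in> r (xs ! k) ` set (drop (Suc k) xs)" by (rule imageI)
        then show ?thesis by simp
      qed
    qed
    then show ?thesis using del[of k] k False by (simp add: signed_def)
  qed
  moreover have "\<psi> (rprod r (take n xs)) (rprod r (del (n - 1) xs)) (f (take n xs)) = 0"
  proof (cases "i = n")
    case True
    have "del (n - 1) xs \<noteq> []" using xs(1) f(2) by (simp add: del_def)
    moreover have "last xs = xs ! n" using xs(1) by (cases "xs = []") (auto simp: last_conv_nth)
    then have "last (del (n - 1) xs) = e"
      using True i xs(1) f(2) by (simp add: del_def)
    ultimately show ?thesis using \<psi>_e by (simp add: rprod_e)
  next
    case False
    then have "take n xs ! i = e" "i < length (take n xs)" using i xs(1) by auto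
    then have "e \<in> set (take n xs)" by (metis nth_mem)
    then have "f (take n xs) = 0" using xs(1) by (intro zero) auto
    then show ?thesis using \<psi>_0 by simp
  qed
  ultimately show ?thesis by (simp add: D_Suc[OF f(2)] signed_def)
qed

text \<open>Every summand is composed of smooth operations and \<open>f\<close>. As \<open>f\<close>
  is smooth only near the base point, each argument passed to \<open>f\<close> must also be shown to
  take the value \<open>e\<close> there.\<close>

lemma D_CR:
  assumes f: "f \<in> CR \<A> e \<B> n" "n \<ge> 1"
  shows "D n f \<in> CR \<A> e \<B> (Suc n)"
proof (rule CR_I[OF rack_manifold])
  show "D n f xs = 0" if "length xs = Suc n" "e \<in> set xs" for xs
    by (rule D_vanish[OF f that])
  fix c assume c: "c \<in> charts_at \<A> e"
  let ?p = "const_bcontfun (snd c e) :: nat \<Rightarrow>\<^sub>C 'e"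
  define X where "X = map (\<lambda>i v. cinv c (apply_bcontfun v i)) [0..<Suc n]"
  have X_map: "map (\<lambda>h. h v) X = map (\<lambda>i. cinv c (apply_bcontfun v i)) [0..<Suc n]" for v
    by (simp add: X_def)
  have len: "length X = Suc n" by (simp add: X_def)
  have "msmooth_at \<A> ?p (\<lambda>v. cinv c (apply_bcontfun v i))" for i
  proof (rule msmooth_at_cinv[OF rack_manifold])
    show "smooth_at ?p (\<lambda>v. apply_bcontfun v i)"
      by (rule smooth_at_bounded_linear[OF bounded_linear_apply_bcontfun smooth_at_id])
  qed (use c in \<open>auto simp: charts_at_def\<close>)
  then have X: "msmooth_at \<A> ?p h \<and> h ?p = e" if "h \<in> set X" for h
    using that chart_cinv[OF manifold_chart[OF rack_manifold c] charts_atD[OF c]] unfolding X_def by auto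
  have prod: "msmooth_at \<A> ?p (\<lambda>v. rprod r (map (\<lambda>h. h v) hs))" if "hs \<noteq> []" "set hs \<subseteq> set X" for hs
    using that X by (intro msmooth_rprod) auto
  have val: "msmooth_at \<B> ?p (\<lambda>v. f (map (\<lambda>h. h v) hs))"
    if "length hs = n" "\<And>h. h \<in> set hs \<Longrightarrow> msmooth_at \<A> ?p h \<and> h ?p = e" for hs
    by (rule msmooth_at_CR[OF rack_manifold f that])
  have "msmooth_at \<B> ?p (\<lambda>v. D n f (map (\<lambda>h. h v) X))"
    unfolding D_Suc[OF f(2)]
  proof (rule msmooth_add[OF msmooth_sum[OF msmooth_signed[OF msmooth_diff]] msmooth_signed])
    fix k assume "k \<in> {..<n}"
    then have k: "k < n" by simp
    have "msmooth_at \<B> ?p (\<lambda>v. f (map (\<lambda>h. h v) (del k X)))"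
      using k len X set_del_subset[of k X] by (intro val) (auto simp: length_del)
    moreover have "take (Suc k) X \<noteq> []" using len by auto
    ultimately have "msmooth_at \<B> ?p (\<lambda>v. \<rho> (rprod r (map (\<lambda>h. h v) (take (Suc k) X))) (f (map (\<lambda>h. h v) (del k X))))"
      using set_take_subset[of "Suc k" X] by (intro msmooth_\<rho> prod)
    then show "msmooth_at \<B> ?p (\<lambda>v. \<rho> (rprod r (take (Suc k) (map (\<lambda>h. h v) X))) (f (del k (map (\<lambda>h. h v) X))))"
      by (simp only: take_map map_del)
    let ?hs = "take k X @ map (\<lambda>h v. r ((X ! k) v) (h v)) (drop (Suc k) X)"
    have "X ! k \<in> set X" using k len by simp
    then have "msmooth_at \<A> ?p h \<and> h ?p = e" if "h \<in> set ?hs" for h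
      using that by (auto simp: msmooth_r conjunct1[OF X] conjunct2[OF X] dest!: in_set_takeD in_set_dropD)
    from val[of ?hs, OF _ this] k len
    have "msmooth_at \<B> ?p (\<lambda>v. f (map (\<lambda>h. h v) ?hs))" by simp
    moreover have "map (\<lambda>h. h v) ?hs = take k (map (\<lambda>h. h v) X)
        @ map (r (map (\<lambda>h. h v) X ! k)) (drop (Suc k) (map (\<lambda>h. h v) X))" for v
      using k len by (simp add: take_map drop_map)
    ultimately show "msmooth_at \<B> ?p (\<lambda>v. f (take k (map (\<lambda>h. h v) X)
        @ map (r (map (\<lambda>h. h v) X ! k)) (drop (Suc k) (map (\<lambda>h. h v) X))))" by (simp only:)
  next
    have "del (n - 1) X \<noteq> []" using len f(2) by (simp add: del_def)
    moreover have "msmooth_at \<B> ?p (\<lambda>v. f (map (\<lambda>h. h v) (take n X)))"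
      using len X by (intro val) (auto dest!: in_set_takeD)
    moreover have "take n X \<noteq> []" using len f(2) by auto
    ultimately have "msmooth_at \<B> ?p (\<lambda>v. \<psi> (rprod r (map (\<lambda>h. h v) (take n X)))
        (rprod r (map (\<lambda>h. h v) (del (n - 1) X))) (f (map (\<lambda>h. h v) (take n X))))"
      using set_take_subset[of n X] set_del_subset[of "n - 1" X] by (intro msmooth_\<psi> prod)
    then show "msmooth_at \<B> ?p (\<lambda>v. \<psi> (rprod r (take n (map (\<lambda>h. h v) X)))
        (rprod r (del (n - 1) (map (\<lambda>h. h v) X))) (f (take n (map (\<lambda>h. h v) X))))"
      by (simp only: take_map map_del)
  qed
  then show "msmooth_at \<B> ?p (\<lambda>v. D n f (map (\<lambda>i. cinv c (apply_bcontfun v i)) [0..<Suc n]))"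
    by (simp only: X_map)
qed simp

lemma asy_D:
  assumes f: "f \<in> CR \<A> e \<B> n" "n \<ge> 1" and c: "c \<in> charts_at \<A> e" and d: "d \<in> charts_at \<B> 0"
    and X: "length X = Suc n" "length us = Suc n" "\<And>i. i \<le> n \<Longrightarrow> vel (X ! i) (us ! i)"
  shows "asy d 0 (Suc n) (\<lambda>t. D n f (map (\<lambda>h. h t) X)) (DL n (delta c e \<B> n f) us d)"
proof -
  have Sn: "Suc n \<ge> 1" by simp
  let ?\<omega> = "delta c e \<B> n f"
  let ?V = "\<lambda>k j. ?\<omega> (del k (us[j := bracket \<A> r e (us ! k) (us ! j)])) d"
  have P: "vel (\<lambda>t. rprod r (map (\<lambda>h. h t) (take n X))) (last (take n us))"
    using X f(2) by (intro vel_rprod) auto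
  \<comment> \<open>The last factor of this product is \<open>X ! n\<close>, so the right action is
    by the last argument.\<close>
  have "vel (\<lambda>t. rprod r (map (\<lambda>h. h t) (del (n - 1) X))) (last (del (n - 1) us))"
  proof (rule vel_rprod)
    show "del (n - 1) X \<noteq> []" using X(1) f(2) by (simp add: del_def)
    show "length (del (n - 1) us) = length (del (n - 1) X)" using X by (simp add: length_del)
    show "vel (del (n - 1) X ! i) (del (n - 1) us ! i)" if "i < length (del (n - 1) X)" for i
      using that X by (auto simp: nth_del length_del)
  qed
  moreover have "last us = us ! n" using X(2) by (cases "us = []") (auto simp: last_conv_nth)
  then have "last (del (n - 1) us) = us ! n"
    using X(2) f(2) by (simp add: del_def)
  ultimately have Q: "vel (\<lambda>t. rprod r (map (\<lambda>h. h t) (del (n - 1) X))) (us ! n)" by simp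
  have "asy b 0 n (\<lambda>t. f (map (\<lambda>h. h t) (take n X))) (?\<omega> (take n us) b)" if "b \<in> charts_at \<B> 0" for b
    using X by (intro asy_CR[OF f c that] velD[OF _ c]) auto
  note right = asy_\<psi>[OF P Q this f(2) d]
  have "asy d 0 (Suc n) (\<lambda>t. D n f (map (\<lambda>h. h t) X))
    ((\<Sum>k<n. (- 1) ^ k *\<^sub>R (act \<A> e \<B> \<rho> (us ! k) (?\<omega> (del k us)) d - (\<Sum>j = Suc k..n. ?V k j)))
      + (- 1) ^ (n - 1) *\<^sub>R actR (?\<omega> (take n us)) (us ! n) d)"
    unfolding D_Suc[OF f(2)]
  proof (rule asy_add[OF d Sn asy_sum[OF d Sn asy_signed[OF d Sn]] asy_signed[OF d Sn]])
    show "asy d 0 (Suc n) (\<lambda>t. \<rho> (rprod r (take (Suc k) (map (\<lambda>h. h t) X))) (f (del k (map (\<lambda>h. h t) X)))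
      - f (take k (map (\<lambda>h. h t) X) @ map (r (map (\<lambda>h. h t) X ! k)) (drop (Suc k) (map (\<lambda>h. h t) X))))
      (act \<A> e \<B> \<rho> (us ! k) (?\<omega> (del k us)) d - (\<Sum>j = Suc k..n. ?V k j))" if "k \<in> {..<n}" for k
      using that by (intro asy_dR_term[OF f c d X]) auto
    show "asy d 0 (Suc n) (\<lambda>t. \<psi> (rprod r (take n (map (\<lambda>h. h t) X)))
        (rprod r (del (n - 1) (map (\<lambda>h. h t) X))) (f (take n (map (\<lambda>h. h t) X))))
      (actR (?\<omega> (take n us)) (us ! n) d)"
      using right by (simp only: take_map map_del)
  qed
  moreover have "(\<Sum>k<n. (- 1) ^ k *\<^sub>R (act \<A> e \<B> \<rho> (us ! k) (?\<omega> (del k us)) d - (\<Sum>j = Suc k..n. ?V k j)))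
      + (- 1) ^ (n - 1) *\<^sub>R actR (?\<omega> (take n us)) (us ! n) d = DL n ?\<omega> us d"
  proof -
    \<comment> \<open>The minus sign in front of the telescoped sums turns the sign of summand
      \<open>i\<close> into the \<open>(- 1) ^ (i + 1)\<close> of the bracket terms.\<close>
    have pairs: "{(i, j). i < j \<and> j \<le> n} = (SIGMA i:{..<n}. {Suc i..n})" by auto
    have "(\<Sum>(i, j)\<in>{(i, j). i < j \<and> j \<le> n}. (- 1) ^ (i + 1) *\<^sub>R ?V i j)
        = (\<Sum>i<n. \<Sum>j = Suc i..n. (- 1) ^ (i + 1) *\<^sub>R ?V i j)"
      unfolding pairs by (simp add: sum.Sigma)
    also have "\<dots> = - (\<Sum>i<n. (- 1) ^ i *\<^sub>R (\<Sum>j = Suc i..n. ?V i j))"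
      by (simp add: scaleR_sum_right sum_negf)
    finally show ?thesis
      unfolding dL_def by (simp add: scaleR_diff_right sum_subtractf)
  qed
  ultimately show ?thesis by simp
qed

text \<open>Both sides are leading coefficients of \<open>D n f\<close> along the same curves: the
  left one because \<open>D n f\<close> is itself a cochain, the right one by expanding
  \<open>D n f\<close> into its summands. At charts not around 0 both sides are 0.\<close>

lemma delta_D:
  assumes f: "f \<in> CR \<A> e \<B> n" "n \<ge> 1" and c: "c \<in> charts_at \<A> e"
    and us: "length us = Suc n" "set us \<subseteq> tangent_space \<A> e"
  shows "delta c e \<B> (Suc n) (D n f) us = DL n (delta c e \<B> n f) us"
proof
  fix d
  show "delta c e \<B> (Suc n) (D n f) us d = DL n (delta c e \<B> n f) us d"
  proof (cases "d \<in> charts_at \<B> 0")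
    case True
    obtain X where "length X = length us" "\<And>i. i < length us \<Longrightarrow> vel (X ! i) (us ! i)"
      using tangent_curves[OF c us(2)] by blast
    then have X: "length X = Suc n" "\<And>i. i < Suc n \<Longrightarrow> vel (X ! i) (us ! i)" using us(1) by auto
    have "asy d 0 (Suc n) (\<lambda>t. D n f (map (\<lambda>h. h t) X)) (delta c e \<B> (Suc n) (D n f) us d)"
      by (rule asy_CR[OF D_CR[OF f] _ c True X(1) velD[OF X(2) c]]) simp_all
    moreover have "asy d 0 (Suc n) (\<lambda>t. D n f (map (\<lambda>h. h t) X)) (DL n (delta c e \<B> n f) us d)"
      by (rule asy_D[OF f c True X(1) us(1)]) (simp add: X(2))
    ultimately show ?thesis by (rule asy_unique)
  next
    case False
    then show ?thesis
      by (simp add: delta_def dL_def act_outside actR_outside case_prod_unfold)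
  qed
qed

lemma cochain_morphism:
  assumes n: "n \<ge> 1" and c: "c \<in> charts_at \<A> e"
  shows "cochain_morphism_at \<A> e \<B> D DL (delta c e \<B>) n"
  unfolding cochain_morphism_at_def
  using D_CR[OF _ n] delta_CL[OF _ n c] delta_add[OF n c] delta_D[OF _ n c] by auto

end

text \<open>Since \<open>r x y\<close> has the velocity \<open>v\<close> of \<open>y\<close>,
  subtracting its action from the identity leaves minus the infinitesimal action of
  \<open>v\<close>, which is the right bracket.\<close>

lemma (in lie_rack_module) symmetric_bimodule:
  "lie_rack_bimodule \<A> r e \<B> \<rho> (\<psi>_s r \<rho>) (right_s \<A> e \<B> \<rho>)"
proof (unfold_locales, goal_cases)
  case (3 p x y a)
  then show ?case unfolding \<psi>_s_def by (intro msmooth_diff msmooth_\<rho> msmooth_r)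
next
  case (4 x y \<alpha> u v w m d)
  have xy: "vel (\<lambda>t. r (x t) (y t)) v" by (rule vel_r[OF 4(1,2)])
  obtain c where c: "c \<in> charts_at \<A> e" using manifold_chart_exists[OF rack_manifold] by blast
  note \<alpha> = asy_conv[OF 4(3)[OF 4(5)] 4(4)]
  have "((\<lambda>t. - (inverse (t ^ Suc m) *\<^sub>R (snd d (\<rho> (r (x t) (y t)) (\<alpha> t)) - snd d (\<alpha> t))))
      \<longlongrightarrow> - act \<A> e \<B> \<rho> v w d) (at_right 0)"
    by (rule tendsto_minus[OF tendsto_act[OF xy 4(3,4,5)]])
  then have "((\<lambda>t. inverse (t ^ Suc m) *\<^sub>R (snd d (\<alpha> t) - snd d (\<rho> (r (x t) (y t)) (\<alpha> t))))
      \<longlongrightarrow> - act \<A> e \<B> \<rho> v w d) (at_right 0)"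
    by (simp only: minus_diff_eq flip: scaleR_minus_right)
  then show ?case
    unfolding \<psi>_s_def right_s_def
    by (intro asy_close_diff[OF 4(5) \<alpha> conv_\<rho>[OF c 4(5) vel_conv[OF xy c] \<alpha>]]) simp_all
qed (simp_all add: \<psi>_s_def right_s_def act_outside)

lemma (in lie_rack_module) antisymmetric_bimodule:
  "lie_rack_bimodule \<A> r e \<B> \<rho> \<psi>_a right_a"
  by unfold_locales (simp_all add: \<psi>_a_def right_a_def msmooth_at_const asy_const charts_atD)

theorem proposition3p7:
  fixes \<A> :: "('x::{t2_space,second_countable_topology}, 'e::real_normed_vector) chart set"
    and r :: "'x \<Rightarrow> 'x \<Rightarrow> 'x" and e :: 'x
    and \<B> :: "('a::{t2_space,second_countable_topology,ab_group_add}, 'f::real_normed_vector) chart set"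
    and \<rho> :: "'x \<Rightarrow> 'a \<Rightarrow> 'a"
    and c :: "('x, 'e) chart" and n :: nat
  assumes "lie_rack \<A> r e"
    and "smooth_As_module \<A> r e \<B> \<rho>"
    and "c \<in> charts_at \<A> e"
    and "n \<ge> 1"
  shows "cochain_morphism_at \<A> e \<B>
           (dR r (\<phi>_mod \<rho>) (\<psi>_s r \<rho>))
           (dL (bracket \<A> r e) (act \<A> e \<B> \<rho>) (right_s \<A> e \<B> \<rho>))
           (delta c e \<B>) n
       \<and> cochain_morphism_at \<A> e \<B>
           (dR r (\<phi>_mod \<rho>) \<psi>_a)
           (dL (bracket \<A> r e) (act \<A> e \<B> \<rho>) right_a)
           (delta c e \<B>) n"
proof -
  interpret lie_rack_module \<A> r e \<B> \<rho> using assms(1,2) by unfold_locales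
  show ?thesis
    using lie_rack_bimodule.cochain_morphism[OF symmetric_bimodule assms(4,3)]
      lie_rack_bimodule.cochain_morphism[OF antisymmetric_bimodule assms(4,3)] by simp
qed

end
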